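(* Let $m,n,r\ge1$ be integers. Let $X_{ik}$ ($1\le i\le m$, $1\le k\le r$) be independent copies of a random variable $X$, and let $Y_{jk}$ ($1\le j\le n$, $1\le k\le r$) be independent copies of a random variable $Y$, with the $Y_{jk}$ independent of the $X_{ik}$, where $X$ and $Y$ have zero mean, unit variance and finite sixth moment. Let $W_r=\frac1{\sqrt{mn}}\sum_{i=1}^m\sum_{j=1}^n\sum_{k=1}^rX_{ik}Y_{jk}$. Then, for $h\in C_b^3(\mathbb{R})$, $$|\mathbb{E}h(W_r)-\mathrm{VG}^{r,0}_{1,0}h|\le r\left(\gamma^1_{m,n}(X,Y)M^2_{r,1}(h)+\gamma^2_{m,n}(X,Y)M^3_{r,1}(h)+\gamma^3_{m,n}(X,Y)M^4_{r,1}(h)\right),$$ where $$\gamma^1_{m,n}(X,Y)=\frac{10}{n}|\mathbb{E}Y^3|\mathbb{E}|Y^3|+\frac{11}{\sqrt{mn}}|\mathbb{E}X^3|\mathbb{E}Y^4,$$ $$\gamma^2_{m,n}(X,Y)=\frac9m\mathbb{E}X^4\mathbb{E}Y^4+\frac{30}n|\mathbb{E}Y^3|\mathbb{E}Y^4+\frac{85}{\sqrt{mn}}|\mathbb{E}X^3|\mathbb{E}|Y^5|+\frac{46}{\sqrt{mn}}\mathbb{E}|X^3||\mathbb{E}Y^3|\mathbb{E}Y^4,$$ $$\gamma^3_{m,n}(X,Y)=\frac1n\mathbb{E}X^4\mathbb{E}Y^4(1+15|\mathbb{E}Y^3|)+\frac{284}m|\mathbb{E}X^3|\mathbb{E}|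X^3|\mathbb{E}Y^6+\frac{148}n\mathbb{E}X^4|\mathbb{E}Y^3|\mathbb{E}|Y^5|+\frac{135}{\sqrt{mn}}|\mathbb{E}X^3|\mathbb{E}X^4\mathbb{E}|Y^3|+\frac{248}{\sqrt{mn}}\mathbb{E}X^4|\mathbb{E}Y^3|.$$
   Context: $\|\cdot\|$ is the supremum norm on $\mathbb{R}$; $C_b^3(\mathbb{R})$ is the set of bounded three times continuously differentiable real functions with bounded derivatives up to order three. $\mathrm{VG}^{r,0}_{1,0}h=\mathbb{E}h(Z)$ where $Z\sim\mathrm{VG}_1(r,0,1,0)$, i.e. $Z$ has density $\frac{1}{\sqrt\pi\,\Gamma(r/2)}\left(\frac{|x|}2\right)^{\frac{r-1}2}K_{\frac{r-1}2}(|x|)$ on $\mathbb{R}$ ($K_\nu$ the modified Bessel function of the second kind). With $\tilde h=h-\mathrm{VG}^{r,0}_{1,0}h$ and $c_r=\sqrt{\frac{\pi}{2r}}+\frac1r$, $$M_{r,1}^2(h)=c_r\,[3\|h'\|+4\|\tilde h\|],\quad M_{r,1}^3(h)=c_r\,[5\|h''\|+18\|h'\|+19\|\tilde h\|],$$ $$M_{r,1}^4(h)=c_r\,[8\|h^{(3)}\|+52\|h''\|+124\|h'\|+124\|\tilde h\|].$$ *)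

theory Defs
  imports "HOL-Probability.Probability"
begin

definition supnorm :: "(real \<Rightarrow> real) \<Rightarrow> real" where
  "supnorm f = (SUP x. \<bar>f x\<bar>)"

text \<open>Derivatives are iterated with the total function \<^const>\<open>deriv\<close>, so
  \<^term>\<open>(deriv ^^ k) h\<close> is meaningful only in the presence of the differentiability clause.\<close>

definition Cb3 :: "(real \<Rightarrow> real) set" where
  "Cb3 = {h. (\<forall>k<3. \<forall>x. (deriv ^^ k) h differentiable (at x)) \<and>
             continuous_on UNIV ((deriv ^^ 3) h) \<and>
             (\<forall>k\<le>3. bounded (range ((deriv ^^ k) h)))}"

text \<open>For \<open>x > 0\<close>, the modified Bessel function of the second kind, by its integral
  representation \<open>K\<^sub>\<nu>(x) = \<integral>\<^sub>0\<^sup>\<infinity> exp (- x cosh t) cosh (\<nu> t) dt\<close>.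
  The integral diverges for \<open>x \<le> 0\<close>, where this function takes the junk value \<open>0\<close>.\<close>

definition bessel_K :: "real \<Rightarrow> real \<Rightarrow> real" where
  "bessel_K \<nu> x = (LINT t:{0..}|lborel. exp (- x * cosh t) * cosh (\<nu> * t))"

text \<open>The law \<open>VG\<^sub>1(r,0,1,0)\<close>. The value of the density at the single point \<open>x = 0\<close>
  (where \<^const>\<open>bessel_K\<close> is junk) is irrelevant to the measure.\<close>

definition VG_density :: "real \<Rightarrow> real \<Rightarrow> real" where
  "VG_density r x = 1 / (sqrt pi * Gamma (r / 2)) * (\<bar>x\<bar> / 2) powr ((r - 1) / 2)
                      * bessel_K ((r - 1) / 2) \<bar>x\<bar>"

definition VG_law :: "real \<Rightarrow> real measure" where
  "VG_law r = density lborel (\<lambda>x. ennreal (VG_density r x))"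

definition VG :: "real \<Rightarrow> (real \<Rightarrow> real) \<Rightarrow> real" where
  "VG r h = (\<integral>x. h x \<partial>VG_law r)"

definition centred :: "real \<Rightarrow> (real \<Rightarrow> real) \<Rightarrow> real \<Rightarrow> real" where
  "centred r h = (\<lambda>x. h x - VG r h)"

definition c_const :: "real \<Rightarrow> real" where
  "c_const r = sqrt (pi / (2 * r)) + 1 / r"

definition M2 :: "real \<Rightarrow> (real \<Rightarrow> real) \<Rightarrow> real" where
  "M2 r h = c_const r * (3 * supnorm (deriv h) + 4 * supnorm (centred r h))"

definition M3 :: "real \<Rightarrow> (real \<Rightarrow> real) \<Rightarrow> real" where
  "M3 r h = c_const r * (5 * supnorm ((deriv ^^ 2) h) + 18 * supnorm (deriv h)
                           + 19 * supnorm (centred r h))"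

definition M4 :: "real \<Rightarrow> (real \<Rightarrow> real) \<Rightarrow> real" where
  "M4 r h = c_const r * (8 * supnorm ((deriv ^^ 3) h) + 52 * supnorm ((deriv ^^ 2) h)
                           + 124 * supnorm (deriv h) + 124 * supnorm (centred r h))"

definition moment :: "'a measure \<Rightarrow> ('a \<Rightarrow> real) \<Rightarrow> nat \<Rightarrow> real" where
  "moment A X p = (\<integral>\<omega>. X \<omega> ^ p \<partial>A)"

definition abs_moment :: "'a measure \<Rightarrow> ('a \<Rightarrow> real) \<Rightarrow> nat \<Rightarrow> real" where
  "abs_moment A X p = (\<integral>\<omega>. \<bar>X \<omega> ^ p\<bar> \<partial>A)"

definition gamma1 ::
  "nat \<Rightarrow> nat \<Rightarrow> 'a measure \<Rightarrow> ('a \<Rightarrow> real) \<Rightarrow> 'b measure \<Rightarrow> ('b \<Rightarrow> real) \<Rightarrow> real" where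
  "gamma1 m n A X B Y =
     10 / real n * \<bar>moment B Y 3\<bar> * abs_moment B Y 3
     + 11 / sqrt (real m * real n) * \<bar>moment A X 3\<bar> * moment B Y 4"

definition gamma2 ::
  "nat \<Rightarrow> nat \<Rightarrow> 'a measure \<Rightarrow> ('a \<Rightarrow> real) \<Rightarrow> 'b measure \<Rightarrow> ('b \<Rightarrow> real) \<Rightarrow> real" where
  "gamma2 m n A X B Y =
     9 / real m * moment A X 4 * moment B Y 4
     + 30 / real n * \<bar>moment B Y 3\<bar> * moment B Y 4
     + 85 / sqrt (real m * real n) * \<bar>moment A X 3\<bar> * abs_moment B Y 5
     + 46 / sqrt (real m * real n) * abs_moment A X 3 * \<bar>moment B Y 3\<bar> * moment B Y 4"

definition gamma3 ::
  "nat \<Rightarrow> nat \<Rightarrow> 'a measure \<Rightarrow> ('a \<Rightarrow> real) \<Rightarrow> 'b measure \<Rightarrow> ('b \<Rightarrow> real) \<Rightarrow> real" where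
  "gamma3 m n A X B Y =
     1 / real n * moment A X 4 * moment B Y 4 * (1 + 15 * \<bar>moment B Y 3\<bar>)
     + 284 / real m * \<bar>moment A X 3\<bar> * abs_moment A X 3 * moment B Y 6
     + 148 / real n * moment A X 4 * \<bar>moment B Y 3\<bar> * abs_moment B Y 5
     + 135 / sqrt (real m * real n) * \<bar>moment A X 3\<bar> * moment A X 4 * abs_moment B Y 3
     + 248 / sqrt (real m * real n) * moment A X 4 * \<bar>moment B Y 3\<bar>"

definition W ::
  "nat \<Rightarrow> nat \<Rightarrow> nat \<Rightarrow> (nat \<Rightarrow> nat \<Rightarrow> 'a \<Rightarrow> real) \<Rightarrow> (nat \<Rightarrow> nat \<Rightarrow> 'a \<Rightarrow> real) \<Rightarrow> 'a \<Rightarrow> real" where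
  "W m n r X Y = (\<lambda>\<omega>. 1 / sqrt (real m * real n) *
     (\<Sum>i=1..m. \<Sum>j=1..n. \<Sum>k=1..r. X i k \<omega> * Y j k \<omega>))"

end

(* Conditionally on the V_k = n^(-1/2) sum_j Y_jk, the statistic W = sum_k V_k U_k, where
   U_k = m^(-1/2) sum_i X_ik, is a weighted sum of independent variables. Stein's method for the
   normal law gives the Edgeworth expansion
     E h(sum_k a_k U_k) = E h(sum_k a_k N_k)
        + E X^3 / (6 sqrt m) * E [h(sum_k a_k N_k) * sum_k (N_k^3 - 3 N_k)] + O(E X^4 / m)
   for fixed weights a, with N a standard Gaussian vector and an error that involves only the sup norms
   of h, h' and h''. Replacing first U by N (with a = V) and then V by N' (with a = N), both main terms
   become E h(sum_k N_k N'_k), which is the VG expectation, because sum_k N_k N'_k is |N| times a standard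
   normal variable and |N|^2 is chi-squared. The cubic corrections vanish to the required order: once
   V is replaced by N' they are odd in N. The constants of the theorem leave ample room. *)

theory Submission
  imports Defs
begin

text \<open>Conditioning means that only the Stein equation of the normal law is solved; the VG law
  is identified afterwards. The price is that the weights are random and that s, the square root of
  the sum of their squares, may be close to 0. Rescaling to unit variance divides by powers of s, so
  the estimates are arranged to let these powers cancel against the sum of fourth powers of the
  weights, which has a finite mean; no negative moment of s is taken. The cubic correction is
  written with the polynomial sum_k (N_k^3 - 3 N_k), which does not depend on the weights. Hence
  Fubini can exchange V and N, and the correction left by the first replacement can itself be
  expanded. Averaged over the weights, the errors grow like sqrt r, and so does r * c_r = sqrt (pi r
  / 2) + 1; this matches the prefactors of the theorem. The error of order 1/m goes into the summand
  with 9/m of gamma^2, the error of order 1/n into the one with 1/n of gamma^3, and the mixed error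
  into the one with 135 / sqrt (mn).\<close>

section \<open>Stein's equation for the standard normal law\<close>

text \<open>The decay condition excludes the multiples of \<open>exp (x\<^sup>2 / 2)\<close> among
  the solutions, and comparison with a rational barrier replaces Mills ratio estimates. The bound
  keeps its decay in \<open>x\<close> because it must also control \<open>x * F x\<close>, and
  thereby the derivative.\<close>

lemma stein_barrier_half:
  fixes F k :: "real \<Rightarrow> real"
  assumes F: "\<And>x. (F has_real_derivative x * F x + k x) (at x)"
    and k: "\<And>x. \<bar>k x\<bar> \<le> K"
    and lim: "((\<lambda>x. F x * exp (- x\<^sup>2 / 2)) \<longlongrightarrow> 0) at_top"
    and x: "x \<ge> 0"
  shows "F x \<le> 2 * K / (x + 1)"
proof -
  \<comment> \<open>\<open>B y = 2 * K / (y + 1)\<close> satisfies \<open>y * B y - B' y \<ge> K\<close>, which makes \<open>\<psi>\<close> nondecreasing.\<close>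
  define \<psi> where "\<psi> = (\<lambda>y. (F y - 2 * K / (y + 1)) * exp (- y\<^sup>2 / 2))"
  have K0: "K \<ge> 0" using k[of 0] by linarith
  have deriv: "(\<psi> has_real_derivative (k y + 2 * K / (y + 1)\<^sup>2 + 2 * K * y / (y + 1)) * exp (- y\<^sup>2 / 2)) (at y)"
    if "y \<ge> 0" for y
    unfolding \<psi>_def
    by (rule derivative_eq_intros F refl | use that in \<open>simp; fail\<close>)+
       (use that in \<open>simp add: field_simps power2_eq_square\<close>)
  have nonneg: "k y + 2 * K / (y + 1)\<^sup>2 + 2 * K * y / (y + 1) \<ge> 0" if "y \<ge> 0" for y
  proof -
    have "2 * K / (y + 1)\<^sup>2 + 2 * K * y / (y + 1) - K = K * ((1 + y\<^sup>2) / (y + 1)\<^sup>2)"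
      using that by (simp add: divide_simps) (simp add: algebra_simps power2_eq_square)
    moreover have "K * ((1 + y\<^sup>2) / (y + 1)\<^sup>2) \<ge> 0" using K0 by simp
    ultimately show ?thesis using k[of y] by linarith
  qed
  have mono: "\<psi> x \<le> \<psi> y" if "x \<le> y" for y
    by (rule DERIV_nonneg_imp_nondecreasing[OF that])
       (use deriv nonneg x in \<open>meson exp_ge_zero mult_nonneg_nonneg order_trans\<close>)
  have "((\<lambda>y. F y * exp (- y\<^sup>2 / 2) - 2 * K / (y + 1) * exp (- y\<^sup>2 / 2)) \<longlongrightarrow> 0 - 0) at_top"
    by (intro tendsto_diff lim) real_asymp
  then have "(\<psi> \<longlongrightarrow> 0) at_top"
    by (simp add: \<psi>_def left_diff_distrib)
  then have "\<psi> x \<le> 0"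
    by (rule tendsto_lowerbound) (auto simp: eventually_at_top_linorder intro!: exI[of _ x] mono)
  then show ?thesis by (simp add: \<psi>_def mult_le_0_iff)
qed

text \<open>Each of \<open>F\<close>, its negative and their reflections at 0 solves an equation of
  the same type, so the one-sided estimate covers all signs. The factor |x| / (|x| + 1) is at most
  1, which bounds \<open>x * F x\<close> by \<open>2 * K\<close>; adding \<open>k x\<close> costs
  one more \<open>K\<close>.\<close>

lemma stein_barrier:
  fixes F k :: "real \<Rightarrow> real"
  assumes F: "\<And>x. (F has_real_derivative x * F x + k x) (at x)"
    and k: "\<And>x. \<bar>k x\<bar> \<le> K"
    and lim: "((\<lambda>x. F x * exp (- x\<^sup>2 / 2)) \<longlongrightarrow> 0) at_top" "((\<lambda>x. F x * exp (- x\<^sup>2 / 2)) \<longlongrightarrow> 0) at_bot"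
  shows "\<bar>F x\<bar> \<le> 2 * K" and "\<bar>x * F x + k x\<bar> \<le> 3 * K"
proof -
  have K0: "K \<ge> 0" using k[of 0] by linarith
  have D: "((\<lambda>x. F (- x)) has_real_derivative - (- x * F (- x) + k (- x))) (at x)" for x
    using DERIV_chain'[OF DERIV_minus[OF DERIV_ident] F, of x] by simp
  have lim': "((\<lambda>x. F (- x) * exp (- x\<^sup>2 / 2)) \<longlongrightarrow> 0) at_top"
    using lim(2) unfolding at_bot_mirror filterlim_filtermap by simp
  have half: "\<bar>F y\<bar> \<le> 2 * K / (y + 1) \<and> \<bar>F (- y)\<bar> \<le> 2 * K / (y + 1)" if "y \<ge> 0" for y
  proof -
    have "F y \<le> 2 * K / (y + 1)"
      by (rule stein_barrier_half[OF F k lim(1) that])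
    moreover have "- F y \<le> 2 * K / (y + 1)"
      by (rule stein_barrier_half[where k = "\<lambda>x. - k x"])
         (use k that tendsto_minus[OF lim(1)] DERIV_minus[OF F] in auto)
    moreover have "F (- y) \<le> 2 * K / (y + 1)"
      by (rule stein_barrier_half[where k = "\<lambda>x. - k (- x)", OF _ _ lim' that])
         (use k D in auto)
    moreover have "- F (- y) \<le> 2 * K / (y + 1)"
      by (rule stein_barrier_half[where k = "\<lambda>x. k (- x)"])
         (use k that tendsto_minus[OF lim'] DERIV_minus[OF D] in auto)
    ultimately show ?thesis by (auto simp: abs_le_iff)
  qed
  have *: "\<bar>F x\<bar> \<le> 2 * K / (\<bar>x\<bar> + 1)"
    using half[of "\<bar>x\<bar>"] by (auto simp: abs_if split: if_splits)
  show "\<bar>F x\<bar> \<le> 2 * K"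
    using K0 by (intro order_trans[OF *]) (simp add: divide_simps algebra_simps)
  have "\<bar>x * F x\<bar> \<le> \<bar>x\<bar> * (2 * K / (\<bar>x\<bar> + 1))"
    unfolding abs_mult by (intro mult_left_mono *) auto
  also have "\<dots> \<le> 2 * K"
    using K0 by (simp add: divide_simps algebra_simps)
  finally show "\<bar>x * F x + k x\<bar> \<le> 3 * K" using k[of x] by linarith
qed

text \<open>Provides the decay that \<open>stein_barrier\<close> asks for when it is applied to a
  derivative of a solution that is already known to be bounded.\<close>

lemma bounded_times_gauss_tendsto_0:
  fixes F :: "real \<Rightarrow> real"
  assumes "\<And>x. \<bar>F x\<bar> \<le> C"
  shows "((\<lambda>x. F x * exp (- x\<^sup>2 / 2)) \<longlongrightarrow> 0) at_top" "((\<lambda>x. F x * exp (- x\<^sup>2 / 2)) \<longlongrightarrow> 0) at_bot"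
proof -
  have "\<bar>F x * exp (- x\<^sup>2 / 2)\<bar> \<le> C * exp (- x\<^sup>2 / 2)" for x
    using assms[of x] by (simp add: abs_mult)
  moreover have "((\<lambda>x. C * exp (- x\<^sup>2 / 2)) \<longlongrightarrow> 0) at_top" by real_asymp
  moreover have "((\<lambda>x. C * exp (- x\<^sup>2 / 2)) \<longlongrightarrow> 0) at_bot" by real_asymp
  ultimately show "((\<lambda>x. F x * exp (- x\<^sup>2 / 2)) \<longlongrightarrow> 0) at_top" "((\<lambda>x. F x * exp (- x\<^sup>2 / 2)) \<longlongrightarrow> 0) at_bot"
    by (simp_all add: Lim_null_comparison[where g = "\<lambda>x. C * exp (- x\<^sup>2 / 2)"] always_eventually)
qed

text \<open>Variation of constants: \<open>exp (- x\<^sup>2 / 2)\<close> is an integrating factor,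
  and the constant of integration is chosen to give the decay.\<close>

lemma stein_solution:
  fixes g :: "real \<Rightarrow> real"
  assumes cont: "continuous_on UNIV g" and B: "\<And>x. \<bar>g x\<bar> \<le> B"
  obtains f where
    "\<And>x. (f has_real_derivative x * f x + (g x - integral\<^sup>L std_normal_distribution g)) (at x)"
    "((\<lambda>x. f x * exp (- x\<^sup>2 / 2)) \<longlongrightarrow> 0) at_top" "((\<lambda>x. f x * exp (- x\<^sup>2 / 2)) \<longlongrightarrow> 0) at_bot"
proof -
  define c where "c = integral\<^sup>L std_normal_distribution g"
  define q where "q = (\<lambda>t. (g t - c) * exp (- t\<^sup>2 / 2))"
  have [measurable]: "g \<in> borel_measurable borel" using cont by (rule borel_measurable_continuous_onI)
  have contq: "continuous_on A q" for A
    unfolding q_def by (intro continuous_intros continuous_on_subset[OF cont]) auto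
  have gint: "integrable std_normal_distribution g"
  proof -
    interpret real_distribution std_normal_distribution by (rule real_dist_normal_dist)
    show ?thesis by (rule integrable_const_bound[where B = B]) (use B in auto)
  qed
  have i: "integrable lborel (\<lambda>x. std_normal_density x * (g x - c))"
    and z: "(\<integral>x. std_normal_density x * (g x - c) \<partial>lborel) = 0"
  proof -
    interpret real_distribution std_normal_distribution by (rule real_dist_normal_dist)
    have "integrable std_normal_distribution (\<lambda>x. g x - c)" using gint by auto
    then show "integrable lborel (\<lambda>x. std_normal_density x * (g x - c))"
      by (subst (asm) integrable_density) auto
    have "(\<integral>x. g x - c \<partial>std_normal_distribution) = 0"
      using gint by (simp add: c_def prob_space[simplified])
    then show "(\<integral>x. std_normal_density x * (g x - c) \<partial>lborel) = 0"
      by (subst (asm) integral_density) auto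
  qed
  then have qint: "integrable lborel q" and q0: "integral\<^sup>L lborel q = 0"
  proof -
    have *: "q = (\<lambda>x. sqrt (2 * pi) * (std_normal_density x * (g x - c)))"
      by (auto simp: q_def std_normal_density_def)
    show "integrable lborel q" unfolding * using i by (rule integrable_mult_right)
    show "integral\<^sup>L lborel q = 0" unfolding * by (simp add: z)
  qed
  have qs: "set_integrable lborel A q" if "A \<in> sets borel" for A
    using that integrable_mult_indicator[OF _ qint, of A] by (simp add: set_integrable_def)
  define P where "P = (\<lambda>x::real. LBINT t=0..x. q t)"
  have DP: "(P has_real_derivative q x) (at x)" for x
  proof -
    \<comment> \<open>The interval contains 0 and has \<open>x\<close> in its interior, so the
      derivative within it becomes a derivative at \<open>x\<close>.\<close>
    have "((\<lambda>u::real. LBINT y=0..u. q y) has_vector_derivative q x) (at x within {-\<bar>x\<bar>-1..\<bar>x\<bar>+1})"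
      using interval_integral_FTC2[of "-\<bar>x\<bar>-1" 0 "\<bar>x\<bar>+1" q x] contq by (simp add: zero_ereal_def)
    then have "((\<lambda>u::real. LBINT y=0..u. q y) has_vector_derivative q x) (at x within {-\<bar>x\<bar>-1<..<\<bar>x\<bar>+1})"
      by (rule has_vector_derivative_within_subset) auto
    then show ?thesis unfolding P_def
      by (subst (asm) has_vector_derivative_within_open)
         (auto simp: has_real_derivative_iff_has_vector_derivative)
  qed
  \<comment> \<open>Centring makes the total integral of \<open>q\<close> vanish, so the integrals
    over the two half-lines are opposite. Hence \<open>P\<close> has the same limit
    \<open>cp\<close> at both ends, and subtracting this one constant gives decay on both
    sides.\<close>
  define cp where "cp = (LBINT x:{0..}. q x)"
  have "(LBINT x:{0..} \<union> {..0}. q x) = cp + (LBINT x:{..0}. q x)"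
    unfolding cp_def
    by (rule set_integral_Un_AE) (auto intro: qs intro!: AE_I[where N = "{0}"] split: if_splits)
  moreover have "({0..} \<union> {..0} :: real set) = UNIV" by auto
  ultimately have cpm: "(LBINT x:{..0}. q x) = - cp" using q0 by (simp add: set_lebesgue_integral_def)
  have "((\<lambda>b. LBINT x:{0..b}. q x) \<longlongrightarrow> cp) at_top"
    unfolding cp_def by (intro tendsto_set_lebesgue_integral_at_top qs) auto
  moreover have "\<forall>\<^sub>F b in at_top. (LBINT x:{0..b}. q x) = P b"
    using eventually_ge_at_top[of 0]
    by eventually_elim (simp add: P_def zero_ereal_def interval_integral_Icc)
  ultimately have lt: "(P \<longlongrightarrow> cp) at_top" by (rule Lim_transform_eventually)
  have "((\<lambda>b. - (LBINT x:{b..0}. q x)) \<longlongrightarrow> - (- cp)) at_bot"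
    unfolding cpm[symmetric] by (intro tendsto_minus tendsto_set_lebesgue_integral_at_bot qs) auto
  moreover have "\<forall>\<^sub>F b in at_bot. - (LBINT x:{b..0}. q x) = P b"
    using eventually_le_at_bot[of 0]
    by eventually_elim
       (simp add: P_def zero_ereal_def interval_integral_Icc interval_integral_endpoints_reverse[of "ereal 0"])
  ultimately have lb: "(P \<longlongrightarrow> cp) at_bot" by (auto intro: Lim_transform_eventually)
  define f where "f = (\<lambda>x. (P x - cp) * exp (x\<^sup>2 / 2))"
  show thesis
  proof (rule that[of f])
    show "(f has_real_derivative x * f x + (g x - integral\<^sup>L std_normal_distribution g)) (at x)" for x
      unfolding f_def
      by (rule derivative_eq_intros DP refl | simp)+
         (simp add: q_def c_def[symmetric] algebra_simps flip: exp_add)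
    have *: "(\<lambda>x. f x * exp (- x\<^sup>2 / 2)) = (\<lambda>x. P x - cp)"
      by (simp add: f_def mult.assoc flip: exp_add)
    show "((\<lambda>x. f x * exp (- x\<^sup>2 / 2)) \<longlongrightarrow> 0) at_top" "((\<lambda>x. f x * exp (- x\<^sup>2 / 2)) \<longlongrightarrow> 0) at_bot"
      unfolding * using tendsto_diff[OF lt tendsto_const[of cp]] tendsto_diff[OF lb tendsto_const[of cp]]
      by auto
  qed
qed

section \<open>Gaussian integration by parts and Hermite polynomials\<close>

lemma integrable_gauss_poly_bound:
  fixes u :: "real \<Rightarrow> real"
  assumes [measurable]: "u \<in> borel_measurable borel" and u: "\<And>x. \<bar>u x\<bar> \<le> C * (1 + x ^ (2 * n))"
  shows "integrable std_normal_distribution u"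
proof (rule Bochner_Integration.integrable_bound)
  interpret real_distribution std_normal_distribution by (rule real_dist_normal_dist)
  show "integrable std_normal_distribution (\<lambda>x. C * (1 + x ^ (2 * n)))"
    using integrable_std_normal_distribution_moment[of "2 * n"] by auto
  show "AE x in std_normal_distribution. norm (u x) \<le> norm (C * (1 + x ^ (2 * n)))"
    using u by (intro always_eventually allI) (smt (verit) real_norm_def)
qed auto

text \<open>The function \<open>(u' x - x * u x) * \<phi> x\<close> is the derivative of
  \<open>u x * \<phi> x\<close>, which vanishes at both infinities. Polynomial growth is allowed
  because \<open>u\<close> will be a bounded function times a Hermite polynomial.\<close>

lemma gauss_integration_by_parts:
  fixes u u' :: "real \<Rightarrow> real"
  assumes D: "\<And>x. (u has_real_derivative u' x) (at x)" and cont: "continuous_on UNIV u'"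
    and u: "\<And>x. \<bar>u x\<bar> \<le> C * (1 + x ^ 4)" and u': "\<And>x. \<bar>u' x\<bar> \<le> C * (1 + x ^ 4)"
  shows "integrable std_normal_distribution u'"
    and "integrable std_normal_distribution (\<lambda>x. x * u x)"
    and "(\<integral>x. x * u x \<partial>std_normal_distribution) = integral\<^sup>L std_normal_distribution u'"
proof -
  interpret real_distribution std_normal_distribution by (rule real_dist_normal_dist)
  have C0: "C \<ge> 0" using u[of 0] by simp
  have cu: "continuous_on UNIV u" by (intro DERIV_continuous_on) (use D in auto)
  have [measurable]: "u' \<in> borel_measurable borel" "u \<in> borel_measurable borel"
    using cont cu by (auto intro: borel_measurable_continuous_onI)
  show i1: "integrable std_normal_distribution u'"
    by (rule integrable_gauss_poly_bound[where n = 2 and C = C]) (use u' in auto)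
  have "\<bar>x * u x\<bar> \<le> (2 * C) * (1 + x ^ (2 * 3))" for x
  proof -
    have "\<bar>x\<bar> * (1 + \<bar>x\<bar> ^ 4) \<le> 2 * (1 + \<bar>x\<bar> ^ 6)"
    proof (cases "\<bar>x\<bar> \<le> 1")
      case True
      then have "\<bar>x\<bar> ^ 4 \<le> 1" by (intro power_le_one) auto
      then have "\<bar>x\<bar> * (1 + \<bar>x\<bar> ^ 4) \<le> 1 * 2" using True by (intro mult_mono) auto
      also have "\<dots> \<le> 2 * (1 + \<bar>x\<bar> ^ 6)" by simp
      finally show ?thesis .
    next
      case False
      then have "\<bar>x\<bar> \<le> \<bar>x\<bar> ^ 6" "\<bar>x\<bar> ^ 5 \<le> \<bar>x\<bar> ^ 6"
        using power_increasing[of 1 6 "\<bar>x\<bar>"] power_increasing[of 5 6 "\<bar>x\<bar>"] by auto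
      then show ?thesis by (simp add: algebra_simps eval_nat_numeral)
    qed
    then have "C * (\<bar>x\<bar> * (1 + \<bar>x\<bar> ^ 4)) \<le> C * (2 * (1 + \<bar>x\<bar> ^ 6))"
      by (rule mult_left_mono[OF _ C0])
    moreover have "\<bar>x * u x\<bar> \<le> \<bar>x\<bar> * (C * (1 + x ^ 4))"
      unfolding abs_mult by (rule mult_left_mono[OF u]) simp
    ultimately show ?thesis by (simp add: algebra_simps power_even_abs)
  qed
  then show i2: "integrable std_normal_distribution (\<lambda>x. x * u x)"
    by (intro integrable_gauss_poly_bound[where n = 3 and C = "2 * C"]) auto
  define \<phi> where "\<phi> = std_normal_density"
  have D\<phi>: "(\<phi> has_real_derivative - x * \<phi> x) (at x)" for x
    unfolding \<phi>_def std_normal_density_def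
    by (rule derivative_eq_intros refl | simp)+
  have c\<phi>: "continuous_on UNIV \<phi>" by (intro DERIV_continuous_on) (use D\<phi> in auto)
  define q where "q = (\<lambda>x. (u' x - x * u x) * \<phi> x)"
  have qint: "integrable lborel q" and qI: "integral\<^sup>L lborel q = (\<integral>x. u' x - x * u x \<partial>std_normal_distribution)"
  proof -
    have "integrable std_normal_distribution (\<lambda>x. u' x - x * u x)" using i1 i2 by auto
    then show "integrable lborel q"
      by (subst (asm) integrable_density) (auto simp: q_def \<phi>_def mult.commute)
    show "integral\<^sup>L lborel q = (\<integral>x. u' x - x * u x \<partial>std_normal_distribution)"
      by (subst integral_density) (auto simp: q_def \<phi>_def mult.commute)
  qed
  have bnd: "\<bar>u x * \<phi> x\<bar> \<le> C * (1 + x ^ 4) * ((1 / sqrt (2 * pi)) * exp (- x\<^sup>2 / 2))" for x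
  proof -
    have "\<phi> x > 0" by (simp add: \<phi>_def normal_density_pos)
    then have "\<bar>u x * \<phi> x\<bar> \<le> C * (1 + x ^ 4) * \<phi> x"
      using u[of x] by (simp add: abs_mult)
    then show ?thesis by (simp add: \<phi>_def std_normal_density_def)
  qed
  have "(LBINT x=-\<infinity>..\<infinity>. q x) = 0 - 0"
  proof (rule interval_integral_FTC_integrable)
    show "((\<lambda>x. u x * \<phi> x) has_vector_derivative q x) (at x)" for x
      unfolding q_def has_real_derivative_iff_has_vector_derivative[symmetric]
      by (rule derivative_eq_intros D D\<phi> refl | simp add: algebra_simps)+
    show "isCont q x" for x
      unfolding q_def using cont cu c\<phi>
      by (intro continuous_intros) (auto simp: continuous_on_eq_continuous_at)
    show "set_integrable lborel (einterval (- \<infinity>) \<infinity>) q"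
      using qint by (simp add: set_integrable_def)
    have "((\<lambda>x. C * (1 + x ^ 4) * ((1 / sqrt (2 * pi)) * exp (- x\<^sup>2 / 2))) \<longlongrightarrow> 0) at_bot"
      "((\<lambda>x. C * (1 + x ^ 4) * ((1 / sqrt (2 * pi)) * exp (- x\<^sup>2 / 2))) \<longlongrightarrow> 0) at_top"
      by real_asymp+
    then have "((\<lambda>x. u x * \<phi> x) \<longlongrightarrow> 0) at_bot" "((\<lambda>x. u x * \<phi> x) \<longlongrightarrow> 0) at_top"
      using bnd by (simp_all add: Lim_null_comparison[where g = "\<lambda>x. C * (1 + x ^ 4) * ((1 / sqrt (2 * pi)) * exp (- x\<^sup>2 / 2))"]
          always_eventually)
    then show "(((\<lambda>x. u x * \<phi> x) \<circ> real_of_ereal) \<longlongrightarrow> 0) (at_right (- \<infinity>))"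
      "(((\<lambda>x. u x * \<phi> x) \<circ> real_of_ereal) \<longlongrightarrow> 0) (at_left \<infinity>)"
      by (simp_all add: ereal_tendsto_simps)
  qed auto
  then have "integral\<^sup>L lborel q = 0"
    by (simp add: interval_lebesgue_integral_def set_lebesgue_integral_def)
  with qI i1 i2 show "(\<integral>x. x * u x \<partial>std_normal_distribution) = integral\<^sup>L std_normal_distribution u'"
    by simp
qed

lemma bounded_mult_poly_bound:
  fixes a p :: "real"
  assumes "\<bar>a\<bar> \<le> B" "\<bar>p\<bar> \<le> D * (1 + x ^ 4)"
  shows "\<bar>a * p\<bar> \<le> B * D * (1 + x ^ 4)"
  using mult_mono[OF assms] assms by (simp add: abs_mult mult.assoc)

lemma power_le_one_plus_power4: "\<bar>x\<bar> ^ k \<le> 1 + x ^ 4" if "k \<le> 4" for x :: real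
proof -
  have "x ^ 4 = \<bar>x\<bar> ^ 4" "x ^ 4 \<ge> 0" by (simp_all add: power_even_abs)
  moreover have "\<bar>x\<bar> ^ k \<le> 1" if "\<bar>x\<bar> \<le> 1" using that by (intro power_le_one) auto
  moreover have "\<bar>x\<bar> ^ k \<le> \<bar>x\<bar> ^ 4" if "\<not> \<bar>x\<bar> \<le> 1"
    using that \<open>k \<le> 4\<close> by (intro power_increasing) auto
  ultimately show ?thesis by (cases "\<bar>x\<bar> \<le> 1") (linarith, linarith)
qed

text \<open>One crude constant for all polynomial factors, so that the integrability goals below are
  discharged in a uniform way.\<close>

lemma hermite_bounds:
  fixes x :: real
  shows "\<bar>1 :: real\<bar> \<le> 9 * (1 + x ^ 4)" "\<bar>x\<bar> \<le> 9 * (1 + x ^ 4)" "\<bar>x\<^sup>2 - 1\<bar> \<le> 9 * (1 + x ^ 4)"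
    "\<bar>x ^ 3 - 3 * x\<bar> \<le> 9 * (1 + x ^ 4)" "\<bar>3 * x\<^sup>2 - 3\<bar> \<le> 9 * (1 + x ^ 4)"
proof -
  define y where "y = x ^ 4"
  have b: "\<bar>x\<bar> \<le> 1 + y" "x\<^sup>2 \<le> 1 + y" "\<bar>x ^ 3\<bar> \<le> 1 + y" and y: "0 \<le> y"
    using power_le_one_plus_power4[of 1 x] power_le_one_plus_power4[of 2 x] power_le_one_plus_power4[of 3 x]
    by (auto simp: power_abs y_def)
  have x2: "\<bar>x\<^sup>2 - 1\<bar> \<le> 2 + y" using b(2) y order_trans[of "- x\<^sup>2" 0 "1 + y"] by (simp add: abs_le_iff)
  show "\<bar>1 :: real\<bar> \<le> 9 * (1 + x ^ 4)" unfolding y_def[symmetric] distrib_left using y by simp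
  show "\<bar>x\<bar> \<le> 9 * (1 + x ^ 4)" unfolding y_def[symmetric] distrib_left using b(1) y by linarith
  show "\<bar>x\<^sup>2 - 1\<bar> \<le> 9 * (1 + x ^ 4)" unfolding y_def[symmetric] distrib_left using x2 y by linarith
  show "\<bar>x ^ 3 - 3 * x\<bar> \<le> 9 * (1 + x ^ 4)" unfolding y_def[symmetric] distrib_left using b(1,3) y by linarith
  have "3 * x\<^sup>2 - 3 = 3 * (x\<^sup>2 - 1)" by simp
  then have "\<bar>3 * x\<^sup>2 - 3\<bar> = 3 * \<bar>x\<^sup>2 - 1\<bar>" by (simp only: abs_mult abs_numeral)
  then show "\<bar>3 * x\<^sup>2 - 3\<bar> \<le> 9 * (1 + x ^ 4)"
    unfolding y_def[symmetric] distrib_left using x2 y by linarith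
qed

text \<open>Write He_1 = x, He_2 = x^2 - 1, He_3 = x^3 - 3 x. Each derivative moved onto
  \<open>g\<close> lowers the Hermite degree by one: integrate by parts with \<open>g\<close> times
  He_k and use He_{k+1} = x He_k - He_k'.\<close>

lemma gauss_hermite:
  fixes g g' :: "real \<Rightarrow> real"
  assumes D: "\<And>x. (g has_real_derivative g' x) (at x)" and cont: "continuous_on UNIV g'"
    and g: "\<And>x. \<bar>g x\<bar> \<le> B" and g': "\<And>x. \<bar>g' x\<bar> \<le> B"
  shows "(\<integral>x. g x * x \<partial>std_normal_distribution) = integral\<^sup>L std_normal_distribution g'"
    and "(\<integral>x. g x * (x\<^sup>2 - 1) \<partial>std_normal_distribution) = (\<integral>x. g' x * x \<partial>std_normal_distribution)"
    and "(\<integral>x. g x * (x ^ 3 - 3 * x) \<partial>std_normal_distribution) = (\<integral>x. g' x * (x\<^sup>2 - 1) \<partial>std_normal_distribution)"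
proof -
  have B0: "B \<ge> 0" using g[of 0] by simp
  have cg: "continuous_on UNIV g" by (intro DERIV_continuous_on) (use D in auto)
  have [measurable]: "g' \<in> borel_measurable borel" "g \<in> borel_measurable borel"
    using cont cg by (auto intro: borel_measurable_continuous_onI)
  have int: "integrable std_normal_distribution (\<lambda>x. a x * p x)"
    if "\<And>x. \<bar>a x\<bar> \<le> B" "\<And>x. \<bar>p x\<bar> \<le> 9 * (1 + x ^ 4)" "a \<in> borel_measurable borel" "p \<in> borel_measurable borel"
    for a p :: "real \<Rightarrow> real"
    using that by (intro integrable_gauss_poly_bound[where n = 2 and C = "B * 9"]) (auto intro: bounded_mult_poly_bound)
  have x4: "0 \<le> x ^ 4" for x :: real by simp
  note bm = bounded_mult_poly_bound[where D = 9]
  have one: "\<bar>1 :: real\<bar> \<le> 9 * (1 + x ^ 4)" for x :: real by (rule hermite_bounds)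
  show "(\<integral>x. g x * x \<partial>std_normal_distribution) = integral\<^sup>L std_normal_distribution g'"
    using gauss_integration_by_parts(3)[OF D cont, of "B * 9"] bm[OF g one] bm[OF g' one]
    by (simp add: mult.commute)
  have "(\<integral>x. x * (g x * x) \<partial>std_normal_distribution) = (\<integral>x. g' x * x + g x * 1 \<partial>std_normal_distribution)"
  proof (rule gauss_integration_by_parts(3)[where C = "B * 18"])
    show "((\<lambda>x. g x * x) has_real_derivative g' x * x + g x * 1) (at x)" for x
      by (rule derivative_eq_intros D refl | simp)+
    show "continuous_on UNIV (\<lambda>x. g' x * x + g x * 1)" by (intro continuous_intros cont cg)
    show "\<bar>g x * x\<bar> \<le> B * 18 * (1 + x ^ 4)" for x
      using bm[OF g[of x] hermite_bounds(2)[of x]] mult_nonneg_nonneg[OF B0 x4[of x]] B0 by (simp add: algebra_simps)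
    show "\<bar>g' x * x + g x * 1\<bar> \<le> B * 18 * (1 + x ^ 4)" for x
      using bm[OF g'[of x] hermite_bounds(2)[of x]] bm[OF g[of x] one[of x]] by linarith
  qed
  also have "\<dots> = (\<integral>x. g' x * x \<partial>std_normal_distribution) + (\<integral>x. g x * 1 \<partial>std_normal_distribution)"
    by (intro Bochner_Integration.integral_add int g g' hermite_bounds) auto
  finally have "(\<integral>x. g' x * x \<partial>std_normal_distribution) =
      (\<integral>x. x * (g x * x) \<partial>std_normal_distribution) - (\<integral>x. g x * 1 \<partial>std_normal_distribution)" by simp
  also have "\<dots> = (\<integral>x. x * (g x * x) - g x * 1 \<partial>std_normal_distribution)"
  proof (rule Bochner_Integration.integral_diff[symmetric])
    have "integrable std_normal_distribution (\<lambda>x. g x * x\<^sup>2)"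
    proof (intro int g)
      show "\<bar>x\<^sup>2\<bar> \<le> 9 * (1 + x ^ 4)" for x :: real
        using hermite_bounds(1,3)[of x] power_le_one_plus_power4[of 2 x] by (simp add: algebra_simps add_increasing)
    qed auto
    then show "integrable std_normal_distribution (\<lambda>x. x * (g x * x))" by (simp add: power2_eq_square mult_ac)
    show "integrable std_normal_distribution (\<lambda>x. g x * 1)" by (intro int g hermite_bounds) auto
  qed
  finally show two: "(\<integral>x. g x * (x\<^sup>2 - 1) \<partial>std_normal_distribution) = (\<integral>x. g' x * x \<partial>std_normal_distribution)"
    by (simp add: algebra_simps power2_eq_square)
  have "(\<integral>x. x * (g x * (x\<^sup>2 - 1)) \<partial>std_normal_distribution) = (\<integral>x. g' x * (x\<^sup>2 - 1) + g x * (2 * x) \<partial>std_normal_distribution)"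
  proof (rule gauss_integration_by_parts(3)[where C = "B * 27"])
    show "((\<lambda>x. g x * (x\<^sup>2 - 1)) has_real_derivative g' x * (x\<^sup>2 - 1) + g x * (2 * x)) (at x)" for x
      by (rule derivative_eq_intros D refl | simp)+
    show "continuous_on UNIV (\<lambda>x. g' x * (x\<^sup>2 - 1) + g x * (2 * x))" by (intro continuous_intros cont cg)
    show "\<bar>g x * (x\<^sup>2 - 1)\<bar> \<le> B * 27 * (1 + x ^ 4)" for x
      using bm[OF g[of x] hermite_bounds(3)[of x]] mult_nonneg_nonneg[OF B0 x4[of x]] B0 by (simp add: algebra_simps)
    show "\<bar>g' x * (x\<^sup>2 - 1) + g x * (2 * x)\<bar> \<le> B * 27 * (1 + x ^ 4)" for x
      using bm[OF g'[of x] hermite_bounds(3)[of x]] bm[OF g[of x] hermite_bounds(2)[of x]] by linarith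
  qed
  moreover have i: "integrable std_normal_distribution (\<lambda>x. g x * (x ^ 3 - 3 * x))"
    "integrable std_normal_distribution (\<lambda>x. g x * x)" "integrable std_normal_distribution (\<lambda>x. g' x * (x\<^sup>2 - 1))"
    by (intro int g g' hermite_bounds; simp)+
  moreover have "(\<integral>x. x * (g x * (x\<^sup>2 - 1)) \<partial>std_normal_distribution) =
     (\<integral>x. g x * (x ^ 3 - 3 * x) + 2 * (g x * x) \<partial>std_normal_distribution)"
    by (intro Bochner_Integration.integral_cong) (auto simp: algebra_simps power2_eq_square power3_eq_cube)
  moreover have "(\<integral>x. g' x * (x\<^sup>2 - 1) + g x * (2 * x) \<partial>std_normal_distribution) =
     (\<integral>x. g' x * (x\<^sup>2 - 1) + 2 * (g x * x) \<partial>std_normal_distribution)"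
    by (intro Bochner_Integration.integral_cong) auto
  ultimately show "(\<integral>x. g x * (x ^ 3 - 3 * x) \<partial>std_normal_distribution) = (\<integral>x. g' x * (x\<^sup>2 - 1) \<partial>std_normal_distribution)"
    by simp
qed

text \<open>Differentiating f' = x f + (h - c) gives f'' = x f' + (f + h'), which is Stein's
  equation for f' with an inhomogeneity bounded by \<open>K1 + 2 * K\<close>. The barrier therefore
  applies a second time and bounds f'' without any bound on h''.\<close>

lemma stein_solution_smooth:
  fixes h h1 :: "real \<Rightarrow> real"
  defines "c \<equiv> integral\<^sup>L std_normal_distribution h"
  assumes D: "\<And>x. (h has_real_derivative h1 x) (at x)"
    and K: "\<And>x. \<bar>h x - c\<bar> \<le> K" and K1: "\<And>x. \<bar>h1 x\<bar> \<le> K1"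
  obtains f f1 f2 where
    "\<And>x. (f has_real_derivative f1 x) (at x)" "\<And>x. (f1 has_real_derivative f2 x) (at x)"
    "\<And>x. f1 x = x * f x + (h x - c)" "\<And>x. f2 x = x * f1 x + f x + h1 x"
    "\<And>x. \<bar>f x\<bar> \<le> 2 * K" "\<And>x. \<bar>f1 x\<bar> \<le> 3 * K" "\<And>x. \<bar>f2 x\<bar> \<le> 3 * (K1 + 2 * K)"
proof -
  have "\<bar>h x\<bar> \<le> K + \<bar>c\<bar>" for x using K[of x] by linarith
  moreover have "continuous_on UNIV h" by (intro DERIV_continuous_on) (use D in auto)
  ultimately have *: "\<exists>f. (\<forall>x. (f has_real_derivative x * f x + (h x - c)) (at x)) \<and>
     ((\<lambda>x. f x * exp (- x\<^sup>2 / 2)) \<longlongrightarrow> 0) at_top \<and> ((\<lambda>x. f x * exp (- x\<^sup>2 / 2)) \<longlongrightarrow> 0) at_bot"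
    unfolding c_def by - (rule stein_solution[of h "K + \<bar>integral\<^sup>L std_normal_distribution h\<bar>"], auto)
  obtain f where f: "\<And>x. (f has_real_derivative x * f x + (h x - c)) (at x)"
    and lim: "((\<lambda>x. f x * exp (- x\<^sup>2 / 2)) \<longlongrightarrow> 0) at_top" "((\<lambda>x. f x * exp (- x\<^sup>2 / 2)) \<longlongrightarrow> 0) at_bot"
    using * by auto
  define f1 where "f1 = (\<lambda>x. x * f x + (h x - c))"
  define f2 where "f2 = (\<lambda>x. x * f1 x + (f x + h1 x))"
  have fb: "\<bar>f x\<bar> \<le> 2 * K" and f1b: "\<bar>f1 x\<bar> \<le> 3 * K" for x
    using stein_barrier[OF f K lim] by (auto simp: f1_def)
  have D0: "(f has_real_derivative f1 x) (at x)" for x using f by (simp add: f1_def)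
  have D1: "(f1 has_real_derivative f2 x) (at x)" for x
    unfolding f1_def by (rule derivative_eq_intros D D0 refl | simp)+ (simp add: f2_def f1_def)
  have "\<bar>f x + h1 x\<bar> \<le> K1 + 2 * K" for x using fb[of x] K1[of x] by linarith
  then have f2b: "\<bar>f2 x\<bar> \<le> 3 * (K1 + 2 * K)" for x
    unfolding f2_def
    by (intro stein_barrier(2)[OF D1[unfolded f2_def] _ bounded_times_gauss_tendsto_0[OF f1b]])
  show thesis
    by (rule that[OF D0 D1 _ _ fb f1b f2b]) (auto simp: f1_def f2_def)
qed

text \<open>A third application of the barrier: f'' solves Stein's equation with inhomogeneity 2 f'
  + h''. The last conclusion removes the solution from the Edgeworth correction. Two integrations by
  parts give E f'' = E (f He_2). For u = f He_3 one has E (u' - x u) = 0, and by Stein's equation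
  and He_3' = 3 He_2 the integrand is (h - c) He_3 + 3 f He_2, where He_3 has mean 0.\<close>

lemma stein_solution_third:
  fixes h h1 h2 :: "real \<Rightarrow> real"
  defines "c \<equiv> integral\<^sup>L std_normal_distribution h"
  assumes D: "\<And>x. (h has_real_derivative h1 x) (at x)" "\<And>x. (h1 has_real_derivative h2 x) (at x)"
    and K: "\<And>x. \<bar>h x - c\<bar> \<le> K" and K1: "\<And>x. \<bar>h1 x\<bar> \<le> K1" and K2: "\<And>x. \<bar>h2 x\<bar> \<le> K2"
  obtains f f1 f2 f3 where
    "\<And>x. (f has_real_derivative f1 x) (at x)" "\<And>x. (f1 has_real_derivative f2 x) (at x)"
    "\<And>x. (f2 has_real_derivative f3 x) (at x)"
    "\<And>x. f1 x = x * f x + (h x - c)"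
    "\<And>x. \<bar>f x\<bar> \<le> 2 * K" "\<And>x. \<bar>f1 x\<bar> \<le> 3 * K" "\<And>x. \<bar>f2 x\<bar> \<le> 3 * (K1 + 2 * K)"
    "\<And>x. \<bar>f3 x\<bar> \<le> 3 * (K2 + 6 * K)"
    "integral\<^sup>L std_normal_distribution f2 = - (1/3) * (\<integral>x. h x * (x ^ 3 - 3 * x) \<partial>std_normal_distribution)"
proof -
  interpret real_distribution std_normal_distribution by (rule real_dist_normal_dist)
  obtain f f1 f2 where f: "\<And>x. (f has_real_derivative f1 x) (at x)" "\<And>x. (f1 has_real_derivative f2 x) (at x)"
    "\<And>x. f1 x = x * f x + (h x - c)" and f2: "\<And>x. f2 x = x * f1 x + f x + h1 x"
    and b: "\<And>x. \<bar>f x\<bar> \<le> 2 * K" "\<And>x. \<bar>f1 x\<bar> \<le> 3 * K" "\<And>x. \<bar>f2 x\<bar> \<le> 3 * (K1 + 2 * K)"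
    using stein_solution_smooth[OF D(1), of K K1] K K1 unfolding c_def by metis
  define f3 where "f3 = (\<lambda>x. x * f2 x + (2 * f1 x + h2 x))"
  have D2: "(f2 has_real_derivative f3 x) (at x)" for x
    unfolding f2 by (rule derivative_eq_intros D f refl | simp)+ (simp add: f3_def f2)
  have "\<bar>2 * f1 x + h2 x\<bar> \<le> K2 + 6 * K" for x using b(2)[of x] K2[of x] by linarith
  then have b3: "\<bar>f3 x\<bar> \<le> 3 * (K2 + 6 * K)" for x
    unfolding f3_def
    by (intro stein_barrier(2)[OF D2[unfolded f3_def] _ bounded_times_gauss_tendsto_0[OF b(3)]])
  have K0: "K \<ge> 0" "K1 \<ge> 0" "K2 \<ge> 0" using K[of 0] K1[of 0] K2[of 0] by auto
  define B where "B = 3 * (K1 + 2 * K) + \<bar>c\<bar>"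
  have bB: "\<bar>f x\<bar> \<le> B" "\<bar>f1 x\<bar> \<le> B" "\<bar>f2 x\<bar> \<le> B" "\<bar>h x\<bar> \<le> B" for x
    using b[of x] K0 K[of x] unfolding B_def by (simp_all add: abs_le_iff) linarith+
  have B0: "B \<ge> 0" using bB(1)[of 0] by linarith
  have cf: "continuous_on UNIV f" "continuous_on UNIV f1" "continuous_on UNIV f2" "continuous_on UNIV h"
    by (intro DERIV_continuous_on; use f D2 D in auto)+
  then have [measurable]: "f \<in> borel_measurable borel" "f1 \<in> borel_measurable borel"
      "f2 \<in> borel_measurable borel" "h \<in> borel_measurable borel"
    by (auto intro: borel_measurable_continuous_onI)
  have int: "integrable std_normal_distribution (\<lambda>x. a x * p x)"
    if "\<And>x. \<bar>a x\<bar> \<le> B" "\<And>x. \<bar>p x\<bar> \<le> 9 * (1 + x ^ 4)" "a \<in> borel_measurable borel" "p \<in> borel_measurable borel"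
    for a p :: "real \<Rightarrow> real"
    using that by (intro integrable_gauss_poly_bound[where n = 2 and C = "B * 9"]) (auto intro: bounded_mult_poly_bound)
  have f2I: "integral\<^sup>L std_normal_distribution f2 = (\<integral>x. f x * (x\<^sup>2 - 1) \<partial>std_normal_distribution)"
    using gauss_hermite(2)[OF f(1) cf(2) bB(1) bB(2)] gauss_hermite(1)[OF f(2) cf(3) bB(2) bB(3)] by simp
  let ?u = "\<lambda>x. f x * (x ^ 3 - 3 * x)" and ?u' = "\<lambda>x. f1 x * (x ^ 3 - 3 * x) + f x * (3 * x\<^sup>2 - 3)"
  note bm = bounded_mult_poly_bound[where D = 9]
  have x4: "0 \<le> x ^ 4" for x :: real by simp
  have uD: "(?u has_real_derivative ?u' x) (at x)" for x
    by (rule derivative_eq_intros f refl | simp)+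
  have uc: "continuous_on UNIV ?u'" by (intro continuous_intros cf)
  have ub: "\<bar>?u x\<bar> \<le> B * 18 * (1 + x ^ 4)" for x
    using bm[OF bB(1)[of x] hermite_bounds(4)[of x]] mult_nonneg_nonneg[OF B0 x4[of x]] B0 by (simp add: algebra_simps)
  have ub': "\<bar>?u' x\<bar> \<le> B * 18 * (1 + x ^ 4)" for x
    using bm[OF bB(2)[of x] hermite_bounds(4)[of x]] bm[OF bB(1)[of x] hermite_bounds(5)[of x]] by linarith
  note ibp = gauss_integration_by_parts[OF uD uc ub ub']
  have i: "integrable std_normal_distribution (\<lambda>x. f x * (x\<^sup>2 - 1))"
    "integrable std_normal_distribution (\<lambda>x. h x * (x ^ 3 - 3 * x))"
    by (intro int bB hermite_bounds; simp)+
  have i3: "integrable std_normal_distribution (\<lambda>x :: real. x ^ 3 - 3 * x)"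
    by (rule integrable_gauss_poly_bound[where n = 2 and C = 9]) (use hermite_bounds(4) in auto)
  have "(\<integral>x. 1 * (x ^ 3 - 3 * x) \<partial>std_normal_distribution) = (\<integral>x. 0 * (x\<^sup>2 - 1) \<partial>std_normal_distribution)"
    by (rule gauss_hermite(3)[where B = 1]) auto
  then have c0: "(\<integral>x. x ^ 3 - 3 * x \<partial>std_normal_distribution) = 0" by simp
  have "(\<integral>x. ?u' x - x * ?u x \<partial>std_normal_distribution) = 0"
    using ibp by (subst Bochner_Integration.integral_diff) auto
  moreover have "?u' x - x * ?u x = h x * (x ^ 3 - 3 * x) - c * (x ^ 3 - 3 * x) + 3 * (f x * (x\<^sup>2 - 1))" for x
    unfolding f(3) by (simp add: algebra_simps)
  ultimately have "0 = (\<integral>x. h x * (x ^ 3 - 3 * x) \<partial>std_normal_distribution) - 0 + 3 * (\<integral>x. f x * (x\<^sup>2 - 1) \<partial>std_normal_distribution)"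
    using i i3 c0 by simp
  then have "integral\<^sup>L std_normal_distribution f2 = - (1/3) * (\<integral>x. h x * (x ^ 3 - 3 * x) \<partial>std_normal_distribution)"
    using f2I by simp
  then show thesis
    using that[OF f(1,2) D2 f(3) b b3] by blast
qed

section \<open>Sums of independent variables with weights\<close>

lemma taylor_first:
  fixes f f1 :: "real \<Rightarrow> real"
  assumes "\<And>x. (f has_real_derivative f1 x) (at x)" and D: "\<And>x. \<bar>f1 x\<bar> \<le> D"
  shows "\<bar>f (w + \<xi>) - f w\<bar> \<le> D * \<bar>\<xi>\<bar>"
proof -
  define df where "df = (\<lambda>m::nat. if m = 0 then (\<lambda>t. f (w + t)) else (\<lambda>t. f1 (w + t)))"
  have "DERIV (df m) t :> df (Suc m) t" if "m < 1" for m t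
    using that assms(1) by (auto simp: df_def add.commute[of w] intro!: iffD1[OF DERIV_shift])
  then obtain t where "f (w + \<xi>) = (\<Sum>m<1. df m 0 / fact m * \<xi> ^ m) + df 1 t / fact 1 * \<xi> ^ 1"
    using Maclaurin_bi_le[of df "\<lambda>t. f (w + t)" 1 \<xi>] by (auto simp: df_def)
  then have "f (w + \<xi>) - f w = f1 (w + t) * \<xi>" by (simp add: df_def)
  then show ?thesis using D[of "w + t"] by (simp add: abs_mult mult_right_mono)
qed

lemma taylor_second:
  fixes f f1 f2 :: "real \<Rightarrow> real"
  assumes "\<And>x. (f has_real_derivative f1 x) (at x)" "\<And>x. (f1 has_real_derivative f2 x) (at x)"
    and D: "\<And>x. \<bar>f2 x\<bar> \<le> D"
  shows "\<bar>f (w + \<xi>) - f w - \<xi> * f1 w\<bar> \<le> D * \<xi>\<^sup>2 / 2"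
proof -
  define df where "df = (\<lambda>m::nat. if m = 0 then (\<lambda>t. f (w + t)) else if m = 1 then (\<lambda>t. f1 (w + t)) else (\<lambda>t. f2 (w + t)))"
  have "DERIV (df m) t :> df (Suc m) t" if "m < 2" for m t
    using that assms(1,2) by (auto simp: df_def add.commute[of w] less_2_cases_iff intro!: iffD1[OF DERIV_shift])
  then obtain t where "f (w + \<xi>) = (\<Sum>m<2. df m 0 / fact m * \<xi> ^ m) + df 2 t / fact 2 * \<xi> ^ 2"
    using Maclaurin_bi_le[of df "\<lambda>t. f (w + t)" 2 \<xi>] by (auto simp: df_def)
  then have "f (w + \<xi>) - f w - \<xi> * f1 w = f2 (w + t) * (\<xi>\<^sup>2 / 2)"
    by (simp add: df_def eval_nat_numeral)
  then have "\<bar>f (w + \<xi>) - f w - \<xi> * f1 w\<bar> = \<bar>f2 (w + t)\<bar> * (\<xi>\<^sup>2 / 2)"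
    by (simp only: abs_mult abs_divide abs_power2 abs_numeral)
  then show ?thesis using mult_right_mono[OF D[of "w + t"], of "\<xi>\<^sup>2 / 2"] by simp
qed

lemma taylor_third:
  fixes f f1 f2 f3 :: "real \<Rightarrow> real"
  assumes "\<And>x. (f has_real_derivative f1 x) (at x)" "\<And>x. (f1 has_real_derivative f2 x) (at x)"
    "\<And>x. (f2 has_real_derivative f3 x) (at x)"
    and D: "\<And>x. \<bar>f3 x\<bar> \<le> L"
  shows "\<bar>f (w + \<xi>) - f w - \<xi> * f1 w - \<xi>\<^sup>2 / 2 * f2 w\<bar> \<le> L * \<bar>\<xi>\<bar> ^ 3 / 6"
proof -
  define df where "df = (\<lambda>m::nat. if m = 0 then (\<lambda>t. f (w + t)) else if m = 1 then (\<lambda>t. f1 (w + t))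
     else if m = 2 then (\<lambda>t. f2 (w + t)) else (\<lambda>t. f3 (w + t)))"
  have "DERIV (df m) t :> df (Suc m) t" if "m < 3" for m t
  proof -
    have "m = 0 \<or> m = 1 \<or> m = 2" using that by auto
    then show ?thesis using assms(1-3) by (auto simp: df_def add.commute[of w] intro!: iffD1[OF DERIV_shift])
  qed
  then obtain t where "f (w + \<xi>) = (\<Sum>m<3. df m 0 / fact m * \<xi> ^ m) + df 3 t / fact 3 * \<xi> ^ 3"
    using Maclaurin_bi_le[of df "\<lambda>t. f (w + t)" 3 \<xi>] by (auto simp: df_def)
  then have "f (w + \<xi>) - f w - \<xi> * f1 w - \<xi>\<^sup>2 / 2 * f2 w = f3 (w + t) * (\<xi> ^ 3 / 6)"
    by (simp add: df_def eval_nat_numeral)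
  then have "\<bar>f (w + \<xi>) - f w - \<xi> * f1 w - \<xi>\<^sup>2 / 2 * f2 w\<bar> = \<bar>f3 (w + t)\<bar> * (\<bar>\<xi>\<bar> ^ 3 / 6)"
    by (simp only: abs_mult power_abs abs_divide abs_numeral)
  then show ?thesis using mult_right_mono[OF D[of "w + t"], of "\<bar>\<xi>\<bar> ^ 3 / 6"] by simp
qed

text \<open>Common values of the first moments are enough; the variables need not have the same law.
  The signed third moment \<open>m3\<close> drives the correction, while \<open>b3\<close> and
  \<open>m4\<close> measure the errors.\<close>

locale weighted_sum = prob_space M for M :: "'a measure" +
  fixes I :: "'i set" and X :: "'i \<Rightarrow> 'a \<Rightarrow> real" and c :: "'i \<Rightarrow> real" and m3 b3 m4 :: real
  assumes fin: "finite I" and indep: "indep_vars (\<lambda>_. borel) X I"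
    and int4: "\<And>i. i \<in> I \<Longrightarrow> integrable M (\<lambda>\<omega>. X i \<omega> ^ 4)"
    and mean: "\<And>i. i \<in> I \<Longrightarrow> expectation (X i) = 0"
    and var: "\<And>i. i \<in> I \<Longrightarrow> expectation (\<lambda>\<omega>. X i \<omega> ^ 2) = 1"
    and mom3: "\<And>i. i \<in> I \<Longrightarrow> expectation (\<lambda>\<omega>. X i \<omega> ^ 3) = m3"
    and amom3: "\<And>i. i \<in> I \<Longrightarrow> expectation (\<lambda>\<omega>. \<bar>X i \<omega>\<bar> ^ 3) = b3"
    and mom4: "\<And>i. i \<in> I \<Longrightarrow> expectation (\<lambda>\<omega>. X i \<omega> ^ 4) = m4"
begin

definition S where "S = (\<lambda>\<omega>. \<Sum>i\<in>I. c i * X i \<omega>)"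

text \<open>The leave-one-out sum, which is independent of \<open>X i\<close> and differs from
  \<open>S\<close> by \<open>c i * X i\<close> only.\<close>

definition S' where "S' i = (\<lambda>\<omega>. \<Sum>j\<in>I-{i}. c j * X j \<omega>)"

lemma measX: "i \<in> I \<Longrightarrow> X i \<in> borel_measurable M"
  using indep by (auto simp: indep_vars_def)

lemma S_split: "i \<in> I \<Longrightarrow> S \<omega> = S' i \<omega> + c i * X i \<omega>"
  unfolding S_def S'_def using fin by (subst sum.remove[of _ i]) auto

lemma measS[measurable]: "S \<in> borel_measurable M" "S' i \<in> borel_measurable M"
  unfolding S_def S'_def using measX by (auto intro!: borel_measurable_sum borel_measurable_times)

lemma int_pow:
  assumes "i \<in> I" "k \<le> 4"
  shows "integrable M (\<lambda>\<omega>. \<bar>X i \<omega>\<bar> ^ k)" "integrable M (\<lambda>\<omega>. X i \<omega> ^ k)"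
proof -
  have [measurable]: "X i \<in> borel_measurable M" by (rule measX) fact
  note le = power_le_one_plus_power4[OF assms(2)]
  show "integrable M (\<lambda>\<omega>. \<bar>X i \<omega>\<bar> ^ k)"
    by (rule Bochner_Integration.integrable_bound[where f = "\<lambda>\<omega>. 1 + X i \<omega> ^ 4"])
       (use int4[OF assms(1)] le in \<open>auto intro!: always_eventually order_trans[OF le abs_ge_self]\<close>)
  show "integrable M (\<lambda>\<omega>. X i \<omega> ^ k)"
    by (rule Bochner_Integration.integrable_bound[where f = "\<lambda>\<omega>. 1 + X i \<omega> ^ 4"])
       (use int4[OF assms(1)] le in \<open>auto simp: power_abs intro!: always_eventually order_trans[OF le abs_ge_self]\<close>)
qed

text \<open>All of these come from integrating pointwise polynomial inequalities against a variable
  of variance 1, for instance (|x| - 1)^2 (2 |x| + 1) >= 0 for the third moment. The bound of |m3|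
  by \<open>m4\<close> passes through b3 <= b3^2, as \<open>b3\<close> is at least 1.\<close>

lemma moment_facts:
  assumes i: "i \<in> I"
  shows "1 \<le> b3" "1 \<le> m4" "b3\<^sup>2 \<le> m4" "\<bar>m3\<bar> \<le> b3" "\<bar>m3\<bar> \<le> m4"
    "expectation (\<lambda>\<omega>. \<bar>X i \<omega>\<bar>) \<le> 1"
proof -
  note ip = int_pow[OF i]
  have i2: "integrable M (\<lambda>\<omega>. X i \<omega> ^ 2)" "integrable M (\<lambda>\<omega>. \<bar>X i \<omega>\<bar> ^ 3)" "integrable M (\<lambda>\<omega>. X i \<omega> ^ 4)"
    "integrable M (\<lambda>\<omega>. \<bar>X i \<omega>\<bar>)"
    using ip(2)[of 2] ip(1)[of 3] ip(2)[of 4] ip(1)[of 1] by auto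
  have "expectation (\<lambda>\<omega>. \<bar>X i \<omega>\<bar>) \<le> expectation (\<lambda>\<omega>. (1 + X i \<omega> ^ 2) / 2)"
  proof (rule integral_mono)
    fix \<omega> show "\<bar>X i \<omega>\<bar> \<le> (1 + X i \<omega> ^ 2) / 2"
      using zero_le_power2[of "\<bar>X i \<omega>\<bar> - 1"] by (simp add: power2_diff)
  qed (use i2 in auto)
  also have "\<dots> = 1" using i2 var[OF i] by (simp add: prob_space)
  finally show "expectation (\<lambda>\<omega>. \<bar>X i \<omega>\<bar>) \<le> 1" .
  have "expectation (\<lambda>\<omega>. (3 * X i \<omega> ^ 2 - 1) / 2) \<le> expectation (\<lambda>\<omega>. \<bar>X i \<omega>\<bar> ^ 3)"
  proof (rule integral_mono)
    fix \<omega>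
    have "0 \<le> (\<bar>X i \<omega>\<bar> - 1)\<^sup>2 * (2 * \<bar>X i \<omega>\<bar> + 1)" by simp
    also have "\<dots> = 2 * \<bar>X i \<omega>\<bar> ^ 3 - 3 * \<bar>X i \<omega>\<bar> ^ 2 + 1" by (simp add: algebra_simps power2_eq_square power3_eq_cube)
    finally show "(3 * X i \<omega> ^ 2 - 1) / 2 \<le> \<bar>X i \<omega>\<bar> ^ 3" by simp
  qed (use i2 in auto)
  then show b: "1 \<le> b3" using i2 var[OF i] amom3[OF i] by (simp add: prob_space)
  have "expectation (\<lambda>\<omega>. 2 * X i \<omega> ^ 2 - 1) \<le> expectation (\<lambda>\<omega>. X i \<omega> ^ 4)"
  proof (rule integral_mono)
    fix \<omega>
    show "2 * X i \<omega> ^ 2 - 1 \<le> X i \<omega> ^ 4"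
      using zero_le_power2[of "(X i \<omega>)\<^sup>2 - 1"] by (simp add: power2_diff flip: power_mult)
  qed (use i2 in auto)
  then show m4: "1 \<le> m4" using i2 var[OF i] mom4[OF i] by (simp add: prob_space)
  \<comment> \<open>Cauchy-Schwarz in the form of the arithmetic-geometric mean inequality; the
    weight \<open>sqrt m4\<close> makes both terms integrate to the same value.\<close>
  have "expectation (\<lambda>\<omega>. \<bar>X i \<omega>\<bar> ^ 3) \<le> expectation (\<lambda>\<omega>. (sqrt m4 * X i \<omega> ^ 2 + X i \<omega> ^ 4 / sqrt m4) / 2)"
  proof (rule integral_mono)
    fix \<omega>
    let ?s = "sqrt m4" and ?x = "\<bar>X i \<omega>\<bar>"
    have s: "?s > 0" using m4 by simp
    have "0 \<le> ?x\<^sup>2 * (?x - ?s)\<^sup>2" by simp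
    also have "\<dots> = ?x ^ 4 + ?s * (?s * ?x ^ 2) - 2 * ?s * ?x ^ 3"
      by (simp add: power2_diff algebra_simps eval_nat_numeral)
    finally have "2 * ?x ^ 3 * ?s \<le> (?s * ?x ^ 2 + ?x ^ 4 / ?s) * ?s"
      using s by (simp add: algebra_simps)
    then have "2 * ?x ^ 3 \<le> (?s * ?x ^ 2 + ?x ^ 4 / ?s)" using s by simp
    then show "?x ^ 3 \<le> (?s * X i \<omega> ^ 2 + X i \<omega> ^ 4 / ?s) / 2" by (simp add: power_even_abs)
  qed (use i2 in auto)
  also have "\<dots> = (sqrt m4 + m4 / sqrt m4) / 2"
    using i2 var[OF i] mom4[OF i] by simp
  also have "\<dots> = sqrt m4" using m4 by (simp add: real_div_sqrt)
  finally have "b3 \<le> sqrt m4" using amom3[OF i] by simp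
  then have "b3\<^sup>2 \<le> (sqrt m4)\<^sup>2" using b by (intro power_mono) auto
  then show bm: "b3\<^sup>2 \<le> m4" using m4 by simp
  have "\<bar>expectation (\<lambda>\<omega>. X i \<omega> ^ 3)\<bar> \<le> expectation (\<lambda>\<omega>. \<bar>X i \<omega> ^ 3\<bar>)" by (rule integral_abs_bound)
  then show "\<bar>m3\<bar> \<le> b3" using mom3[OF i] amom3[OF i] by (simp add: power_abs)
  moreover have "b3 * 1 \<le> b3 * b3" using b by (intro mult_left_mono) auto
  ultimately show "\<bar>m3\<bar> \<le> m4" using bm by (simp add: power2_eq_square)
qed

lemma bounded_integrable:
  assumes "F \<in> borel_measurable borel" "\<And>x. \<bar>F x\<bar> \<le> (B::real)" "V \<in> borel_measurable M"
  shows "integrable M (\<lambda>\<omega>. F (V \<omega>))"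
  using assms by (intro integrable_const_bound[where B = B]) auto

lemma pow_times_bounded_integrable:
  assumes i: "i \<in> I" "k \<le> 4" and F: "F \<in> borel_measurable borel" "\<And>x. \<bar>F x\<bar> \<le> (B::real)" "V \<in> borel_measurable M"
  shows "integrable M (\<lambda>\<omega>. X i \<omega> ^ k * F (V \<omega>))"
proof (rule Bochner_Integration.integrable_bound[where f = "\<lambda>\<omega>. B * X i \<omega> ^ k"])
  show "integrable M (\<lambda>\<omega>. B * X i \<omega> ^ k)" using int_pow(2)[OF i] by auto
  show "(\<lambda>\<omega>. X i \<omega> ^ k * F (V \<omega>)) \<in> borel_measurable M"
    using measX[OF i(1)] F by measurable
  have "\<bar>F x\<bar> \<le> \<bar>B\<bar>" for x using F(2)[of x] by linarith
  then show "AE \<omega> in M. norm (X i \<omega> ^ k * F (V \<omega>)) \<le> norm (B * X i \<omega> ^ k)"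
    by (auto simp: abs_mult mult.commute intro!: always_eventually mult_right_mono)
qed

lemma leave_one_out:
  assumes i: "i \<in> I" "k \<le> 4" and F: "F \<in> borel_measurable borel" "\<And>x. \<bar>F x\<bar> \<le> (B::real)"
  shows "expectation (\<lambda>\<omega>. X i \<omega> ^ k * F (S' i \<omega>)) = expectation (\<lambda>\<omega>. X i \<omega> ^ k) * expectation (\<lambda>\<omega>. F (S' i \<omega>))"
proof -
  have "indep_var
    borel ((\<lambda>f. f i ^ k) \<circ> (\<lambda>\<omega>. restrict (\<lambda>i. X i \<omega>) {i}))
    borel ((\<lambda>f. F (\<Sum>j\<in>I-{i}. c j * f j)) \<circ> (\<lambda>\<omega>. restrict (\<lambda>i. X i \<omega>) (I - {i})))"
  proof (intro indep_var_compose[OF indep_var_restrict[OF indep]])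
    show "(\<lambda>f. f i ^ k :: real) \<in> borel_measurable (Pi\<^sub>M {i} (\<lambda>_. borel))"
      by (intro borel_measurable_power measurable_component_singleton) auto
    have "(\<lambda>f. \<Sum>j\<in>I-{i}. c j * f j) \<in> borel_measurable (Pi\<^sub>M (I - {i}) (\<lambda>_. borel))"
      by (intro borel_measurable_sum borel_measurable_times) auto
    then show "(\<lambda>f. F (\<Sum>j\<in>I-{i}. c j * f j)) \<in> borel_measurable (Pi\<^sub>M (I - {i}) (\<lambda>_. borel))"
      using F(1) by measurable
  qed (use i in auto)
  also have "((\<lambda>f. f i ^ k) \<circ> (\<lambda>\<omega>. restrict (\<lambda>i. X i \<omega>) {i})) = (\<lambda>\<omega>. X i \<omega> ^ k)" by auto
  also have "((\<lambda>f. F (\<Sum>j\<in>I-{i}. c j * f j)) \<circ> (\<lambda>\<omega>. restrict (\<lambda>i. X i \<omega>) (I - {i}))) = (\<lambda>\<omega>. F (S' i \<omega>))"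
    by (auto simp: S'_def intro!: arg_cong[where f = F] sum.cong)
  finally show ?thesis
    using int_pow(2)[OF i] bounded_integrable[OF F measS(2)] by (intro indep_var_lebesgue_integral)
qed

lemma abs_expectation_le:
  fixes U V :: "'a \<Rightarrow> real"
  assumes "integrable M U" "integrable M V" "\<And>\<omega>. \<bar>U \<omega>\<bar> \<le> V \<omega>"
  shows "\<bar>expectation U\<bar> \<le> expectation V"
proof -
  have "expectation (\<lambda>\<omega>. \<bar>U \<omega>\<bar>) \<le> expectation V"
    by (rule integral_mono) (use assms in auto)
  then show ?thesis using integral_abs_bound[of M U] by linarith
qed

text \<open>Expand \<open>f (S \<omega>)\<close> around \<open>S' i \<omega>\<close>: independence,
  mean 0 and variance 1 leave only the term with \<open>f1 (S' i \<omega>)\<close>. In 3/2, the part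
  1/2 is the Taylor remainder and the part 1 is the cost of putting \<open>S\<close> back in place
  of \<open>S' i\<close> in \<open>f1\<close>, where E|X| <= 1 <= b3 is used.\<close>

lemma stein_term_first:
  assumes i: "i \<in> I"
    and D: "\<And>x. (f has_real_derivative f1 x) (at x)" "\<And>x. (f1 has_real_derivative f2 x) (at x)"
    and b: "\<And>x. \<bar>f x\<bar> \<le> B" "\<And>x. \<bar>f1 x\<bar> \<le> B1" "\<And>x. \<bar>f2 x\<bar> \<le> B2"
  shows "\<bar>expectation (\<lambda>\<omega>. c i * X i \<omega> * f (S \<omega>)) - (c i)\<^sup>2 * expectation (\<lambda>\<omega>. f1 (S \<omega>))\<bar>
    \<le> 3 / 2 * B2 * b3 * \<bar>c i\<bar> ^ 3"
proof -
  have B2: "B2 \<ge> 0" using b(3)[of 0] by linarith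
  note [measurable] = measX[OF i]
  have [measurable]: "f \<in> borel_measurable borel" "f1 \<in> borel_measurable borel"
    by (intro borel_measurable_continuous_onI DERIV_continuous_on; use D in auto)+
  note P = pow_times_bounded_integrable[OF i] and L = leave_one_out[OF i]
  have J: "integrable M (\<lambda>\<omega>. X i \<omega> * f (S \<omega>))" "integrable M (\<lambda>\<omega>. X i \<omega> * f (S' i \<omega>))"
    "integrable M (\<lambda>\<omega>. X i \<omega> ^ 2 * f1 (S' i \<omega>))"
    "integrable M (\<lambda>\<omega>. f1 (S \<omega>))" "integrable M (\<lambda>\<omega>. f1 (S' i \<omega>))"
    using P[of 1 f B S] P[of 1 f B "S' i"] P[of 2 f1 B1 "S' i"] bounded_integrable[of f1 B1] b by auto
  have E: "expectation (\<lambda>\<omega>. X i \<omega> * f (S' i \<omega>)) = 0"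
    "expectation (\<lambda>\<omega>. X i \<omega> ^ 2 * f1 (S' i \<omega>)) = expectation (\<lambda>\<omega>. f1 (S' i \<omega>))"
    using L[of 1 f B] L[of 2 f1 B1] b mean[OF i] var[OF i] by auto
  let ?U = "\<lambda>\<omega>. c i * X i \<omega> * (f (S \<omega>) - f (S' i \<omega>) - c i * X i \<omega> * f1 (S' i \<omega>))"
  have U: "?U = (\<lambda>\<omega>. c i * (X i \<omega> * f (S \<omega>)) - c i * (X i \<omega> * f (S' i \<omega>)) - (c i)\<^sup>2 * (X i \<omega> ^ 2 * f1 (S' i \<omega>)))"
    by (auto simp: algebra_simps power2_eq_square)
  have IU: "integrable M ?U" unfolding U using J by auto
  have "expectation ?U = c i * expectation (\<lambda>\<omega>. X i \<omega> * f (S \<omega>)) - (c i)\<^sup>2 * expectation (\<lambda>\<omega>. f1 (S' i \<omega>))"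
    unfolding U using J E by simp
  moreover have "\<bar>expectation ?U\<bar> \<le> expectation (\<lambda>\<omega>. B2 / 2 * \<bar>c i\<bar> ^ 3 * \<bar>X i \<omega>\<bar> ^ 3)"
  proof (rule abs_expectation_le[OF IU])
    show "integrable M (\<lambda>\<omega>. B2 / 2 * \<bar>c i\<bar> ^ 3 * \<bar>X i \<omega>\<bar> ^ 3)" using int_pow(1)[OF i, of 3] by auto
    fix \<omega>
    have "\<bar>f (S \<omega>) - f (S' i \<omega>) - c i * X i \<omega> * f1 (S' i \<omega>)\<bar> \<le> B2 * (c i * X i \<omega>)\<^sup>2 / 2"
      unfolding S_split[OF i] by (rule taylor_second[OF D b(3)])
    then have "\<bar>?U \<omega>\<bar> \<le> \<bar>c i * X i \<omega>\<bar> * (B2 * (c i * X i \<omega>)\<^sup>2 / 2)"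
      unfolding abs_mult[of "c i * X i \<omega>"] by (rule mult_left_mono) simp
    also have "\<dots> = \<bar>c i * X i \<omega>\<bar> * (B2 * \<bar>c i * X i \<omega>\<bar>\<^sup>2 / 2)" by simp
    also have "\<dots> = B2 / 2 * \<bar>c i * X i \<omega>\<bar> ^ 3" by (simp only: power2_eq_square power3_eq_cube mult_ac times_divide_eq_right)
    also have "\<dots> = B2 / 2 * \<bar>c i\<bar> ^ 3 * \<bar>X i \<omega>\<bar> ^ 3" by (simp add: abs_mult power_mult_distrib)
    finally show "\<bar>?U \<omega>\<bar> \<le> B2 / 2 * \<bar>c i\<bar> ^ 3 * \<bar>X i \<omega>\<bar> ^ 3" .
  qed
  ultimately have A: "\<bar>c i * expectation (\<lambda>\<omega>. X i \<omega> * f (S \<omega>)) - (c i)\<^sup>2 * expectation (\<lambda>\<omega>. f1 (S' i \<omega>))\<bar> \<le> B2 / 2 * \<bar>c i\<bar> ^ 3 * b3"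
    using amom3[OF i] by simp
  have "\<bar>expectation (\<lambda>\<omega>. f1 (S \<omega>) - f1 (S' i \<omega>))\<bar> \<le> expectation (\<lambda>\<omega>. B2 * \<bar>c i\<bar> * \<bar>X i \<omega>\<bar>)"
  proof (rule abs_expectation_le)
    show "integrable M (\<lambda>\<omega>. B2 * \<bar>c i\<bar> * \<bar>X i \<omega>\<bar>)" using int_pow(1)[OF i, of 1] by auto
    fix \<omega> show "\<bar>f1 (S \<omega>) - f1 (S' i \<omega>)\<bar> \<le> B2 * \<bar>c i\<bar> * \<bar>X i \<omega>\<bar>"
      unfolding S_split[OF i] using taylor_first[OF D(2) b(3), of "S' i \<omega>" "c i * X i \<omega>"] by (simp add: abs_mult mult.assoc)
  qed (use J in auto)
  also have "\<dots> \<le> B2 * \<bar>c i\<bar> * b3"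
    using moment_facts(1,6)[OF i] B2 by (auto intro!: mult_left_mono)
  finally have "\<bar>expectation (\<lambda>\<omega>. f1 (S \<omega>)) - expectation (\<lambda>\<omega>. f1 (S' i \<omega>))\<bar> \<le> B2 * \<bar>c i\<bar> * b3"
    using J by simp
  then have "(c i)\<^sup>2 * \<bar>expectation (\<lambda>\<omega>. f1 (S \<omega>)) - expectation (\<lambda>\<omega>. f1 (S' i \<omega>))\<bar> \<le> (c i)\<^sup>2 * (B2 * \<bar>c i\<bar> * b3)"
    by (rule mult_left_mono) simp
  also have "\<dots> = \<bar>c i\<bar>\<^sup>2 * (B2 * \<bar>c i\<bar> * b3)" by simp
  also have "\<dots> = B2 * b3 * \<bar>c i\<bar> ^ 3" by (simp only: power3_eq_cube power2_eq_square mult_ac)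
  finally have "\<bar>(c i)\<^sup>2 * expectation (\<lambda>\<omega>. f1 (S \<omega>)) - (c i)\<^sup>2 * expectation (\<lambda>\<omega>. f1 (S' i \<omega>))\<bar> \<le> B2 * b3 * \<bar>c i\<bar> ^ 3"
    by (simp add: abs_mult flip: right_diff_distrib)
  moreover have "expectation (\<lambda>\<omega>. c i * X i \<omega> * f (S \<omega>)) = c i * expectation (\<lambda>\<omega>. X i \<omega> * f (S \<omega>))"
    by (simp add: mult.assoc)
  ultimately have "\<bar>expectation (\<lambda>\<omega>. c i * X i \<omega> * f (S \<omega>)) - (c i)\<^sup>2 * expectation (\<lambda>\<omega>. f1 (S \<omega>))\<bar>
      \<le> B2 / 2 * \<bar>c i\<bar> ^ 3 * b3 + B2 * b3 * \<bar>c i\<bar> ^ 3"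
    using A by linarith
  then show ?thesis by (simp add: mult_ac)
qed

text \<open>One order more than \<open>stein_term_first\<close>. The constant is 7/6 = 1/6 + 1/2 +
  1/2: the Taylor remainder of \<open>f\<close>, the return from \<open>S' i\<close> to
  \<open>S\<close> in \<open>f1\<close>, and the same return in \<open>f2\<close>. The second of
  these gains an order because its linear term has mean 0, since \<open>X i\<close> is centred and
  independent of \<open>S' i\<close>. The third uses |m3| <= m4.\<close>

lemma stein_term_third:
  assumes i: "i \<in> I"
    and D: "\<And>x. (f has_real_derivative f1 x) (at x)" "\<And>x. (f1 has_real_derivative f2 x) (at x)"
     "\<And>x. (f2 has_real_derivative f3 x) (at x)"
    and b: "\<And>x. \<bar>f x\<bar> \<le> B" "\<And>x. \<bar>f1 x\<bar> \<le> B1" "\<And>x. \<bar>f2 x\<bar> \<le> B2" "\<And>x. \<bar>f3 x\<bar> \<le> L"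
  shows "\<bar>expectation (\<lambda>\<omega>. c i * X i \<omega> * f (S \<omega>)) - (c i)\<^sup>2 * expectation (\<lambda>\<omega>. f1 (S \<omega>))
      - c i ^ 3 * m3 / 2 * expectation (\<lambda>\<omega>. f2 (S \<omega>))\<bar>
    \<le> 7 / 6 * L * m4 * c i ^ 4"
proof -
  have L0: "L \<ge> 0" using b(4)[of 0] by linarith
  note [measurable] = measX[OF i]
  have [measurable]: "f \<in> borel_measurable borel" "f1 \<in> borel_measurable borel" "f2 \<in> borel_measurable borel"
    by (intro borel_measurable_continuous_onI DERIV_continuous_on; use D in auto)+
  note P = pow_times_bounded_integrable[OF i] and LO = leave_one_out[OF i]
  have J: "integrable M (\<lambda>\<omega>. X i \<omega> * f (S \<omega>))" "integrable M (\<lambda>\<omega>. X i \<omega> * f (S' i \<omega>))"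
    "integrable M (\<lambda>\<omega>. X i \<omega> ^ 2 * f1 (S' i \<omega>))" "integrable M (\<lambda>\<omega>. X i \<omega> ^ 3 * f2 (S' i \<omega>))"
    "integrable M (\<lambda>\<omega>. X i \<omega> * f2 (S' i \<omega>))"
    "integrable M (\<lambda>\<omega>. f1 (S \<omega>))" "integrable M (\<lambda>\<omega>. f1 (S' i \<omega>))"
    "integrable M (\<lambda>\<omega>. f2 (S \<omega>))" "integrable M (\<lambda>\<omega>. f2 (S' i \<omega>))"
    using P[of 1 f B S] P[of 1 f B "S' i"] P[of 2 f1 B1 "S' i"] P[of 3 f2 B2 "S' i"] P[of 1 f2 B2 "S' i"]
      bounded_integrable[of f1 B1] bounded_integrable[of f2 B2] b by auto
  have E: "expectation (\<lambda>\<omega>. X i \<omega> * f (S' i \<omega>)) = 0" "expectation (\<lambda>\<omega>. X i \<omega> * f2 (S' i \<omega>)) = 0"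
    "expectation (\<lambda>\<omega>. X i \<omega> ^ 2 * f1 (S' i \<omega>)) = expectation (\<lambda>\<omega>. f1 (S' i \<omega>))"
    "expectation (\<lambda>\<omega>. X i \<omega> ^ 3 * f2 (S' i \<omega>)) = m3 * expectation (\<lambda>\<omega>. f2 (S' i \<omega>))"
    using LO[of 1 f B] LO[of 1 f2 B2] LO[of 2 f1 B1] LO[of 3 f2 B2] b mean[OF i] var[OF i] mom3[OF i] by auto
  define A0 where "A0 = c i * expectation (\<lambda>\<omega>. X i \<omega> * f (S \<omega>))"
  define A1 where "A1 = expectation (\<lambda>\<omega>. f1 (S \<omega>))"
  define A1' where "A1' = expectation (\<lambda>\<omega>. f1 (S' i \<omega>))"
  define A2 where "A2 = expectation (\<lambda>\<omega>. f2 (S \<omega>))"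
  define A2' where "A2' = expectation (\<lambda>\<omega>. f2 (S' i \<omega>))"
  let ?U = "\<lambda>\<omega>. c i * X i \<omega> * (f (S \<omega>) - f (S' i \<omega>) - c i * X i \<omega> * f1 (S' i \<omega>) - (c i * X i \<omega>)\<^sup>2 / 2 * f2 (S' i \<omega>))"
  have U: "?U = (\<lambda>\<omega>. c i * (X i \<omega> * f (S \<omega>)) - c i * (X i \<omega> * f (S' i \<omega>)) - (c i)\<^sup>2 * (X i \<omega> ^ 2 * f1 (S' i \<omega>))
       - c i ^ 3 / 2 * (X i \<omega> ^ 3 * f2 (S' i \<omega>)))"
    by (auto simp: algebra_simps power2_eq_square power3_eq_cube)
  have IU: "integrable M ?U" unfolding U using J by auto
  have "expectation ?U = A0 - (c i)\<^sup>2 * A1' - c i ^ 3 / 2 * (m3 * A2')"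
    unfolding U A0_def A1'_def A2'_def using J E by simp
  moreover have "\<bar>expectation ?U\<bar> \<le> expectation (\<lambda>\<omega>. L / 6 * c i ^ 4 * X i \<omega> ^ 4)"
  proof (rule abs_expectation_le[OF IU])
    show "integrable M (\<lambda>\<omega>. L / 6 * c i ^ 4 * X i \<omega> ^ 4)" using int_pow(2)[OF i, of 4] by auto
    fix \<omega>
    have "\<bar>f (S \<omega>) - f (S' i \<omega>) - c i * X i \<omega> * f1 (S' i \<omega>) - (c i * X i \<omega>)\<^sup>2 / 2 * f2 (S' i \<omega>)\<bar> \<le> L * \<bar>c i * X i \<omega>\<bar> ^ 3 / 6"
      unfolding S_split[OF i] by (rule taylor_third[OF D b(4)])
    then have "\<bar>?U \<omega>\<bar> \<le> \<bar>c i * X i \<omega>\<bar> * (L * \<bar>c i * X i \<omega>\<bar> ^ 3 / 6)"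
      unfolding abs_mult[of "c i * X i \<omega>"] by (rule mult_left_mono) simp
    also have "\<dots> = L / 6 * \<bar>c i * X i \<omega>\<bar> ^ 4" by (simp add: eval_nat_numeral)
    also have "\<dots> = L / 6 * c i ^ 4 * X i \<omega> ^ 4" by (simp add: power_mult_distrib power_even_abs)
    finally show "\<bar>?U \<omega>\<bar> \<le> L / 6 * c i ^ 4 * X i \<omega> ^ 4" .
  qed
  ultimately have H0: "\<bar>A0 - (c i)\<^sup>2 * A1' - c i ^ 3 / 2 * (m3 * A2')\<bar> \<le> L / 6 * c i ^ 4 * m4"
    using mom4[OF i] by simp
  let ?U1 = "\<lambda>\<omega>. f1 (S \<omega>) - f1 (S' i \<omega>) - c i * X i \<omega> * f2 (S' i \<omega>)"
  have "\<bar>expectation ?U1\<bar> \<le> expectation (\<lambda>\<omega>. L / 2 * (c i)\<^sup>2 * X i \<omega> ^ 2)"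
  proof (rule abs_expectation_le)
    show "integrable M ?U1" using J by (auto simp: mult.assoc)
    show "integrable M (\<lambda>\<omega>. L / 2 * (c i)\<^sup>2 * X i \<omega> ^ 2)" using int_pow(2)[OF i, of 2] by auto
    fix \<omega> show "\<bar>?U1 \<omega>\<bar> \<le> L / 2 * (c i)\<^sup>2 * X i \<omega> ^ 2"
      unfolding S_split[OF i] using taylor_second[OF D(2,3) b(4), of "S' i \<omega>" "c i * X i \<omega>"] by (simp add: power_mult_distrib mult.assoc)
  qed
  also have "expectation ?U1 = A1 - A1'"
    using J E unfolding A1_def A1'_def by (simp add: mult.assoc)
  also have "expectation (\<lambda>\<omega>. L / 2 * (c i)\<^sup>2 * X i \<omega> ^ 2) = L / 2 * (c i)\<^sup>2" using var[OF i] by simp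
  finally have "(c i)\<^sup>2 * \<bar>A1 - A1'\<bar> \<le> (c i)\<^sup>2 * (L / 2 * (c i)\<^sup>2)" by (rule mult_left_mono) simp
  also have "\<dots> \<le> L / 2 * c i ^ 4 * m4"
  proof -
    have "L / 2 * c i ^ 4 * 1 \<le> L / 2 * c i ^ 4 * m4"
      using moment_facts(2)[OF i] L0 by (intro mult_left_mono) auto
    moreover have "(c i)\<^sup>2 * (L / 2 * (c i)\<^sup>2) = L / 2 * c i ^ 4 * 1" by (simp add: eval_nat_numeral)
    ultimately show ?thesis by (simp only:)
  qed
  finally have H1: "\<bar>(c i)\<^sup>2 * A1 - (c i)\<^sup>2 * A1'\<bar> \<le> L / 2 * c i ^ 4 * m4"
    by (simp add: abs_mult flip: right_diff_distrib)
  have "\<bar>expectation (\<lambda>\<omega>. f2 (S \<omega>) - f2 (S' i \<omega>))\<bar> \<le> expectation (\<lambda>\<omega>. L * \<bar>c i\<bar> * \<bar>X i \<omega>\<bar>)"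
  proof (rule abs_expectation_le)
    show "integrable M (\<lambda>\<omega>. L * \<bar>c i\<bar> * \<bar>X i \<omega>\<bar>)" using int_pow(1)[OF i, of 1] by auto
    fix \<omega> show "\<bar>f2 (S \<omega>) - f2 (S' i \<omega>)\<bar> \<le> L * \<bar>c i\<bar> * \<bar>X i \<omega>\<bar>"
      unfolding S_split[OF i] using taylor_first[OF D(3) b(4), of "S' i \<omega>" "c i * X i \<omega>"] by (simp add: abs_mult mult.assoc)
  qed (use J in auto)
  also have "\<dots> = L * \<bar>c i\<bar> * expectation (\<lambda>\<omega>. \<bar>X i \<omega>\<bar>)" by simp
  also have "\<dots> \<le> L * \<bar>c i\<bar> * 1"
    using L0 by (intro mult_left_mono moment_facts(6)[OF i]) auto
  finally have "\<bar>A2 - A2'\<bar> \<le> L * \<bar>c i\<bar>"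
    using J unfolding A2_def A2'_def by simp
  then have "\<bar>c i ^ 3 / 2 * m3\<bar> * \<bar>A2 - A2'\<bar> \<le> (\<bar>c i\<bar> ^ 3 / 2 * m4) * (L * \<bar>c i\<bar>)"
    using moment_facts(5)[OF i] by (intro mult_mono) (auto simp: abs_mult power_abs intro!: mult_left_mono)
  also have "\<dots> = L / 2 * c i ^ 4 * m4" by (simp add: eval_nat_numeral flip: power_even_abs[of 4 "c i"])
  finally have "\<bar>c i ^ 3 / 2 * m3 * (A2 - A2')\<bar> \<le> L / 2 * c i ^ 4 * m4"
    unfolding abs_mult[symmetric] .
  also have "c i ^ 3 / 2 * m3 * (A2 - A2') = c i ^ 3 / 2 * (m3 * A2) - c i ^ 3 / 2 * (m3 * A2')"
    by (simp only: right_diff_distrib mult.assoc)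
  finally have H2: "\<bar>c i ^ 3 / 2 * (m3 * A2) - c i ^ 3 / 2 * (m3 * A2')\<bar> \<le> L / 2 * c i ^ 4 * m4" .
  have "\<bar>A0 - (c i)\<^sup>2 * A1 - c i ^ 3 / 2 * (m3 * A2)\<bar> \<le> L / 6 * c i ^ 4 * m4 + L / 2 * c i ^ 4 * m4 + L / 2 * c i ^ 4 * m4"
    using H0 H1 H2 by linarith
  then show ?thesis unfolding A0_def A1_def A2_def by (simp add: mult.assoc mult_ac)
qed

text \<open>As the squared weights add up to 1, the expectation of \<open>f1 (S \<omega>)\<close>
  can be distributed over the indices, and Stein's operator becomes a sum of leave-one-out
  errors.\<close>

lemma stein_sum:
  assumes c: "(\<Sum>i\<in>I. (c i)\<^sup>2) = 1"
    and f: "f \<in> borel_measurable borel" "\<And>x. \<bar>f x\<bar> \<le> B" and f1: "f1 \<in> borel_measurable borel" "\<And>x. \<bar>f1 x\<bar> \<le> B1"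
  shows "expectation (\<lambda>\<omega>. f1 (S \<omega>) - S \<omega> * f (S \<omega>)) =
    - (\<Sum>i\<in>I. expectation (\<lambda>\<omega>. c i * X i \<omega> * f (S \<omega>)) - (c i)\<^sup>2 * expectation (\<lambda>\<omega>. f1 (S \<omega>)))"
proof -
  have J: "integrable M (\<lambda>\<omega>. c i * X i \<omega> * f (S \<omega>))" if "i \<in> I" for i
    using pow_times_bounded_integrable[OF that, of 1 f B S] f by (auto simp: mult.assoc)
  have "(\<lambda>\<omega>. S \<omega> * f (S \<omega>)) = (\<lambda>\<omega>. \<Sum>i\<in>I. c i * X i \<omega> * f (S \<omega>))"
    by (simp add: S_def sum_distrib_right)
  then have "expectation (\<lambda>\<omega>. f1 (S \<omega>) - S \<omega> * f (S \<omega>)) = expectation (\<lambda>\<omega>. f1 (S \<omega>)) - (\<Sum>i\<in>I. expectation (\<lambda>\<omega>. c i * X i \<omega> * f (S \<omega>)))"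
    using J bounded_integrable[OF f1 measS(1)] by simp
  also have "expectation (\<lambda>\<omega>. f1 (S \<omega>)) = (\<Sum>i\<in>I. (c i)\<^sup>2 * expectation (\<lambda>\<omega>. f1 (S \<omega>)))"
    using c by (simp flip: sum_distrib_right)
  finally show ?thesis by (simp add: sum_subtractf)
qed

end

section \<open>Normal approximation, and the Edgeworth expansion with its cubic term\<close>

lemma (in weighted_sum) clt_first_order:
  assumes c: "(\<Sum>i\<in>I. (c i)\<^sup>2) = 1"
    and D: "\<And>x. (g has_real_derivative g1 x) (at x)"
    and K: "\<And>x. \<bar>g x - integral\<^sup>L std_normal_distribution g\<bar> \<le> K" and K1: "\<And>x. \<bar>g1 x\<bar> \<le> K1"
  shows "\<bar>expectation (\<lambda>\<omega>. g (S \<omega>)) - integral\<^sup>L std_normal_distribution g\<bar> \<le> 9 / 2 * (K1 + 2 * K) * b3 * (\<Sum>i\<in>I. \<bar>c i\<bar> ^ 3)"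
proof -
  let ?c0 = "integral\<^sup>L std_normal_distribution g"
  obtain f f1 f2 where f: "\<And>x. (f has_real_derivative f1 x) (at x)" "\<And>x. (f1 has_real_derivative f2 x) (at x)"
    "\<And>x. f1 x = x * f x + (g x - ?c0)" "\<And>x. \<bar>f x\<bar> \<le> 2 * K" "\<And>x. \<bar>f1 x\<bar> \<le> 3 * K" "\<And>x. \<bar>f2 x\<bar> \<le> 3 * (K1 + 2 * K)"
    using stein_solution_smooth[of g g1 K K1] D K K1 by metis
  have [measurable]: "f \<in> borel_measurable borel" "f1 \<in> borel_measurable borel" "g \<in> borel_measurable borel"
    by (intro borel_measurable_continuous_onI DERIV_continuous_on; use D f in auto)+
  have gi: "integrable M (\<lambda>\<omega>. g (S \<omega>))"
  proof (rule bounded_integrable[where F = g])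
    show "\<bar>g x\<bar> \<le> K + \<bar>?c0\<bar>" for x using K[of x] by linarith
  qed auto
  have "expectation (\<lambda>\<omega>. g (S \<omega>)) - ?c0 = expectation (\<lambda>\<omega>. g (S \<omega>) - ?c0)"
    using gi by (simp add: prob_space)
  also have "\<dots> = expectation (\<lambda>\<omega>. f1 (S \<omega>) - S \<omega> * f (S \<omega>))" by (simp add: f(3))
  also have "\<dots> = - (\<Sum>i\<in>I. expectation (\<lambda>\<omega>. c i * X i \<omega> * f (S \<omega>)) - (c i)\<^sup>2 * expectation (\<lambda>\<omega>. f1 (S \<omega>)))"
    using f by (intro stein_sum c) auto
  finally have "\<bar>expectation (\<lambda>\<omega>. g (S \<omega>)) - ?c0\<bar> =
      \<bar>\<Sum>i\<in>I. expectation (\<lambda>\<omega>. c i * X i \<omega> * f (S \<omega>)) - (c i)\<^sup>2 * expectation (\<lambda>\<omega>. f1 (S \<omega>))\<bar>"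
    by simp
  also have "\<dots> \<le> (\<Sum>i\<in>I. 3 / 2 * (3 * (K1 + 2 * K)) * b3 * \<bar>c i\<bar> ^ 3)"
    by (intro order_trans[OF sum_abs] sum_mono stein_term_first[OF _ f(1,2,4,5,6)])
  also have "\<dots> = 9 / 2 * (K1 + 2 * K) * b3 * (\<Sum>i\<in>I. \<bar>c i\<bar> ^ 3)"
    unfolding sum_distrib_left[symmetric] by simp
  finally show ?thesis .
qed

text \<open>Summing \<open>stein_term_third\<close> leaves -(m3 / 2) (sum c_i^3) E f''(S) as the
  main term. Replacing S by a normal variable in this expectation turns it into the cubic
  correction, by the last conclusion of \<open>stein_solution_third\<close>.\<close>

lemma (in weighted_sum) clt_third_order:
  assumes c: "(\<Sum>i\<in>I. (c i)\<^sup>2) = 1"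
    and D: "\<And>x. (h has_real_derivative h1 x) (at x)" "\<And>x. (h1 has_real_derivative h2 x) (at x)"
    and K: "\<And>x. \<bar>h x - integral\<^sup>L std_normal_distribution h\<bar> \<le> K" and K1: "\<And>x. \<bar>h1 x\<bar> \<le> K1" and K2: "\<And>x. \<bar>h2 x\<bar> \<le> K2"
  shows "\<bar>expectation (\<lambda>\<omega>. h (S \<omega>)) - integral\<^sup>L std_normal_distribution h
      - m3 / 6 * (\<Sum>i\<in>I. c i ^ 3) * (\<integral>x. h x * (x ^ 3 - 3 * x) \<partial>std_normal_distribution)\<bar>
    \<le> m4 * (\<Sum>i\<in>I. c i ^ 4) * (41 / 4 * K2 + 27 * K1 + 231 / 2 * K)"
proof -
  interpret N: real_distribution std_normal_distribution by (rule real_dist_normal_dist)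
  let ?c0 = "integral\<^sup>L std_normal_distribution h" and ?H = "\<integral>x. h x * (x ^ 3 - 3 * x) \<partial>std_normal_distribution"
  define L where "L = 3 * (K2 + 6 * K)"
  define B2 where "B2 = 3 * (K1 + 2 * K)"
  have K0: "K \<ge> 0" "K1 \<ge> 0" "K2 \<ge> 0" using K[of 0] K1[of 0] K2[of 0] by auto
  obtain f f1 f2 f3 where f: "\<And>x. (f has_real_derivative f1 x) (at x)" "\<And>x. (f1 has_real_derivative f2 x) (at x)"
    "\<And>x. (f2 has_real_derivative f3 x) (at x)" "\<And>x. f1 x = x * f x + (h x - ?c0)"
    "\<And>x. \<bar>f x\<bar> \<le> 2 * K" "\<And>x. \<bar>f1 x\<bar> \<le> 3 * K" "\<And>x. \<bar>f2 x\<bar> \<le> B2" "\<And>x. \<bar>f3 x\<bar> \<le> L"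
    "integral\<^sup>L std_normal_distribution f2 = - (1/3) * ?H"
    using stein_solution_third[OF D K K1 K2] unfolding L_def B2_def by blast
  have LB: "L \<ge> 0" "B2 \<ge> 0" using K0 by (auto simp: L_def B2_def)
  have [measurable]: "f \<in> borel_measurable borel" "f1 \<in> borel_measurable borel" "f2 \<in> borel_measurable borel"
    by (intro borel_measurable_continuous_onI DERIV_continuous_on; use f(1-3) in auto)+
  have [measurable]: "h \<in> borel_measurable borel"
    by (intro borel_measurable_continuous_onI DERIV_continuous_on) (use D(1) in auto)
  have I: "I \<noteq> {}" using c by auto
  then obtain i0 where i0: "i0 \<in> I" by auto
  note mf = moment_facts[OF i0]
  have hi: "integrable M (\<lambda>\<omega>. h (S \<omega>))"
  proof (rule bounded_integrable[where F = h])
    show "\<bar>h x\<bar> \<le> K + \<bar>?c0\<bar>" for x using K[of x] by linarith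
  qed auto
  define A2 where "A2 = expectation (\<lambda>\<omega>. f2 (S \<omega>))"
  define s3 where "s3 = (\<Sum>i\<in>I. c i ^ 3)"
  define s4 where "s4 = (\<Sum>i\<in>I. c i ^ 4)"
  have "expectation (\<lambda>\<omega>. h (S \<omega>)) - ?c0 = expectation (\<lambda>\<omega>. h (S \<omega>) - ?c0)"
    using hi by (simp add: prob_space)
  also have "\<dots> = expectation (\<lambda>\<omega>. f1 (S \<omega>) - S \<omega> * f (S \<omega>))" by (simp add: f(4))
  also have "\<dots> = - (\<Sum>i\<in>I. expectation (\<lambda>\<omega>. c i * X i \<omega> * f (S \<omega>)) - (c i)\<^sup>2 * expectation (\<lambda>\<omega>. f1 (S \<omega>)))"
    using f by (intro stein_sum c) auto
  finally have "\<bar>expectation (\<lambda>\<omega>. h (S \<omega>)) - ?c0 + m3 / 2 * s3 * A2\<bar> =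
      \<bar>\<Sum>i\<in>I. expectation (\<lambda>\<omega>. c i * X i \<omega> * f (S \<omega>)) - (c i)\<^sup>2 * expectation (\<lambda>\<omega>. f1 (S \<omega>)) - c i ^ 3 * m3 / 2 * A2\<bar>"
    unfolding s3_def by (subst abs_minus_cancel[symmetric]) (simp add: sum_subtractf sum_distrib_left sum_distrib_right mult_ac)
  also have "\<dots> \<le> (\<Sum>i\<in>I. 7 / 6 * L * m4 * c i ^ 4)"
    unfolding A2_def by (intro order_trans[OF sum_abs] sum_mono stein_term_third[OF _ f(1,2,3,5,6,7,8)])
  also have "\<dots> = 7 / 6 * L * m4 * s4" unfolding sum_distrib_left[symmetric] s4_def ..
  finally have A: "\<bar>expectation (\<lambda>\<omega>. h (S \<omega>)) - ?c0 + m3 / 2 * s3 * A2\<bar> \<le> 7 / 6 * L * m4 * s4" .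
  have f2i: "integrable std_normal_distribution f2"
    by (rule N.integrable_const_bound[where B = B2]) (use f(7) in auto)
  have "\<bar>integral\<^sup>L std_normal_distribution f2\<bar> \<le> N.expectation (\<lambda>x. \<bar>f2 x\<bar>)" by (rule integral_abs_bound)
  also have "\<dots> \<le> N.expectation (\<lambda>x. B2)" using f2i f(7) by (intro integral_mono) auto
  also have "\<dots> = B2" using N.prob_space by simp
  finally have "\<bar>f2 x - integral\<^sup>L std_normal_distribution f2\<bar> \<le> 2 * B2" for x
    using f(7)[of x] by linarith
  \<comment> \<open>The second derivative of the Stein solution is itself used as a test function.
    The first-order theorem suffices because the prefactor is already of third order.\<close>
  from clt_first_order[OF c f(3) this f(8)]
  have "\<bar>A2 - - (1/3) * ?H\<bar> \<le> 9 / 2 * (L + 4 * B2) * b3 * (\<Sum>i\<in>I. \<bar>c i\<bar> ^ 3)"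
    unfolding A2_def f(9) by simp
  then have "\<bar>m3 / 2 * s3\<bar> * \<bar>A2 - - (1/3) * ?H\<bar> \<le> (b3 / 2 * (\<Sum>i\<in>I. \<bar>c i\<bar> ^ 3)) * (9 / 2 * (L + 4 * B2) * b3 * (\<Sum>i\<in>I. \<bar>c i\<bar> ^ 3))"
  proof (rule mult_mono[rotated])
    have "\<bar>s3\<bar> \<le> (\<Sum>i\<in>I. \<bar>c i\<bar> ^ 3)" unfolding s3_def power_abs[symmetric] by (rule sum_abs)
    then show "\<bar>m3 / 2 * s3\<bar> \<le> b3 / 2 * (\<Sum>i\<in>I. \<bar>c i\<bar> ^ 3)"
      unfolding abs_mult using mf by (intro mult_mono) auto
  qed (use mf in \<open>auto intro!: mult_nonneg_nonneg sum_nonneg\<close>)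
  also have "\<dots> = 9 / 4 * (L + 4 * B2) * (b3\<^sup>2 * (\<Sum>i\<in>I. \<bar>c i\<bar> ^ 3)\<^sup>2)" by (simp add: power2_eq_square)
  \<comment> \<open>A product of two third-order quantities is of fourth order: with sum c_i^2 = 1,
    Cauchy-Schwarz gives (sum |c_i|^3)^2 <= sum c_i^4, and b3^2 <= m4 is the analogue for
    moments.\<close>
  also have "\<dots> \<le> 9 / 4 * (L + 4 * B2) * (m4 * s4)"
  proof (intro mult_left_mono mult_mono mf)
    have "(\<Sum>i\<in>I. \<bar>c i\<bar> * (c i)\<^sup>2)\<^sup>2 \<le> (\<Sum>i\<in>I. \<bar>c i\<bar>\<^sup>2) * (\<Sum>i\<in>I. ((c i)\<^sup>2)\<^sup>2)"
      by (rule Cauchy_Schwarz_ineq_sum)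
    then have "(\<Sum>i\<in>I. \<bar>c i\<bar> * (c i)\<^sup>2)\<^sup>2 \<le> s4" using c by (simp add: s4_def flip: power_mult)
    moreover have "(\<Sum>i\<in>I. \<bar>c i\<bar> * (c i)\<^sup>2) = (\<Sum>i\<in>I. \<bar>c i\<bar> ^ 3)"
      by (intro sum.cong) (auto simp: power3_eq_cube power2_eq_square)
    ultimately show "(\<Sum>i\<in>I. \<bar>c i\<bar> ^ 3)\<^sup>2 \<le> s4" by simp
  qed (use mf LB in auto)
  finally have B: "\<bar>m3 / 2 * s3 * A2 + m3 / 6 * s3 * ?H\<bar> \<le> 9 / 4 * (L + 4 * B2) * (m4 * s4)"
    unfolding abs_mult[symmetric] by (simp add: algebra_simps)
  have "\<bar>expectation (\<lambda>\<omega>. h (S \<omega>)) - ?c0 - m3 / 6 * s3 * ?H\<bar> \<le>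
     \<bar>expectation (\<lambda>\<omega>. h (S \<omega>)) - ?c0 + m3 / 2 * s3 * A2\<bar> + \<bar>m3 / 2 * s3 * A2 + m3 / 6 * s3 * ?H\<bar> "
    by linarith
  also have "\<dots> \<le> 7 / 6 * L * m4 * s4 + 9 / 4 * (L + 4 * B2) * (m4 * s4)"
    by (intro add_mono A B)
  \<comment> \<open>The total coefficient is 7/6 + 9/4 = 41/12 for \<open>L\<close> and 9 for
    \<open>B2\<close>.\<close>
  also have "\<dots> = m4 * s4 * (41 / 4 * K2 + 27 * K1 + 231 / 2 * K)"
    unfolding L_def B2_def by (simp add: field_simps)
  finally show ?thesis unfolding s3_def s4_def .
qed

section \<open>Gaussian vectors\<close>

lemma indep_vars_PiM_coordinates:
  assumes M: "\<And>i. i \<in> I \<Longrightarrow> prob_space (M i)" and "I \<noteq> {}"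
  shows "prob_space.indep_vars (PiM I M) M (\<lambda>i \<omega>. \<omega> i) I"
proof -
  interpret P: prob_space "PiM I M" by (intro prob_space_PiM M)
  have "distr (PiM I M) (PiM I M) (\<lambda>x. \<lambda>i\<in>I. x i) = distr (PiM I M) (PiM I M) (\<lambda>x. x)"
    by (intro distr_cong) (auto simp: space_PiM PiE_def extensional_restrict)
  also have "\<dots> = PiM I M" by simp
  also have "\<dots> = PiM I (\<lambda>i. distr (PiM I M) (M i) (\<lambda>\<omega>. \<omega> i))"
    by (intro PiM_cong) (auto simp: distr_PiM_component M)
  finally show ?thesis
    using assms by (subst P.indep_vars_iff_distr_eq_PiM') auto
qed

lemma PiM_component_integral:
  assumes M: "\<And>i. i \<in> I \<Longrightarrow> prob_space (M i)" and i: "i \<in> I"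
    and u: "u \<in> borel_measurable (M i)"
  shows "integrable (M i) u \<Longrightarrow> integrable (PiM I M) (\<lambda>x. u (x i) :: real)"
    "(\<integral>x. u (x i) \<partial>PiM I M) = integral\<^sup>L (M i) u"
proof -
  have m: "(\<lambda>\<omega>. \<omega> i) \<in> measurable (PiM I M) (M i)" using i by measurable
  note d = distr_PiM_component[of I M i, OF M i]
  show "integrable (PiM I M) (\<lambda>x. u (x i))" if "integrable (M i) u"
    using that u by (subst integrable_distr_eq[OF m, symmetric]) (simp_all add: d)
  show "(\<integral>x. u (x i) \<partial>PiM I M) = integral\<^sup>L (M i) u"
    using u by (subst integral_distr[OF m, symmetric]) (simp_all add: d)
qed

lemma (in prob_space) sum_square_expectation:
  fixes X :: "'i \<Rightarrow> 'a \<Rightarrow> real"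
  assumes "finite I" "indep_vars (\<lambda>_. borel) X I"
    and "\<And>i. i \<in> I \<Longrightarrow> integrable M (\<lambda>\<omega>. X i \<omega> ^ 2)" "\<And>i. i \<in> I \<Longrightarrow> expectation (X i) = 0"
  shows "integrable M (\<lambda>\<omega>. (\<Sum>i\<in>I. X i \<omega>) ^ 2)"
    and "expectation (\<lambda>\<omega>. (\<Sum>i\<in>I. X i \<omega>) ^ 2) = (\<Sum>i\<in>I. expectation (\<lambda>\<omega>. X i \<omega> ^ 2))"
proof -
  have "integrable M (\<lambda>\<omega>. (\<Sum>i\<in>I. X i \<omega>) ^ 2) \<and>
    expectation (\<lambda>\<omega>. (\<Sum>i\<in>I. X i \<omega>) ^ 2) = (\<Sum>i\<in>I. expectation (\<lambda>\<omega>. X i \<omega> ^ 2))"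
    using assms
  proof (induction I rule: finite_induct)
    case (insert i I)
    let ?S = "\<lambda>\<omega>. \<Sum>i\<in>I. X i \<omega>"
    have [measurable]: "X j \<in> borel_measurable M" if "j \<in> insert i I" for j
      using insert.prems(1) that by (auto simp: indep_vars_def)
    have IH: "integrable M (\<lambda>\<omega>. ?S \<omega> ^ 2)" "expectation (\<lambda>\<omega>. ?S \<omega> ^ 2) = (\<Sum>i\<in>I. expectation (\<lambda>\<omega>. X i \<omega> ^ 2))"
      using insert.IH indep_vars_subset[OF insert.prems(1), of I] insert.prems by auto
    have iv: "indep_var borel (X i) borel ?S"
      using insert by (intro indep_vars_sum) auto
    have X1: "integrable M (X j)" if "j \<in> insert i I" for j
      by (rule square_integrable_imp_integrable) (use that insert.prems(2) in auto)
    have S1: "integrable M ?S" using X1 by auto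
    have cross: "integrable M (\<lambda>\<omega>. X i \<omega> * ?S \<omega>)" "expectation (\<lambda>\<omega>. X i \<omega> * ?S \<omega>) = 0"
      using indep_var_integrable[OF iv X1 S1] indep_var_lebesgue_integral[OF iv X1 S1] insert.prems(3) by auto
    have eq: "(\<lambda>\<omega>. (\<Sum>i\<in>insert i I. X i \<omega>) ^ 2) = (\<lambda>\<omega>. X i \<omega> ^ 2 + ?S \<omega> ^ 2 + 2 * (X i \<omega> * ?S \<omega>))"
      using insert.hyps by (auto simp: power2_sum)
    have "integrable M (\<lambda>\<omega>. X i \<omega> ^ 2)" using insert.prems(2) by auto
    then show ?case unfolding eq using IH cross insert.hyps by simp
  qed auto
  then show "integrable M (\<lambda>\<omega>. (\<Sum>i\<in>I. X i \<omega>) ^ 2)"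
    "expectation (\<lambda>\<omega>. (\<Sum>i\<in>I. X i \<omega>) ^ 2) = (\<Sum>i\<in>I. expectation (\<lambda>\<omega>. X i \<omega> ^ 2))" by auto
qed

lemma (in prob_space) integrable_power_le_fourth:
  fixes X :: "'a \<Rightarrow> real"
  assumes [measurable]: "X \<in> borel_measurable M" and i: "integrable M (\<lambda>\<omega>. X \<omega> ^ 4)" and k: "k \<le> 4"
  shows "integrable M (\<lambda>\<omega>. X \<omega> ^ k)"
proof (rule Bochner_Integration.integrable_bound[where f = "\<lambda>\<omega>. 1 + X \<omega> ^ 4"])
  show "AE \<omega> in M. norm (X \<omega> ^ k) \<le> norm (1 + X \<omega> ^ 4)"
    using power_le_one_plus_power4[OF k] by (auto simp: power_abs intro!: always_eventually order_trans[OF power_le_one_plus_power4[OF k] abs_ge_self])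
qed (use i in auto)

lemma (in prob_space) sum_fourth_expectation:
  fixes X :: "'i \<Rightarrow> 'a \<Rightarrow> real"
  assumes "finite I" "indep_vars (\<lambda>_. borel) X I"
    and "\<And>i. i \<in> I \<Longrightarrow> integrable M (\<lambda>\<omega>. X i \<omega> ^ 4)" "\<And>i. i \<in> I \<Longrightarrow> expectation (X i) = 0"
  shows "integrable M (\<lambda>\<omega>. (\<Sum>i\<in>I. X i \<omega>) ^ 4)"
    and "expectation (\<lambda>\<omega>. (\<Sum>i\<in>I. X i \<omega>) ^ 4) \<le> (\<Sum>i\<in>I. expectation (\<lambda>\<omega>. X i \<omega> ^ 4)) + 3 * (\<Sum>i\<in>I. expectation (\<lambda>\<omega>. X i \<omega> ^ 2))\<^sup>2"
proof -
  have "integrable M (\<lambda>\<omega>. (\<Sum>i\<in>I. X i \<omega>) ^ 4) \<and>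
    expectation (\<lambda>\<omega>. (\<Sum>i\<in>I. X i \<omega>) ^ 4) \<le> (\<Sum>i\<in>I. expectation (\<lambda>\<omega>. X i \<omega> ^ 4)) + 3 * (\<Sum>i\<in>I. expectation (\<lambda>\<omega>. X i \<omega> ^ 2))\<^sup>2"
    using assms
  proof (induction I rule: finite_induct)
    case (insert i I)
    let ?S = "\<lambda>\<omega>. \<Sum>i\<in>I. X i \<omega>"
    have mX: "X j \<in> borel_measurable M" if "j \<in> insert i I" for j
      using insert.prems(1) that by (auto simp: indep_vars_def)
    then have [measurable]: "X i \<in> borel_measurable M" "?S \<in> borel_measurable M" by auto
    have ivI: "indep_vars (\<lambda>_. borel) X I" using indep_vars_subset[OF insert.prems(1), of I] by auto
    have IH: "integrable M (\<lambda>\<omega>. ?S \<omega> ^ 4)" "expectation (\<lambda>\<omega>. ?S \<omega> ^ 4) \<le> (\<Sum>i\<in>I. expectation (\<lambda>\<omega>. X i \<omega> ^ 4)) + 3 * (\<Sum>i\<in>I. expectation (\<lambda>\<omega>. X i \<omega> ^ 2))\<^sup>2"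
      using insert.IH ivI insert.prems by auto
    have iv: "indep_var borel (X i) borel ?S"
      using insert by (intro indep_vars_sum) auto
    have Xp: "integrable M (\<lambda>\<omega>. X j \<omega> ^ k)" if "k \<le> 4" "j \<in> insert i I" for j k
      using insert.prems(2) mX that by - (rule integrable_power_le_fourth, auto)
    have Sp: "integrable M (\<lambda>\<omega>. ?S \<omega> ^ k)" if "k \<le> 4" for k
      using IH that by - (rule integrable_power_le_fourth, auto)
    have ivp: "indep_var borel (\<lambda>\<omega>. X i \<omega> ^ k) borel (\<lambda>\<omega>. ?S \<omega> ^ l)" for k l
      using indep_var_compose[OF iv, of "\<lambda>x. x ^ k" borel "\<lambda>x. x ^ l" borel] by (auto simp: comp_def)
    have cross: "integrable M (\<lambda>\<omega>. X i \<omega> ^ k * ?S \<omega> ^ l)"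
      "expectation (\<lambda>\<omega>. X i \<omega> ^ k * ?S \<omega> ^ l) = expectation (\<lambda>\<omega>. X i \<omega> ^ k) * expectation (\<lambda>\<omega>. ?S \<omega> ^ l)"
      if "k \<le> 4" "l \<le> 4" for k l
      using indep_var_integrable[OF ivp Xp Sp] indep_var_lebesgue_integral[OF ivp Xp Sp] that by auto
    have "integrable M (X j)" if "j \<in> insert i I" for j using Xp[of 1 j] that by auto
    then have S0: "expectation ?S = 0" using insert.prems(3) by simp
    have S2: "expectation (\<lambda>\<omega>. ?S \<omega> ^ 2) = (\<Sum>i\<in>I. expectation (\<lambda>\<omega>. X i \<omega> ^ 2))"
      using Xp insert.prems insert.hyps by (intro sum_square_expectation ivI) auto
    have X0: "expectation (X i) = 0" using insert.prems(3) by simp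
    have "(a + b) ^ 4 = a ^ 4 + b ^ 4 + 6 * (a ^ 2 * b ^ 2) + 4 * (a ^ 3 * b ^ 1) + 4 * (a ^ 1 * b ^ 3)" for a b :: real
      by (simp add: eval_nat_numeral algebra_simps)
    moreover have "(\<Sum>i\<in>insert i I. X i \<omega>) = X i \<omega> + ?S \<omega>" for \<omega>
      using insert.hyps by simp
    ultimately have eq: "(\<lambda>\<omega>. (\<Sum>i\<in>insert i I. X i \<omega>) ^ 4) = (\<lambda>\<omega>. X i \<omega> ^ 4 + ?S \<omega> ^ 4 + 6 * (X i \<omega> ^ 2 * ?S \<omega> ^ 2)
        + 4 * (X i \<omega> ^ 3 * ?S \<omega> ^ 1) + 4 * (X i \<omega> ^ 1 * ?S \<omega> ^ 3))"
      by (simp only:)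
    have int: "integrable M (\<lambda>\<omega>. (\<Sum>i\<in>insert i I. X i \<omega>) ^ 4)"
      unfolding eq by (intro Bochner_Integration.integrable_add integrable_mult_right cross Xp IH) auto
    define v where "v = expectation (\<lambda>\<omega>. X i \<omega> ^ 2)"
    define s where "s = (\<Sum>i\<in>I. expectation (\<lambda>\<omega>. X i \<omega> ^ 2))"
    have "expectation (\<lambda>\<omega>. (\<Sum>i\<in>insert i I. X i \<omega>) ^ 4) = expectation (\<lambda>\<omega>. X i \<omega> ^ 4) + expectation (\<lambda>\<omega>. ?S \<omega> ^ 4) + 6 * (v * s)"
      unfolding eq
      using cross[of 2 2] cross[of 3 1] cross[of 1 3] Xp[of 4 i] IH S0 S2 X0 by (simp add: v_def s_def)
    \<comment> \<open>The added \<open>3 * v\<^sup>2\<close> completes the square of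
      \<open>v + s\<close> and so closes the induction.\<close>
    also have "\<dots> \<le> expectation (\<lambda>\<omega>. X i \<omega> ^ 4) + ((\<Sum>i\<in>I. expectation (\<lambda>\<omega>. X i \<omega> ^ 4)) + 3 * s\<^sup>2) + 6 * (v * s) + 3 * v\<^sup>2"
    proof -
      have "0 \<le> 3 * v\<^sup>2" by simp
      then show ?thesis using IH(2) unfolding s_def[symmetric] by linarith
    qed
    also have "\<dots> = (\<Sum>i\<in>insert i I. expectation (\<lambda>\<omega>. X i \<omega> ^ 4)) + 3 * (\<Sum>i\<in>insert i I. expectation (\<lambda>\<omega>. X i \<omega> ^ 2))\<^sup>2"
      using insert.hyps by (simp add: v_def[symmetric] s_def[symmetric] power2_sum)
    finally show ?case using int by simp
  qed auto
  then show "integrable M (\<lambda>\<omega>. (\<Sum>i\<in>I. X i \<omega>) ^ 4)"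
    "expectation (\<lambda>\<omega>. (\<Sum>i\<in>I. X i \<omega>) ^ 4) \<le> (\<Sum>i\<in>I. expectation (\<lambda>\<omega>. X i \<omega> ^ 4)) + 3 * (\<Sum>i\<in>I. expectation (\<lambda>\<omega>. X i \<omega> ^ 2))\<^sup>2" by auto
qed

section \<open>Linear forms and moments of Gaussian vectors\<close>

abbreviation gauss_vec :: "'k set \<Rightarrow> ('k \<Rightarrow> real) measure" where
  "gauss_vec I \<equiv> PiM I (\<lambda>_. std_normal_distribution)"

lemma prob_space_gauss: "prob_space std_normal_distribution"
  using real_dist_normal_dist by (simp add: real_distribution_def)

lemma prob_space_gauss_vec: "prob_space (gauss_vec I)"
  by (intro prob_space_PiM prob_space_gauss)

lemma sets_gauss_vec: "sets (gauss_vec I) = sets (PiM I (\<lambda>_. borel))"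
  by (intro sets_PiM_cong) auto

lemma measurable_gauss_vec: "f \<in> borel_measurable (PiM I (\<lambda>_. borel)) \<Longrightarrow> f \<in> borel_measurable (gauss_vec I)"
  by (simp cong: measurable_cong_sets add: measurable_cong_sets[OF sets_gauss_vec refl])

text \<open>Characteristic functions multiply over the independent coordinates, and the exponents (t
  a_k)^2 / 2 add up.\<close>

lemma gauss_vec_linear:
  assumes "finite I" "I \<noteq> {}"
  shows "distr (gauss_vec I) borel (\<lambda>N. \<Sum>k\<in>I. a k * N k) = distr std_normal_distribution borel (\<lambda>z. sqrt (\<Sum>k\<in>I. (a k)\<^sup>2) * z)"
proof (rule Levy_uniqueness)
  interpret G: prob_space "gauss_vec I" by (rule prob_space_gauss_vec)
  interpret N: real_distribution std_normal_distribution by (rule real_dist_normal_dist)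
  let ?s = "sqrt (\<Sum>k\<in>I. (a k)\<^sup>2)"
  have mk: "(\<lambda>N. N k) \<in> borel_measurable (gauss_vec I)" if "k \<in> I" for k
    using that by (intro measurable_gauss_vec) auto
  have [measurable]: "(\<lambda>N. \<Sum>k\<in>I. a k * N k) \<in> borel_measurable (gauss_vec I)"
    by (intro borel_measurable_sum borel_measurable_times mk) auto
  show "real_distribution (distr (gauss_vec I) borel (\<lambda>N. \<Sum>k\<in>I. a k * N k))"
    by (intro G.real_distribution_distr) auto
  show "real_distribution (distr std_normal_distribution borel (\<lambda>z. ?s * z))"
    by (intro N.real_distribution_distr) auto
  have scale: "char (distr std_normal_distribution borel (\<lambda>z. b * z)) t = complex_of_real (exp (- ((t * b)\<^sup>2) / 2))" for b t
  proof -
    have "char (distr std_normal_distribution borel (\<lambda>z. b * z)) t = char std_normal_distribution (t * b)"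
      unfolding char_def by (subst integral_distr) (auto simp: mult.assoc)
    then show ?thesis by (simp add: char_std_normal_distribution)
  qed
  have iv: "G.indep_vars (\<lambda>_. borel) (\<lambda>k N. a k * N k) I"
  proof -
    have "G.indep_vars (\<lambda>_. std_normal_distribution) (\<lambda>k N. N k) I"
      by (intro indep_vars_PiM_coordinates prob_space_gauss assms)
    from G.indep_vars_compose2[OF this, of "\<lambda>k x. a k * x" "\<lambda>_. borel"] show ?thesis by auto
  qed
  show "char (distr (gauss_vec I) borel (\<lambda>N. \<Sum>k\<in>I. a k * N k)) = char (distr std_normal_distribution borel (\<lambda>z. ?s * z))"
  proof
    fix t
    have "char (distr (gauss_vec I) borel (\<lambda>N. \<Sum>k\<in>I. a k * N k)) t = (\<Prod>k\<in>I. char (distr (gauss_vec I) borel (\<lambda>N. a k * N k)) t)"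
      by (rule G.char_distr_sum[OF iv])
    also have "\<dots> = (\<Prod>k\<in>I. complex_of_real (exp (- ((t * a k)\<^sup>2) / 2)))"
    proof (rule prod.cong)
      fix k assume k: "k \<in> I"
      have "distr (gauss_vec I) borel (\<lambda>N. a k * N k) = distr (distr (gauss_vec I) std_normal_distribution (\<lambda>N. N k)) borel (\<lambda>z. a k * z)"
        using k mk by (subst distr_distr) (auto simp: comp_def)
      also have "\<dots> = distr std_normal_distribution borel (\<lambda>z. a k * z)"
        using k by (subst distr_PiM_component) (auto intro: prob_space_gauss)
      finally show "char (distr (gauss_vec I) borel (\<lambda>N. a k * N k)) t = complex_of_real (exp (- ((t * a k)\<^sup>2) / 2))"
        by (simp only: scale)
    qed auto
    also have "\<dots> = complex_of_real (exp (\<Sum>k\<in>I. - ((t * a k)\<^sup>2) / 2))"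
      using assms by (simp add: exp_sum)
    also have "(\<Sum>k\<in>I. - ((t * a k)\<^sup>2) / 2) = - ((t * ?s)\<^sup>2) / 2"
      by (simp add: power_mult_distrib sum_nonneg sum_divide_distrib[symmetric] sum_negf sum_distrib_left)
    finally show "char (distr (gauss_vec I) borel (\<lambda>N. \<Sum>k\<in>I. a k * N k)) t = char (distr std_normal_distribution borel (\<lambda>z. ?s * z)) t"
      by (simp only: scale)
  qed
qed

lemma gauss_vec_linear_integral:
  fixes h :: "real \<Rightarrow> real"
  assumes "finite I" "I \<noteq> {}" and [measurable]: "h \<in> borel_measurable borel"
  shows "(\<integral>N. h (\<Sum>k\<in>I. a k * N k) \<partial>gauss_vec I) = (\<integral>z. h (sqrt (\<Sum>k\<in>I. (a k)\<^sup>2) * z) \<partial>std_normal_distribution)"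
proof -
  have [measurable]: "(\<lambda>N. \<Sum>k\<in>I. a k * N k) \<in> borel_measurable (gauss_vec I)"
    by (intro borel_measurable_sum borel_measurable_times measurable_gauss_vec) auto
  have "(\<integral>N. h (\<Sum>k\<in>I. a k * N k) \<partial>gauss_vec I) = integral\<^sup>L (distr (gauss_vec I) borel (\<lambda>N. \<Sum>k\<in>I. a k * N k)) h"
    by (subst integral_distr) auto
  also have "\<dots> = (\<integral>z. h (sqrt (\<Sum>k\<in>I. (a k)\<^sup>2) * z) \<partial>std_normal_distribution)"
    unfolding gauss_vec_linear[OF assms(1,2)] by (subst integral_distr) auto
  finally show ?thesis .
qed

text \<open>The values 6 = 3! and 2 = 2! are the squared norms of He_3 and He_2. The first measures
  the cubic weight, the second the fluctuation of the squared length of a Gaussian vector.\<close>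

lemma gauss_moments:
  "(\<integral>x. (x ^ 3 - 3 * x)\<^sup>2 \<partial>std_normal_distribution) = 6" "(\<integral>x. x ^ 4 \<partial>std_normal_distribution) = 3"
  "(\<integral>x. (x\<^sup>2 - 1)\<^sup>2 \<partial>std_normal_distribution) = 2" "(\<integral>x. x\<^sup>2 - 1 \<partial>std_normal_distribution) = 0"
  "(\<integral>x. x ^ 3 - 3 * x \<partial>std_normal_distribution) = 0"
  "integrable std_normal_distribution (\<lambda>x. (x ^ 3 - 3 * x)\<^sup>2)" "integrable std_normal_distribution (\<lambda>x. (x\<^sup>2 - 1)\<^sup>2)"
  "integrable std_normal_distribution (\<lambda>x. x ^ 3 - 3 * x)" "integrable std_normal_distribution (\<lambda>x. x\<^sup>2 - 1)"
proof -
  interpret N: prob_space std_normal_distribution by (rule prob_space_gauss)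
  note i = integrable_std_normal_distribution_moment
  have e: "(\<integral>x. x ^ 6 \<partial>std_normal_distribution) = 15" "(\<integral>x. x ^ 4 \<partial>std_normal_distribution) = 3" "(\<integral>x. x\<^sup>2 \<partial>std_normal_distribution) = 1"
    "(\<integral>x. x \<partial>std_normal_distribution) = 0" "(\<integral>x. x ^ 3 \<partial>std_normal_distribution) = 0"
    using std_normal_distribution_even_moments(1)[of 3] std_normal_distribution_even_moments(1)[of 2] std_normal_distribution_even_moments(1)[of 1]
      integral_std_normal_distribution_moment_odd[of 1] integral_std_normal_distribution_moment_odd[of 3]
    by (simp_all add: fact_numeral)
  have i1: "integrable std_normal_distribution (\<lambda>x. x)" using i[of 1] by simp
  have eq: "(\<lambda>x::real. (x ^ 3 - 3 * x)\<^sup>2) = (\<lambda>x. x ^ 6 - 6 * x ^ 4 + 9 * x\<^sup>2)" "(\<lambda>x::real. (x\<^sup>2 - 1)\<^sup>2) = (\<lambda>x. x ^ 4 - 2 * x\<^sup>2 + 1)"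
    by (auto simp: power2_diff algebra_simps eval_nat_numeral)
  show "(\<integral>x. x ^ 4 \<partial>std_normal_distribution) = 3" by (fact e)
  show "integrable std_normal_distribution (\<lambda>x. (x ^ 3 - 3 * x)\<^sup>2)" "integrable std_normal_distribution (\<lambda>x. (x\<^sup>2 - 1)\<^sup>2)"
    unfolding eq using i by auto
  show "(\<integral>x. (x ^ 3 - 3 * x)\<^sup>2 \<partial>std_normal_distribution) = 6" "(\<integral>x. (x\<^sup>2 - 1)\<^sup>2 \<partial>std_normal_distribution) = 2"
    unfolding eq using i e N.prob_space by simp_all
  show "integrable std_normal_distribution (\<lambda>x. x ^ 3 - 3 * x)" "integrable std_normal_distribution (\<lambda>x. x\<^sup>2 - 1)"
    using i i1 by auto
  show "(\<integral>x. x\<^sup>2 - 1 \<partial>std_normal_distribution) = 0" "(\<integral>x. x ^ 3 - 3 * x \<partial>std_normal_distribution) = 0"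
    using i i1 e N.prob_space by simp_all
qed

lemma gauss_odd:
  fixes u :: "real \<Rightarrow> real"
  assumes [measurable]: "u \<in> borel_measurable borel" and odd: "\<And>x. u (- x) = - u x"
  shows "integral\<^sup>L std_normal_distribution u = 0"
proof -
  have "integral\<^sup>L std_normal_distribution u = (\<integral>x. std_normal_density x * u x \<partial>lborel)"
    by (subst integral_density) auto
  also have "\<dots> = (\<integral>x. std_normal_density (- x) * u (- x) \<partial>lborel)"
    by (subst lborel_integral_real_affine[of "-1" _ 0]) auto
  also have "\<dots> = - (\<integral>x. std_normal_density x * u x \<partial>lborel)"
    by (simp add: odd std_normal_density_def)
  also have "(\<integral>x. std_normal_density x * u x \<partial>lborel) = integral\<^sup>L std_normal_distribution u"
    by (subst integral_density) auto
  finally show ?thesis by simp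
qed

section \<open>Hermite weights on Gaussian vectors\<close>

lemma gauss_vec_split:
  fixes f :: "('k \<Rightarrow> real) \<Rightarrow> real"
  assumes "finite I" "k \<in> I" "integrable (gauss_vec I) f"
  shows "integral\<^sup>L (gauss_vec I) f = (\<integral>x. (\<integral>z. f (x(k := z)) \<partial>std_normal_distribution) \<partial>gauss_vec (I - {k}))"
proof -
  interpret N: prob_space std_normal_distribution by (rule prob_space_gauss)
  interpret product_prob_space "\<lambda>_. std_normal_distribution" by (rule product_prob_spaceI) (rule prob_space_gauss)
  show ?thesis
    using product_integral_insert[of "I - {k}" k f] assms by (simp add: insert_absorb)
qed

lemma integrable_mult_bounded:
  fixes u v :: "'a \<Rightarrow> real"
  assumes "integrable M u" "v \<in> borel_measurable M" "\<And>x. \<bar>v x\<bar> \<le> B"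
  shows "integrable M (\<lambda>x. v x * u x)"
proof (rule Bochner_Integration.integrable_bound[where f = "\<lambda>x. B * u x"])
  show "AE x in M. norm (v x * u x) \<le> norm (B * u x)"
  proof (intro always_eventually allI)
    fix x
    have "\<bar>v x\<bar> \<le> \<bar>B\<bar>" using assms(3)[of x] by linarith
    then show "norm (v x * u x) \<le> norm (B * u x)" by (simp add: abs_mult mult_right_mono)
  qed
qed (use assms in auto)

text \<open>With the other coordinates frozen, the test function of coordinate \<open>k\<close> is z
  |-> h(b z + R) with b = a_k. Three integrations by parts remove He_3, and each of them produces
  one factor b.\<close>

lemma gauss_vec_hermite_coordinate:
  assumes I: "finite I" "k \<in> I"
    and D: "\<And>x. (h has_real_derivative h1 x) (at x)" "\<And>x. (h1 has_real_derivative h2 x) (at x)"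
      "\<And>x. (h2 has_real_derivative h3 x) (at x)" and cont: "continuous_on UNIV h3"
    and B: "\<And>x. \<bar>h x\<bar> \<le> B" "\<And>x. \<bar>h1 x\<bar> \<le> B" "\<And>x. \<bar>h2 x\<bar> \<le> B" "\<And>x. \<bar>h3 x\<bar> \<le> B"
  shows "(\<integral>N. h (\<Sum>j\<in>I. a j * N j) * (N k ^ 3 - 3 * N k) \<partial>gauss_vec I) = a k ^ 3 * (\<integral>N. h3 (\<Sum>j\<in>I. a j * N j) \<partial>gauss_vec I)"
proof -
  interpret G: prob_space "gauss_vec I" by (rule prob_space_gauss_vec)
  have c: "continuous_on UNIV h" "continuous_on UNIV h1" "continuous_on UNIV h2"
    by (intro DERIV_continuous_on; use D in auto)+
  have [measurable]: "h \<in> borel_measurable borel" "h3 \<in> borel_measurable borel"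
    using c cont by (auto intro: borel_measurable_continuous_onI)
  have [measurable]: "(\<lambda>N. \<Sum>j\<in>I. a j * N j) \<in> borel_measurable (gauss_vec I)"
    by (intro borel_measurable_sum borel_measurable_times measurable_gauss_vec) auto
  have one: "(\<integral>z. h (b * z + R) * (z ^ 3 - 3 * z) \<partial>std_normal_distribution) = b ^ 3 * (\<integral>z. h3 (b * z + R) \<partial>std_normal_distribution)" for b R
  proof -
    \<comment> \<open>Dominates b^j times the j-th derivative of \<open>h\<close> for j up to 3, so
      that one constant serves all three integrations by parts.\<close>
    define C where "C = B * (1 + \<bar>b\<bar>) ^ 3"
    have B0: "B \<ge> 0" using B(1)[of 0] by linarith
    have le: "\<bar>b\<bar> ^ n * \<bar>v\<bar> \<le> C" if "\<bar>v\<bar> \<le> B" "n \<le> 3" for n v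
    proof -
      have "\<bar>b\<bar> ^ n \<le> (1 + \<bar>b\<bar>) ^ n" by (intro power_mono) auto
      also have "\<dots> \<le> (1 + \<bar>b\<bar>) ^ 3" using that by (intro power_increasing) auto
      finally have "\<bar>b\<bar> ^ n * \<bar>v\<bar> \<le> (1 + \<bar>b\<bar>) ^ 3 * B" using that by (intro mult_mono) auto
      then show ?thesis by (simp add: C_def mult.commute)
    qed
    have d: "((\<lambda>z. b ^ n * u (b * z + R)) has_real_derivative b ^ (Suc n) * u' (b * z + R)) (at z)"
      if "\<And>x. (u has_real_derivative u' x) (at x)" for n z and u u' :: "real \<Rightarrow> real"
    proof -
      have "((\<lambda>z. b * z + R) has_real_derivative b) (at z)" by (auto intro!: derivative_eq_intros)
      from DERIV_cmult[OF DERIV_chain2[OF that this], of "b ^ n"] show ?thesis by (simp add: mult_ac)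
    qed
    have cc: "continuous_on UNIV (\<lambda>z. b ^ n * u (b * z + R))" if "continuous_on UNIV u" for n and u :: "real \<Rightarrow> real"
      by (intro continuous_intros continuous_on_compose2[OF that]) auto
    have bb: "\<bar>b ^ n * u (b * z + R)\<bar> \<le> C" if "\<And>x. \<bar>u x\<bar> \<le> B" "n \<le> 3" for n z and u :: "real \<Rightarrow> real"
      unfolding abs_mult power_abs by (rule le) (use that in auto)
    have "(\<integral>z. b ^ 0 * h (b * z + R) * (z ^ 3 - 3 * z) \<partial>std_normal_distribution) = (\<integral>z. b ^ (Suc 0) * h1 (b * z + R) * (z\<^sup>2 - 1) \<partial>std_normal_distribution)"
      by (rule gauss_hermite(3)[where B = C]; (rule d[OF D(1)] cc[OF c(2)] | rule bb[OF B(1)], simp | rule bb[OF B(2)], simp))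
    also have "\<dots> = (\<integral>z. b ^ Suc (Suc 0) * h2 (b * z + R) * z \<partial>std_normal_distribution)"
      by (rule gauss_hermite(2)[where B = C]; (rule d[OF D(2)] cc[OF c(3)] | rule bb[OF B(2)], simp | rule bb[OF B(3)], simp))
    also have "\<dots> = (\<integral>z. b ^ Suc (Suc (Suc 0)) * h3 (b * z + R) \<partial>std_normal_distribution)"
      by (rule gauss_hermite(1)[where B = C]; (rule d[OF D(3)] cc[OF cont] | rule bb[OF B(3)], simp | rule bb[OF B(4)], simp))
    finally show ?thesis by (simp add: eval_nat_numeral mult_ac)
  qed
  have sp: "(\<Sum>j\<in>I. a j * (x(k := z)) j) = a k * z + (\<Sum>j\<in>I-{k}. a j * x j)" for x z
    using I by (subst sum.remove[of I k]) (auto intro!: sum.cong)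
  have i1: "integrable (gauss_vec I) (\<lambda>N. h (\<Sum>j\<in>I. a j * N j) * (N k ^ 3 - 3 * N k))"
    by (rule integrable_mult_bounded[where B = B])
       (use B(1) in \<open>auto intro!: PiM_component_integral(1)[where u = "\<lambda>x. x ^ 3 - 3 * x"] prob_space_gauss I gauss_moments\<close>)
  have i2: "integrable (gauss_vec I) (\<lambda>N. h3 (\<Sum>j\<in>I. a j * N j))"
    by (rule G.integrable_const_bound[where B = B]) (use B(4) in auto)
  show ?thesis
    unfolding gauss_vec_split[OF I i1] gauss_vec_split[OF I i2] sp by (simp add: one)
qed

text \<open>Both sides reduce to the mean of the third derivative. The purpose is to trade the
  correction along the direction of \<open>a\<close> for one whose polynomial weight does not depend
  on \<open>a\<close>, which is what allows \<open>a\<close> to be randomised. Multiplying by s^3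
  instead of dividing keeps the identity true for s = 0.\<close>

lemma gauss_vec_hermite_sum:
  assumes I: "finite I" "I \<noteq> {}"
    and D: "\<And>x. (h has_real_derivative h1 x) (at x)" "\<And>x. (h1 has_real_derivative h2 x) (at x)"
      "\<And>x. (h2 has_real_derivative h3 x) (at x)" and cont: "continuous_on UNIV h3"
    and B: "\<And>x. \<bar>h x\<bar> \<le> B" "\<And>x. \<bar>h1 x\<bar> \<le> B" "\<And>x. \<bar>h2 x\<bar> \<le> B" "\<And>x. \<bar>h3 x\<bar> \<le> B"
    and s: "s = sqrt (\<Sum>k\<in>I. (a k)\<^sup>2)"
  shows "s ^ 3 * (\<integral>N. h (\<Sum>j\<in>I. a j * N j) * (\<Sum>k\<in>I. N k ^ 3 - 3 * N k) \<partial>gauss_vec I) =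
    (\<Sum>k\<in>I. a k ^ 3) * (\<integral>z. h (s * z) * (z ^ 3 - 3 * z) \<partial>std_normal_distribution)"
proof -
  have c: "continuous_on UNIV h"
    by (intro DERIV_continuous_on) (use D(1) in auto)
  have [measurable]: "h \<in> borel_measurable borel" "h3 \<in> borel_measurable borel"
    using c cont by (auto intro: borel_measurable_continuous_onI)
  have [measurable]: "(\<lambda>N. \<Sum>j\<in>I. a j * N j) \<in> borel_measurable (gauss_vec I)"
    by (intro borel_measurable_sum borel_measurable_times measurable_gauss_vec) auto
  have i1: "integrable (gauss_vec I) (\<lambda>N. h (\<Sum>j\<in>I. a j * N j) * (N k ^ 3 - 3 * N k))" if "k \<in> I" for k
    by (rule integrable_mult_bounded[where B = B])
       (use B(1) that in \<open>auto intro!: PiM_component_integral(1)[where u = "\<lambda>x. x ^ 3 - 3 * x"] prob_space_gauss I gauss_moments\<close>)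
  have "(\<integral>N. h (\<Sum>j\<in>I. a j * N j) * (\<Sum>k\<in>I. N k ^ 3 - 3 * N k) \<partial>gauss_vec I) =
     (\<Sum>k\<in>I. \<integral>N. h (\<Sum>j\<in>I. a j * N j) * (N k ^ 3 - 3 * N k) \<partial>gauss_vec I)"
    unfolding sum_distrib_left using i1 by (intro Bochner_Integration.integral_sum) auto
  also have "\<dots> = (\<Sum>k\<in>I. a k ^ 3) * (\<integral>N. h3 (\<Sum>j\<in>I. a j * N j) \<partial>gauss_vec I)"
    unfolding sum_distrib_right by (intro sum.cong refl gauss_vec_hermite_coordinate[OF I(1) _ D cont B])
  also have "(\<integral>N. h3 (\<Sum>j\<in>I. a j * N j) \<partial>gauss_vec I) = (\<integral>z. h3 (s * z) \<partial>std_normal_distribution)"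
    unfolding s by (rule gauss_vec_linear_integral[OF I]) auto
  finally have A: "(\<integral>N. h (\<Sum>j\<in>I. a j * N j) * (\<Sum>k\<in>I. N k ^ 3 - 3 * N k) \<partial>gauss_vec I) =
    (\<Sum>k\<in>I. a k ^ 3) * (\<integral>z. h3 (s * z) \<partial>std_normal_distribution)" .
  \<comment> \<open>The one-dimensional identity is the vector identity over a one-element index
    set.\<close>
  have "(\<integral>N. h (\<Sum>j\<in>{()}. s * N j) * (N () ^ 3 - 3 * N ()) \<partial>gauss_vec {()}) = s ^ 3 * (\<integral>N. h3 (\<Sum>j\<in>{()}. s * N j) \<partial>gauss_vec {()})"
    by (rule gauss_vec_hermite_coordinate[OF _ _ D cont B]) auto
  also have "(\<integral>N. h3 (\<Sum>j\<in>{()}. s * N j) \<partial>gauss_vec {()}) = (\<integral>z. h3 (s * z) \<partial>std_normal_distribution)"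
    using PiM_component_integral(2)[of "{()}" "\<lambda>_. std_normal_distribution" "()" "\<lambda>z. h3 (s * z)"] by (simp add: prob_space_gauss)
  also have "(\<integral>N. h (\<Sum>j\<in>{()}. s * N j) * (N () ^ 3 - 3 * N ()) \<partial>gauss_vec {()}) = (\<integral>z. h (s * z) * (z ^ 3 - 3 * z) \<partial>std_normal_distribution)"
    using PiM_component_integral(2)[of "{()}" "\<lambda>_. std_normal_distribution" "()" "\<lambda>z. h (s * z) * (z ^ 3 - 3 * z)"] by (simp add: prob_space_gauss)
  finally show ?thesis unfolding A by simp
qed

text \<open>A function of the squared length is even in each coordinate, while He_3 is odd, so each
  summand vanishes already after integrating its own coordinate.\<close>

lemma gauss_vec_hermite_radial:
  fixes \<psi> :: "real \<Rightarrow> real"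
  assumes I: "finite I" and [measurable]: "\<psi> \<in> borel_measurable borel" and B: "\<And>x. \<bar>\<psi> x\<bar> \<le> B"
  shows "(\<integral>N. \<psi> (\<Sum>j\<in>I. (N j)\<^sup>2) * (\<Sum>k\<in>I. N k ^ 3 - 3 * N k) \<partial>gauss_vec I) = 0"
proof -
  have [measurable]: "(\<lambda>N. \<Sum>j\<in>I. (N j)\<^sup>2) \<in> borel_measurable (gauss_vec I)"
    by (intro borel_measurable_sum borel_measurable_power measurable_gauss_vec) auto
  have i1: "integrable (gauss_vec I) (\<lambda>N. \<psi> (\<Sum>j\<in>I. (N j)\<^sup>2) * (N k ^ 3 - 3 * N k))" if "k \<in> I" for k
    by (rule integrable_mult_bounded[where B = B])
       (use B that in \<open>auto intro!: PiM_component_integral(1)[where u = "\<lambda>x. x ^ 3 - 3 * x"] prob_space_gauss I gauss_moments\<close>)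
  have "(\<integral>N. \<psi> (\<Sum>j\<in>I. (N j)\<^sup>2) * (N k ^ 3 - 3 * N k) \<partial>gauss_vec I) = 0" if k: "k \<in> I" for k
  proof -
    have sp: "(\<Sum>j\<in>I. ((x(k := z)) j)\<^sup>2) = z\<^sup>2 + (\<Sum>j\<in>I-{k}. (x j)\<^sup>2)" for x z
      using I k by (subst sum.remove[of I k]) (auto intro!: sum.cong)
    have "(\<integral>z. \<psi> (z\<^sup>2 + R) * (z ^ 3 - 3 * z) \<partial>std_normal_distribution) = 0" for R
      by (rule gauss_odd) (auto simp: algebra_simps)
    then show ?thesis unfolding gauss_vec_split[OF I k i1[OF k]] sp by simp
  qed
  then show ?thesis unfolding sum_distrib_left using i1 by (subst Bochner_Integration.integral_sum) auto
qed

section \<open>The variance-gamma law as a normal variance mixture\<close>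

text \<open>Exhaustion by compact intervals: each side is the increasing limit of its restrictions,
  for which ordinary substitution applies.\<close>

lemma nn_integral_substitution_range:
  fixes f :: "real \<Rightarrow> ennreal" and g g' :: "real \<Rightarrow> real"
  assumes [measurable]: "f \<in> borel_measurable borel"
    and D: "\<And>x. (g has_real_derivative g' x) (at x)" and cont: "continuous_on UNIV g'"
    and nonneg: "\<And>x. g' x \<ge> 0" and A: "(\<Union>n::nat. {g (- real n - 1)..g (real n + 1)}) = A"
  shows "(\<integral>\<^sup>+x. f x * indicator A x \<partial>lborel) = (\<integral>\<^sup>+x. f (g x) * g' x \<partial>lborel)"
proof -
  have mono: "g x \<le> g y" if "x \<le> y" for x y
    by (rule DERIV_nonneg_imp_nondecreasing[OF that]) (use D nonneg in blast)
  have [measurable]: "g' \<in> borel_measurable borel" using cont by (rule borel_measurable_continuous_onI)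
  have [measurable]: "g \<in> borel_measurable borel"
    by (intro borel_measurable_continuous_onI DERIV_continuous_on) (use D in auto)
  have [measurable]: "A \<in> sets borel" unfolding A[symmetric] by auto
  have U: "(\<Union>n::nat. {- real n - 1..real n + 1}) = UNIV"
  proof -
    have "x \<in> (\<Union>n::nat. {- real n - 1..real n + 1})" for x
    proof -
      obtain n :: nat where "\<bar>x\<bar> \<le> real n" using real_arch_simple by blast
      then have "x \<in> {- real n - 1..real n + 1}" by auto
      then show ?thesis by blast
    qed
    then show ?thesis by blast
  qed
  have "(\<integral>\<^sup>+x. f x * indicator A x \<partial>lborel) = emeasure (density lborel f) A"
    by (simp add: emeasure_density)
  also have "\<dots> = (SUP n. emeasure (density lborel f) {g (- real n - 1)..g (real n + 1)})"
    unfolding A[symmetric]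
    by (intro SUP_emeasure_incseq[symmetric]) (auto simp: incseq_def intro: order_trans[OF mono] order_trans[OF _ mono])
  also have "\<dots> = (SUP n. emeasure (density lborel (\<lambda>x. f (g x) * g' x)) {- real n - 1..real n + 1})"
  proof (intro SUP_cong refl)
    fix n :: nat
    show "emeasure (density lborel f) {g (- real n - 1)..g (real n + 1)} = emeasure (density lborel (\<lambda>x. f (g x) * g' x)) {- real n - 1..real n + 1}"
      using nn_integral_substitution_aux[of f "- real n - 1" "real n + 1" g g'] D nonneg continuous_on_subset[OF cont]
      by (simp add: emeasure_density)
  qed
  also have "\<dots> = emeasure (density lborel (\<lambda>x. f (g x) * g' x)) (\<Union>n::nat. {- real n - 1..real n + 1})"
    by (intro SUP_emeasure_incseq) (auto simp: incseq_def)
  also have "\<dots> = (\<integral>\<^sup>+x. f (g x) * g' x \<partial>lborel)"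
    unfolding U by (simp add: emeasure_density)
  finally show ?thesis .
qed

lemma exp_intervals_Union:
  assumes "b > 0" "c > 0"
  shows "(\<Union>n::nat. {b * exp (c * (- real n - 1))..b * exp (c * (real n + 1))}) = {0::real<..}"
proof (intro subset_antisym subsetI)
  fix x :: real assume "x \<in> {0<..}"
  then have x: "x > 0" by simp
  obtain n :: nat where n: "\<bar>ln (x / b) / c\<bar> \<le> real n" using real_arch_simple by blast
  then have "\<bar>ln (x / b)\<bar> \<le> c * real n" using assms by (simp add: field_simps)
  then have "c * (- real n - 1) \<le> ln (x / b)" "ln (x / b) \<le> c * (real n + 1)"
    using assms by (auto simp: algebra_simps abs_le_iff)
  then have "exp (c * (- real n - 1)) \<le> x / b" "x / b \<le> exp (c * (real n + 1))"
    using x assms by (metis divide_pos_pos exp_le_cancel_iff exp_ln)+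
  then have "x \<in> {b * exp (c * (- real n - 1))..b * exp (c * (real n + 1))}"
    using assms by (auto simp: field_simps)
  then show "x \<in> (\<Union>n::nat. {b * exp (c * (- real n - 1))..b * exp (c * (real n + 1))})" by blast
next
  fix x assume "x \<in> (\<Union>n::nat. {b * exp (c * (- real n - 1))..b * exp (c * (real n + 1))})"
  then obtain n :: nat where "b * exp (c * (- real n - 1)) \<le> x" by auto
  moreover have "0 < b * exp (c * (- real n - 1))" using assms by simp
  ultimately show "x \<in> {0<..}" by simp
qed

lemma nn_integral_exp_substitution:
  fixes f :: "real \<Rightarrow> ennreal"
  assumes "f \<in> borel_measurable borel" "b > 0" "c > 0"
  shows "(\<integral>\<^sup>+x. f x * indicator {0<..} x \<partial>lborel) = (\<integral>\<^sup>+u. f (b * exp (c * u)) * ennreal (b * c * exp (c * u)) \<partial>lborel)"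
  by (rule nn_integral_substitution_range[OF assms(1) _ _ _ exp_intervals_Union[OF assms(2,3)]])
     (use assms in \<open>auto intro!: derivative_eq_intros continuous_intros\<close>)

lemma borel_measurable_cosh_real[measurable]: "(cosh :: real \<Rightarrow> real) \<in> borel_measurable borel"
  by (intro borel_measurable_continuous_onI continuous_intros)

section \<open>Chi-squared densities and the squared length of a Gaussian vector\<close>

text \<open>The Gamma density of shape \<open>a\<close> and rate 1/2, that is chi-squared with 2a
  degrees of freedom. Halving the degrees makes the shapes add under convolution.\<close>

definition chi_density :: "real \<Rightarrow> real \<Rightarrow> real" where
  "chi_density a s = (if s > 0 then s powr (a - 1) * exp (- s / 2) / (2 powr a * Gamma a) else 0)"

lemma chi_density_measurable[measurable]: "chi_density a \<in> borel_measurable borel"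
  unfolding chi_density_def by measurable

lemma chi_density_nonneg: "a > 0 \<Longrightarrow> chi_density a s \<ge> 0"
  by (auto simp: chi_density_def intro!: divide_nonneg_nonneg less_imp_le[OF Gamma_real_pos])

text \<open>After the substitution s = u v the exponentials combine to exp (-u/2), and what remains
  is a Beta integral over v in (0, 1).\<close>

lemma chi_density_convolution:
  assumes ab: "a > 0" "b > 0"
  shows "(\<integral>\<^sup>+s. ennreal (chi_density a s) * ennreal (chi_density b (u - s)) \<partial>lborel) = ennreal (chi_density (a + b) u)"
proof (cases "u > 0")
  case False
  then have 0: "ennreal (chi_density a s) * ennreal (chi_density b (u - s)) = 0" for s
    by (auto simp: chi_density_def)
  have "chi_density (a + b) u = 0" using False by (simp add: chi_density_def)
  then show ?thesis by (simp only: 0) simp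
next
  case True
  define K where "K = u powr (a - 1) * u powr (b - 1) * exp (- u / 2) / (2 powr a * Gamma a * (2 powr b * Gamma b))"
  have K: "K \<ge> 0" using ab unfolding K_def
    by (intro divide_nonneg_nonneg mult_nonneg_nonneg less_imp_le[OF Gamma_real_pos]) auto
  have pw: "ennreal (chi_density a (u * v)) * ennreal (chi_density b (u - u * v)) =
     ennreal K * ennreal (indicator {0..1} v * (v powr (a - 1) * (1 - v) powr (b - 1)))" for v
  proof (cases "0 < v \<and> v < 1")
    case True
    then have "u * v > 0" "u * (1 - v) > 0" using \<open>u > 0\<close> by auto
    moreover have "u - u * v = u * (1 - v)" by (simp add: algebra_simps)
    ultimately have "chi_density a (u * v) * chi_density b (u - u * v) =
        (u * v) powr (a - 1) * exp (- (u * v) / 2) / (2 powr a * Gamma a) *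
        ((u * (1 - v)) powr (b - 1) * exp (- (u * (1 - v)) / 2) / (2 powr b * Gamma b))"
      by (simp add: chi_density_def)
    also have "exp (- u / 2) = exp (- (u * v) / 2) * exp (- (u * (1 - v)) / 2)"
      unfolding exp_add[symmetric] by (rule arg_cong[where f = exp]) (simp add: field_simps)
    then have "(u * v) powr (a - 1) * exp (- (u * v) / 2) / (2 powr a * Gamma a) *
        ((u * (1 - v)) powr (b - 1) * exp (- (u * (1 - v)) / 2) / (2 powr b * Gamma b)) =
       K * (v powr (a - 1) * (1 - v) powr (b - 1))"
      using True \<open>u > 0\<close> by (simp add: K_def powr_mult)
    finally show ?thesis using True K chi_density_nonneg ab
      by (simp flip: ennreal_mult)
  next
    case False
    then have "v \<le> 0 \<or> v \<ge> 1" by auto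
    then show ?thesis
    proof
      assume "v \<le> 0"
      then have "chi_density a (u * v) = 0" using \<open>u > 0\<close> by (auto simp: chi_density_def zero_less_mult_iff)
      then show ?thesis using \<open>v \<le> 0\<close> by (auto simp: indicator_def)
    next
      assume "v \<ge> 1"
      then have "u * 1 \<le> u * v" using \<open>u > 0\<close> by (intro mult_left_mono) auto
      then have "chi_density b (u - u * v) = 0" by (auto simp: chi_density_def)
      then show ?thesis using \<open>v \<ge> 1\<close> by (auto simp: indicator_def)
    qed
  qed
  have "(\<integral>\<^sup>+s. ennreal (chi_density a s) * ennreal (chi_density b (u - s)) \<partial>lborel) =
    ennreal u * (\<integral>\<^sup>+v. ennreal (chi_density a (u * v)) * ennreal (chi_density b (u - u * v)) \<partial>lborel)"
    using True by (subst nn_integral_real_affine[where c = u and t = 0]) auto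
  also have "\<dots> = ennreal u * (ennreal K * (\<integral>\<^sup>+v. ennreal (indicator {0..1} v * (v powr (a - 1) * (1 - v) powr (b - 1))) \<partial>lborel))"
    unfolding pw by (subst nn_integral_cmult) auto
  also have "(\<integral>\<^sup>+v. ennreal (indicator {0..1} v * (v powr (a - 1) * (1 - v) powr (b - 1))) \<partial>lborel) = ennreal (Beta a b)"
    using ab by (intro nn_integral_has_integral_lebesgue has_integral_Beta_real) auto
  also have "ennreal u * (ennreal K * ennreal (Beta a b)) = ennreal (u * (K * Beta a b))"
    using True K by (simp flip: ennreal_mult')
  also have "u * (K * Beta a b) = chi_density (a + b) u"
  proof -
    have "Gamma a > 0" "Gamma b > 0" "Gamma (a + b) > 0" using ab by auto
    moreover have "u * (u powr (a - 1) * u powr (b - 1)) = u powr (a + b - 1)"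
    proof -
      have "u * (u powr (a - 1) * u powr (b - 1)) = u powr 1 * (u powr (a - 1) * u powr (b - 1))" using True by simp
      also have "\<dots> = u powr (a + b - 1)" unfolding powr_add[symmetric] by (rule arg_cong[where f = "\<lambda>x. u powr x"]) simp
      finally show ?thesis .
    qed
    ultimately show ?thesis using True
      by (simp add: chi_density_def K_def Beta_def powr_add field_simps)
  qed
  finally show ?thesis .
qed

lemma chi_density_nn_integral_add:
  assumes ab: "a > 0" "b > 0" and [measurable]: "f \<in> borel_measurable borel"
  shows "(\<integral>\<^sup>+s. (\<integral>\<^sup>+t. f (s + t) * ennreal (chi_density b t) \<partial>lborel) * ennreal (chi_density a s) \<partial>lborel)
     = (\<integral>\<^sup>+u. f u * ennreal (chi_density (a + b) u) \<partial>lborel)"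
proof -
  have "(\<integral>\<^sup>+t. f (s + t) * ennreal (chi_density b t) \<partial>lborel) = (\<integral>\<^sup>+u. f u * ennreal (chi_density b (u - s)) \<partial>lborel)" for s
    by (subst nn_integral_real_affine[where c = 1 and t = "- s"]) (auto simp: algebra_simps)
  then have "(\<integral>\<^sup>+s. (\<integral>\<^sup>+t. f (s + t) * ennreal (chi_density b t) \<partial>lborel) * ennreal (chi_density a s) \<partial>lborel) =
     (\<integral>\<^sup>+s. (\<integral>\<^sup>+u. f u * ennreal (chi_density b (u - s)) * ennreal (chi_density a s) \<partial>lborel) \<partial>lborel)"
    by (simp add: nn_integral_multc)
  also have "\<dots> = (\<integral>\<^sup>+u. (\<integral>\<^sup>+s. f u * ennreal (chi_density b (u - s)) * ennreal (chi_density a s) \<partial>lborel) \<partial>lborel)"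
    by (subst lborel_pair.Fubini') auto
  also have "\<dots> = (\<integral>\<^sup>+u. f u * (\<integral>\<^sup>+s. ennreal (chi_density a s) * ennreal (chi_density b (u - s)) \<partial>lborel) \<partial>lborel)"
    by (simp add: mult.assoc nn_integral_cmult) (simp add: mult.commute)
  finally show ?thesis by (simp add: chi_density_convolution ab)
qed

text \<open>Fold the two half-lines, then parametrise by z = exp u on one side and by s = exp (2 u)
  on the other; the integrands agree pointwise.\<close>

lemma gauss_square_nn_integral:
  fixes f :: "real \<Rightarrow> ennreal"
  assumes [measurable]: "f \<in> borel_measurable borel"
  shows "(\<integral>\<^sup>+z. f (z\<^sup>2) \<partial>std_normal_distribution) = (\<integral>\<^sup>+s. f s * ennreal (chi_density (1/2) s) \<partial>lborel)"
proof -
  let ?F = "\<lambda>z. ennreal (std_normal_density z) * f (z\<^sup>2)"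
  have ae: "AE z::real in lborel. z \<noteq> 0" by (rule AE_lborel_singleton)
  have "(\<integral>\<^sup>+z. f (z\<^sup>2) \<partial>std_normal_distribution) = (\<integral>\<^sup>+z. ?F z \<partial>lborel)"
    by (subst nn_integral_density) auto
  also have "\<dots> = (\<integral>\<^sup>+z. ?F z * indicator {0<..} z + ?F z * indicator {..<0} z \<partial>lborel)"
    by (rule nn_integral_cong_AE) (use ae in eventually_elim, auto simp: indicator_def)
  also have "\<dots> = (\<integral>\<^sup>+z. ?F z * indicator {0<..} z \<partial>lborel) + (\<integral>\<^sup>+z. ?F z * indicator {..<0} z \<partial>lborel)"
    by (rule nn_integral_add) auto
  also have "(\<integral>\<^sup>+z. ?F z * indicator {..<0} z \<partial>lborel) = (\<integral>\<^sup>+z. ?F z * indicator {0<..} z \<partial>lborel)"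
    by (subst nn_integral_real_affine[where c = "-1" and t = 0])
       (auto intro!: nn_integral_cong simp: indicator_def std_normal_density_def)
  also have "(\<integral>\<^sup>+z. ?F z * indicator {0<..} z \<partial>lborel) = (\<integral>\<^sup>+u. ?F (1 * exp (1 * u)) * ennreal (1 * 1 * exp (1 * u)) \<partial>lborel)"
    by (rule nn_integral_exp_substitution) auto
  also have "\<dots> + \<dots> = (\<integral>\<^sup>+u. ?F (1 * exp (1 * u)) * ennreal (1 * 1 * exp (1 * u)) + ?F (1 * exp (1 * u)) * ennreal (1 * 1 * exp (1 * u)) \<partial>lborel)"
    by (rule nn_integral_add[symmetric]) auto
  also have "\<dots> = (\<integral>\<^sup>+u. f (1 * exp (2 * u)) * ennreal (chi_density (1/2) (1 * exp (2 * u))) * ennreal (1 * 2 * exp (2 * u)) \<partial>lborel)"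
  proof (rule nn_integral_cong)
    fix u :: real
    have e: "(exp u)\<^sup>2 = exp (2 * u)" by (simp add: exp_double)
    have "chi_density (1/2) (exp (2 * u)) * (2 * exp (2 * u)) = exp (2 * u) powr (- 1/2) * exp (- exp (2 * u) / 2) / (sqrt 2 * sqrt pi) * (2 * exp (2 * u))"
      by (simp add: chi_density_def powr_half_sqrt Gamma_one_half_real)
    also have "exp (2 * u) powr (- 1/2) = exp (- u)" by (simp add: powr_def)
    also have "exp (- u) * exp (- exp (2 * u) / 2) / (sqrt 2 * sqrt pi) * (2 * exp (2 * u)) = 
        (exp (- u) * exp (2 * u)) * (exp (- exp (2 * u) / 2) / (sqrt 2 * sqrt pi) * 2)" by simp
    also have "exp (- u) * exp (2 * u) = exp u" by (simp flip: exp_add)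
    also have "exp u * (exp (- exp (2 * u) / 2) / (sqrt 2 * sqrt pi) * 2) = std_normal_density (exp u) * exp u + std_normal_density (exp u) * exp u"
      by (simp add: std_normal_density_def real_sqrt_mult e mult_ac)
    finally have *: "ennreal (chi_density (1/2) (exp (2 * u))) * ennreal (2 * exp (2 * u)) =
       ennreal (std_normal_density (exp u)) * ennreal (exp u) + ennreal (std_normal_density (exp u)) * ennreal (exp u)"
      by (simp add: chi_density_nonneg flip: ennreal_mult ennreal_plus)
    have "?F (1 * exp (1 * u)) * ennreal (1 * 1 * exp (1 * u)) + ?F (1 * exp (1 * u)) * ennreal (1 * 1 * exp (1 * u)) =
      f (exp (2 * u)) * (ennreal (std_normal_density (exp u)) * ennreal (exp u) + ennreal (std_normal_density (exp u)) * ennreal (exp u))"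
      by (simp add: e distrib_left mult_ac)
    also have "\<dots> = f (1 * exp (2 * u)) * ennreal (chi_density (1/2) (1 * exp (2 * u))) * ennreal (1 * 2 * exp (2 * u))"
      unfolding *[symmetric] by (simp add: mult_ac)
    finally show "?F (1 * exp (1 * u)) * ennreal (1 * 1 * exp (1 * u)) + ?F (1 * exp (1 * u)) * ennreal (1 * 1 * exp (1 * u)) =
      f (1 * exp (2 * u)) * ennreal (chi_density (1/2) (1 * exp (2 * u))) * ennreal (1 * 2 * exp (2 * u))" .
  qed
  also have "\<dots> = (\<integral>\<^sup>+s. f s * ennreal (chi_density (1/2) s) * indicator {0<..} s \<partial>lborel)"
    by (rule nn_integral_exp_substitution[symmetric]) auto
  also have "\<dots> = (\<integral>\<^sup>+s. f s * ennreal (chi_density (1/2) s) \<partial>lborel)"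
    by (rule nn_integral_cong) (auto simp: indicator_def chi_density_def)
  finally show ?thesis .
qed

lemma gauss_vec_norm_nn_integral:
  fixes f :: "real \<Rightarrow> ennreal"
  assumes "finite I" "I \<noteq> {}" and "f \<in> borel_measurable borel"
  shows "(\<integral>\<^sup>+N. f (\<Sum>k\<in>I. (N k)\<^sup>2) \<partial>gauss_vec I) = (\<integral>\<^sup>+s. f s * ennreal (chi_density (real (card I) / 2) s) \<partial>lborel)"
  using assms
proof (induction I arbitrary: f rule: finite_ne_induct)
  interpret product_prob_space "\<lambda>_. std_normal_distribution" by (rule product_prob_spaceI) (rule prob_space_gauss)
  case (singleton k)
  note [measurable] = singleton(1)
  have "(\<integral>\<^sup>+N. f (\<Sum>k\<in>{k}. (N k)\<^sup>2) \<partial>gauss_vec {k}) = (\<integral>\<^sup>+z. f (z\<^sup>2) \<partial>std_normal_distribution)"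
    using product_nn_integral_singleton[of "\<lambda>z. f (z\<^sup>2)" k] by simp
  then show ?case by (simp add: gauss_square_nn_integral)
next
  case (insert k I)
  interpret product_prob_space "\<lambda>_. std_normal_distribution" by (rule product_prob_spaceI) (rule prob_space_gauss)
  note [measurable] = insert.prems
  have [measurable]: "(\<lambda>N. f (\<Sum>k\<in>insert k I. (N k)\<^sup>2)) \<in> borel_measurable (gauss_vec (insert k I))"
    by (intro measurable_compose[OF _ insert.prems] borel_measurable_sum borel_measurable_power measurable_gauss_vec) auto
  have sp: "(\<Sum>j\<in>insert k I. ((x(k := z)) j)\<^sup>2) = (\<Sum>j\<in>I. (x j)\<^sup>2) + z\<^sup>2" for x :: "'a \<Rightarrow> real" and z
  proof -
    have "(\<Sum>j\<in>I. ((x(k := z)) j)\<^sup>2) = (\<Sum>j\<in>I. (x j)\<^sup>2)"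
      using insert.hyps by (intro sum.cong) auto
    then show ?thesis using insert.hyps by (subst sum.insert) (auto simp del: fun_upd_apply simp: fun_upd_same)
  qed
  have "(\<integral>\<^sup>+N. f (\<Sum>k\<in>insert k I. (N k)\<^sup>2) \<partial>gauss_vec (insert k I)) =
     (\<integral>\<^sup>+x. (\<integral>\<^sup>+z. f ((\<Sum>j\<in>I. (x j)\<^sup>2) + z\<^sup>2) \<partial>std_normal_distribution) \<partial>gauss_vec I)"
    using insert.hyps by (subst product_nn_integral_insert) (auto simp only: sp, auto)
  also have "\<dots> = (\<integral>\<^sup>+x. (\<integral>\<^sup>+t. f ((\<Sum>j\<in>I. (x j)\<^sup>2) + t) * ennreal (chi_density (1/2) t) \<partial>lborel) \<partial>gauss_vec I)"
    by (intro nn_integral_cong gauss_square_nn_integral) auto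
  also have "\<dots> = (\<integral>\<^sup>+s. (\<integral>\<^sup>+t. f (s + t) * ennreal (chi_density (1/2) t) \<partial>lborel) * ennreal (chi_density (real (card I) / 2) s) \<partial>lborel)"
    by (rule insert.IH) auto
  also have "\<dots> = (\<integral>\<^sup>+s. f s * ennreal (chi_density (real (card I) / 2 + 1/2) s) \<partial>lborel)"
    using insert.hyps by (intro chi_density_nn_integral_add) (auto simp: card_gt_0_iff)
  also have "real (card I) / 2 + 1/2 = real (card (insert k I)) / 2"
    using insert.hyps by simp
  finally show ?case .
qed

section \<open>Mixing the normal scale, and the Bessel representation of the density\<close>

text \<open>The density of sqrt(S) Z for a standard normal Z and an independent S with density
  \<open>chi_density a\<close>. It takes extended values because it may be infinite at a point: for
  \<open>a = 1/2\<close> it is so at 0.\<close>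

definition mixture_density :: "real \<Rightarrow> real \<Rightarrow> ennreal" where
  "mixture_density a x = (\<integral>\<^sup>+s. ennreal (std_normal_density (x / sqrt s) / sqrt s) * ennreal (chi_density a s) \<partial>lborel)"

lemma mixture_density_measurable[measurable]: "mixture_density a \<in> borel_measurable borel"
  unfolding mixture_density_def by measurable

lemma mixture_nn_integral:
  fixes f :: "real \<Rightarrow> ennreal"
  assumes [measurable]: "f \<in> borel_measurable borel"
  shows "(\<integral>\<^sup>+s. (\<integral>\<^sup>+z. f (sqrt s * z) \<partial>std_normal_distribution) * ennreal (chi_density a s) \<partial>lborel)
    = (\<integral>\<^sup>+x. f x * mixture_density a x \<partial>lborel)"
proof -
  have "(\<integral>\<^sup>+z. f (sqrt s * z) \<partial>std_normal_distribution) * ennreal (chi_density a s) =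
     (\<integral>\<^sup>+x. f x * ennreal (std_normal_density (x / sqrt s) / sqrt s) * ennreal (chi_density a s) \<partial>lborel)" for s
  proof (cases "s > 0")
    case True
    have "(\<integral>\<^sup>+z. f (sqrt s * z) \<partial>std_normal_distribution) = (\<integral>\<^sup>+z. ennreal (std_normal_density z) * f (sqrt s * z) \<partial>lborel)"
      by (subst nn_integral_density) auto
    also have "\<dots> = ennreal (1 / sqrt s) * (\<integral>\<^sup>+x. ennreal (std_normal_density (x / sqrt s)) * f x \<partial>lborel)"
      using True by (subst nn_integral_real_affine[where c = "1 / sqrt s" and t = 0]) auto
    also have "\<dots> = (\<integral>\<^sup>+x. f x * ennreal (std_normal_density (x / sqrt s) / sqrt s) \<partial>lborel)"
      using True by (subst nn_integral_cmult[symmetric])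
        (auto intro!: nn_integral_cong simp: divide_inverse ennreal_mult mult_ac)
    finally show ?thesis by (simp add: nn_integral_multc)
  qed (simp add: chi_density_def)
  then have "(\<integral>\<^sup>+s. (\<integral>\<^sup>+z. f (sqrt s * z) \<partial>std_normal_distribution) * ennreal (chi_density a s) \<partial>lborel) =
    (\<integral>\<^sup>+s. \<integral>\<^sup>+x. f x * ennreal (std_normal_density (x / sqrt s) / sqrt s) * ennreal (chi_density a s) \<partial>lborel \<partial>lborel)"
    by simp
  also have "\<dots> = (\<integral>\<^sup>+x. \<integral>\<^sup>+s. f x * ennreal (std_normal_density (x / sqrt s) / sqrt s) * ennreal (chi_density a s) \<partial>lborel \<partial>lborel)"
    by (subst lborel_pair.Fubini') auto
  also have "\<dots> = (\<integral>\<^sup>+x. f x * mixture_density a x \<partial>lborel)"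
    unfolding mixture_density_def mult.assoc by (subst nn_integral_cmult) auto
  finally show ?thesis .
qed

text \<open>The substitution s = |x| exp u turns the exponent -x^2 / (2 s) - s / 2 into -|x| cosh u,
  and the powers of s contribute exp (\<nu> u) with \<nu> = a - 1/2. Folding u to -u then produces
  twice the cosh of the Bessel integral. Finiteness is assumed so that the Lebesgue integral
  defining \<open>bessel_K\<close> agrees with the nonnegative integral instead of being the default
  value 0.\<close>

lemma mixture_density_bessel:
  assumes a: "a > 0" and x: "x \<noteq> 0" and fin: "mixture_density a x \<noteq> \<infinity>"
  shows "mixture_density a x = ennreal (VG_density (2 * a) x)"
proof -
  define \<nu> where "\<nu> = a - 1/2"
  define b where "b = \<bar>x\<bar>"
  have b: "b > 0" using x by (simp add: b_def)
  define C where "C = b powr \<nu> / (sqrt (2 * pi) * (2 powr a * Gamma a))"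
  have C: "C > 0" using a b by (auto simp: C_def)
  let ?E = "\<lambda>u. exp (- b * cosh u) * exp (\<nu> * u)"
  have "mixture_density a x = (\<integral>\<^sup>+s. ennreal (std_normal_density (x / sqrt s) / sqrt s) * ennreal (chi_density a s) * indicator {0<..} s \<partial>lborel)"
    unfolding mixture_density_def by (intro nn_integral_cong) (auto simp: indicator_def chi_density_def)
  also have "\<dots> = (\<integral>\<^sup>+u. ennreal (std_normal_density (x / sqrt (b * exp (1 * u))) / sqrt (b * exp (1 * u))) *
      ennreal (chi_density a (b * exp (1 * u))) * ennreal (b * 1 * exp (1 * u)) \<partial>lborel)"
    using b by (intro nn_integral_exp_substitution) auto
  also have "\<dots> = (\<integral>\<^sup>+u. ennreal C * ennreal (?E u) \<partial>lborel)"
  proof (rule nn_integral_cong)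
    fix u :: real
    define s where "s = b * exp u"
    have s: "s > 0" using b by (simp add: s_def)
    have sq: "(x / sqrt s)\<^sup>2 = b * exp (- u)"
      using s b by (simp add: power_divide s_def exp_minus field_simps) (simp add: b_def power2_eq_square)
    have "std_normal_density (x / sqrt s) / sqrt s * (chi_density a s * s) =
       (exp (- (b * exp (- u)) / 2) * exp (- s / 2)) * (s powr (a - 1) * s / sqrt s) / (sqrt (2 * pi) * (2 powr a * Gamma a))"
      using s by (simp add: std_normal_density_def chi_density_def sq mult_ac)
    also have "exp (- (b * exp (- u)) / 2) * exp (- s / 2) = exp (- b * cosh u)"
      unfolding exp_add[symmetric] by (rule arg_cong[where f = exp]) (simp add: s_def cosh_def field_simps)
    also have "s powr (a - 1) * s / sqrt s = s powr \<nu>"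
    proof -
      have "s powr (a - 1) * s / sqrt s = s powr (a - 1) * s powr 1 / s powr (1/2)" using s by (simp add: powr_half_sqrt)
      also have "\<dots> = s powr \<nu>" unfolding powr_add[symmetric] powr_diff[symmetric] by (simp add: \<nu>_def)
      finally show ?thesis .
    qed
    also have "s powr \<nu> = b powr \<nu> * exp (\<nu> * u)" using b by (simp add: s_def powr_mult) (simp add: powr_def)
    finally have "std_normal_density (x / sqrt s) / sqrt s * (chi_density a s * s) = C * ?E u"
      by (simp add: C_def)
    moreover have "ennreal (std_normal_density (x / sqrt s) / sqrt s) * ennreal (chi_density a s) * ennreal s =
      ennreal (std_normal_density (x / sqrt s) / sqrt s * (chi_density a s * s))"
      using s chi_density_nonneg[OF a] by (simp flip: ennreal_mult add: mult.assoc)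
    ultimately show "ennreal (std_normal_density (x / sqrt (b * exp (1 * u))) / sqrt (b * exp (1 * u))) *
      ennreal (chi_density a (b * exp (1 * u))) * ennreal (b * 1 * exp (1 * u)) = ennreal C * ennreal (?E u)"
      using C by (simp add: s_def ennreal_mult)
  qed
  also have "\<dots> = ennreal C * (\<integral>\<^sup>+u. ennreal (?E u) \<partial>lborel)"
    by (rule nn_integral_cmult) auto
  also have "(\<integral>\<^sup>+u. ennreal (?E u) \<partial>lborel) = (\<integral>\<^sup>+u. ennreal (?E u) * indicator {0..} u + ennreal (?E u) * indicator {..<0} u \<partial>lborel)"
    by (intro nn_integral_cong) (auto simp: indicator_def)
  also have "\<dots> = (\<integral>\<^sup>+u. ennreal (?E u) * indicator {0..} u \<partial>lborel) + (\<integral>\<^sup>+u. ennreal (?E u) * indicator {..<0} u \<partial>lborel)"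
    by (rule nn_integral_add) auto
  also have "(\<integral>\<^sup>+u. ennreal (?E u) * indicator {..<0} u \<partial>lborel) = (\<integral>\<^sup>+u. ennreal (?E (- u)) * indicator {0<..} u \<partial>lborel)"
    by (subst nn_integral_real_affine[where c = "-1" and t = 0]) (auto intro!: nn_integral_cong simp: indicator_def)
  also have "\<dots> = (\<integral>\<^sup>+u. ennreal (?E (- u)) * indicator {0..} u \<partial>lborel)"
    by (intro nn_integral_cong_AE eventually_mono[OF AE_lborel_singleton[of 0]]) (auto simp: indicator_def)
  also have "(\<integral>\<^sup>+u. ennreal (?E u) * indicator {0..} u \<partial>lborel) + \<dots> =
      (\<integral>\<^sup>+u. ennreal (?E u) * indicator {0..} u + ennreal (?E (- u)) * indicator {0..} u \<partial>lborel)"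
    by (rule nn_integral_add[symmetric]) auto
  also have "\<dots> = (\<integral>\<^sup>+u. ennreal 2 * ennreal (indicator {0..} u *\<^sub>R (exp (- b * cosh u) * cosh (\<nu> * u))) \<partial>lborel)"
  proof (intro nn_integral_cong)
    fix u :: real
    have "?E u + ?E (- u) = 2 * (exp (- b * cosh u) * cosh (\<nu> * u))"
      by (simp add: cosh_field_def[of "\<nu> * u"] algebra_simps)
    moreover have "ennreal (?E u) + ennreal (?E (- u)) = ennreal (?E u + ?E (- u))" by (simp flip: ennreal_plus)
    moreover have "ennreal (2 * (exp (- b * cosh u) * cosh (\<nu> * u))) = ennreal 2 * ennreal (exp (- b * cosh u) * cosh (\<nu> * u))"
      by (rule ennreal_mult) (auto intro: mult_nonneg_nonneg cosh_real_nonneg)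
    ultimately have "ennreal (?E u) + ennreal (?E (- u)) = ennreal 2 * ennreal (exp (- b * cosh u) * cosh (\<nu> * u))"
      by simp
    then show "ennreal (?E u) * indicator {0..} u + ennreal (?E (- u)) * indicator {0..} u =
        ennreal 2 * ennreal (indicator {0..} u *\<^sub>R (exp (- b * cosh u) * cosh (\<nu> * u)))"
      by (cases "u \<ge> 0") auto
  qed
  also have "\<dots> = ennreal 2 * (\<integral>\<^sup>+u. ennreal (indicator {0..} u *\<^sub>R (exp (- b * cosh u) * cosh (\<nu> * u))) \<partial>lborel)"
    by (rule nn_integral_cmult) auto
  finally have eq: "mixture_density a x = ennreal C * (ennreal 2 * (\<integral>\<^sup>+u. ennreal (indicator {0..} u *\<^sub>R (exp (- b * cosh u) * cosh (\<nu> * u))) \<partial>lborel))" .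
  then have fin': "(\<integral>\<^sup>+u. ennreal (indicator {0..} u *\<^sub>R (exp (- b * cosh u) * cosh (\<nu> * u))) \<partial>lborel) \<noteq> \<infinity>"
    using fin C by (auto simp: ennreal_mult_eq_top_iff)
  have nn: "0 \<le> indicator {0..} u *\<^sub>R (exp (- b * cosh u) * cosh (\<nu> * u))" for u
    by (auto simp: indicator_def intro!: mult_nonneg_nonneg cosh_real_nonneg)
  have "integrable lborel (\<lambda>u. indicator {0..} u *\<^sub>R (exp (- b * cosh u) * cosh (\<nu> * u)))"
    by (rule integrableI_nonneg) (use nn fin' in \<open>auto simp: less_top\<close>)
  then have "(\<integral>\<^sup>+u. ennreal (indicator {0..} u *\<^sub>R (exp (- b * cosh u) * cosh (\<nu> * u))) \<partial>lborel) = ennreal (bessel_K \<nu> b)"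
    unfolding bessel_K_def set_lebesgue_integral_def using nn by (intro nn_integral_eq_integral) auto
  moreover have "bessel_K \<nu> b \<ge> 0"
    unfolding bessel_K_def set_lebesgue_integral_def using nn by (intro integral_nonneg_AE) auto
  ultimately have "mixture_density a x = ennreal (C * (2 * bessel_K \<nu> b))"
    unfolding eq using C by (simp add: ennreal_mult)
  also have "C * (2 * bessel_K \<nu> b) = VG_density (2 * a) x"
  proof -
    have "2 powr a = 2 powr \<nu> * sqrt 2" unfolding \<nu>_def by (simp add: powr_diff powr_half_sqrt)
    define q where "q = sqrt (2 :: real)"
    have q: "q * q = 2" "q > 0" by (simp_all add: q_def)
    have "C = b powr \<nu> / (q * sqrt pi * (2 powr \<nu> * q * Gamma a))"
      using \<open>2 powr a = 2 powr \<nu> * sqrt 2\<close> by (simp add: C_def real_sqrt_mult q_def)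
    then have "C * 2 = b powr \<nu> / 2 powr \<nu> / (sqrt pi * Gamma a) * (2 / (q * q))"
      by simp
    then have "C * 2 = (b / 2) powr \<nu> / (sqrt pi * Gamma a)"
      using b unfolding q by (simp add: powr_divide)
    moreover have "(2 * a - 1) / 2 = \<nu>" by (simp add: \<nu>_def field_simps)
    moreover have "C * (2 * bessel_K \<nu> b) = (C * 2) * bessel_K \<nu> b" by simp
    ultimately have "C * (2 * bessel_K \<nu> b) = (b / 2) powr ((2 * a - 1) / 2) / (sqrt pi * Gamma a) * bessel_K ((2 * a - 1) / 2) b"
      by (simp only:)
    then show ?thesis by (simp add: VG_density_def b_def[symmetric])
  qed
  finally show ?thesis .
qed

lemma VG_law_nn_integral:
  fixes f :: "real \<Rightarrow> ennreal"
  assumes r: "finite I" "I \<noteq> {}" and [measurable]: "f \<in> borel_measurable borel"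
  shows "(\<integral>\<^sup>+x. f x \<partial>VG_law (real (card I))) = (\<integral>\<^sup>+N. (\<integral>\<^sup>+z. f (sqrt (\<Sum>k\<in>I. (N k)\<^sup>2) * z) \<partial>std_normal_distribution) \<partial>gauss_vec I)"
proof -
  interpret N: prob_space std_normal_distribution by (rule prob_space_gauss)
  interpret G: prob_space "gauss_vec I" by (rule prob_space_gauss_vec)
  let ?a = "real (card I) / 2"
  have a: "?a > 0" using r by (auto simp: card_gt_0_iff)
  have mix: "(\<integral>\<^sup>+N. (\<integral>\<^sup>+z. g (sqrt (\<Sum>k\<in>I. (N k)\<^sup>2) * z) \<partial>std_normal_distribution) \<partial>gauss_vec I) = (\<integral>\<^sup>+x. g x * mixture_density ?a x \<partial>lborel)"
    if [measurable]: "g \<in> borel_measurable borel" for g :: "real \<Rightarrow> ennreal"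
    using gauss_vec_norm_nn_integral[OF r, of "\<lambda>s. \<integral>\<^sup>+z. g (sqrt s * z) \<partial>std_normal_distribution"] mixture_nn_integral[OF that]
    by simp
  \<comment> \<open>Total mass 1 forces the mixture density to be finite almost everywhere. This
    supplies the finiteness that the Bessel formula needs, with no estimate of the Bessel
    integrand.\<close>
  have "(\<integral>\<^sup>+x. mixture_density ?a x \<partial>lborel) = 1"
    using mix[of "\<lambda>_. 1"] by (simp add: N.emeasure_space_1[simplified] G.emeasure_space_1)
  then have "AE x in lborel. mixture_density ?a x \<noteq> \<infinity>"
    by (intro nn_integral_PInf_AE) auto
  then have ae: "AE x in lborel. mixture_density ?a x = ennreal (VG_density (real (card I)) x)"
    using AE_lborel_singleton[of 0]
  proof eventually_elim
    case (elim x)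
    then show ?case using mixture_density_bessel[OF a, of x] by simp
  qed
  have [measurable]: "VG_density (real (card I)) \<in> borel_measurable borel"
    unfolding VG_density_def bessel_K_def set_lebesgue_integral_def by measurable
  have "(\<integral>\<^sup>+x. f x \<partial>VG_law (real (card I))) = (\<integral>\<^sup>+x. ennreal (VG_density (real (card I)) x) * f x \<partial>lborel)"
    unfolding VG_law_def by (subst nn_integral_density) auto
  also have "\<dots> = (\<integral>\<^sup>+x. f x * mixture_density ?a x \<partial>lborel)"
    by (rule nn_integral_cong_AE) (use ae in eventually_elim, simp add: mult.commute)
  finally show ?thesis by (simp add: mix)
qed

text \<open>The identity for nonnegative functions, applied to indicators, shows that the VG law is
  the law of |N| z on the product space. For bounded signed \<open>h\<close> the formula is then
  Fubini.\<close>

lemma VG_eq_gauss_mixture: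
  fixes h :: "real \<Rightarrow> real"
  assumes r: "finite I" "I \<noteq> {}" and [measurable]: "h \<in> borel_measurable borel" and B: "\<And>x. \<bar>h x\<bar> \<le> B"
  shows "VG (real (card I)) h = (\<integral>N. (\<integral>z. h (sqrt (\<Sum>k\<in>I. (N k)\<^sup>2) * z) \<partial>std_normal_distribution) \<partial>gauss_vec I)"
proof -
  interpret N: prob_space std_normal_distribution by (rule prob_space_gauss)
  interpret G: prob_space "gauss_vec I" by (rule prob_space_gauss_vec)
  interpret P: pair_prob_space "gauss_vec I" std_normal_distribution ..
  let ?P = "gauss_vec I \<Otimes>\<^sub>M std_normal_distribution"
  have [measurable]: "(\<lambda>N. \<Sum>k\<in>I. (N k)\<^sup>2) \<in> borel_measurable (gauss_vec I)"
    by (intro borel_measurable_sum borel_measurable_power measurable_gauss_vec) auto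
  let ?T = "\<lambda>p. sqrt (\<Sum>k\<in>I. (fst p k)\<^sup>2) * snd p"
  have [measurable]: "?T \<in> borel_measurable ?P"
    by (intro borel_measurable_times measurable_compose[OF measurable_fst, of "\<lambda>N. sqrt (\<Sum>k\<in>I. (N k)\<^sup>2)"]) measurable
  have "VG_law (real (card I)) = distr ?P borel ?T"
  proof (rule measure_eqI)
    show "sets (VG_law (real (card I))) = sets (distr ?P borel ?T)" by (simp add: VG_law_def)
    fix A assume "A \<in> sets (VG_law (real (card I)))"
    then have A[measurable]: "A \<in> sets borel" by (simp add: VG_law_def)
    have "emeasure (VG_law (real (card I))) A = (\<integral>\<^sup>+x. indicator A x \<partial>VG_law (real (card I)))"
      by (simp add: VG_law_def)
    also have "\<dots> = (\<integral>\<^sup>+N. (\<integral>\<^sup>+z. indicator A (?T (N, z)) \<partial>std_normal_distribution) \<partial>gauss_vec I)"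
      by (subst VG_law_nn_integral[OF r]) auto
    also have "\<dots> = (\<integral>\<^sup>+p. indicator A (?T p) \<partial>?P)"
      by (subst N.nn_integral_fst) auto
    also have "\<dots> = (\<integral>\<^sup>+x. indicator A x \<partial>distr ?P borel ?T)"
      by (subst nn_integral_distr) auto
    also have "\<dots> = emeasure (distr ?P borel ?T) A" by simp
    finally show "emeasure (VG_law (real (card I))) A = emeasure (distr ?P borel ?T) A" .
  qed
  then have "VG (real (card I)) h = (\<integral>p. h (?T p) \<partial>?P)"
    unfolding VG_def by (simp add: integral_distr)
  also have "\<dots> = (\<integral>N. (\<integral>z. h (?T (N, z)) \<partial>std_normal_distribution) \<partial>gauss_vec I)"
    by (subst P.integral_fst'[symmetric]) (auto intro!: P.integrable_const_bound[where B = B] B)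
  finally show ?thesis by simp
qed

section \<open>Bilinear forms in independent samples\<close>

text \<open>A law on the line rather than a random variable, so that the same estimates apply to the
  sample of X and to that of Y on their own product spaces.\<close>

locale moment_law = prob_space \<mu> for \<mu> :: "real measure" +
  fixes m3 b3 m4 :: real
  assumes sets_law[simp, measurable_cong]: "sets \<mu> = sets borel"
    and law_int4: "integrable \<mu> (\<lambda>x. x ^ 4)"
    and law_moments: "(\<integral>x. x \<partial>\<mu>) = 0" "(\<integral>x. x\<^sup>2 \<partial>\<mu>) = 1" "(\<integral>x. x ^ 3 \<partial>\<mu>) = m3"
      "(\<integral>x. \<bar>x\<bar> ^ 3 \<partial>\<mu>) = b3" "(\<integral>x. x ^ 4 \<partial>\<mu>) = m4"
begin

abbreviation sample :: "'i set \<Rightarrow> ('i \<Rightarrow> real) measure" where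
  "sample I \<equiv> PiM I (\<lambda>_. \<mu>)"

lemma prob_space_sample: "prob_space (sample I)"
  by (intro prob_space_PiM prob_space_axioms)

lemma indep_sample: "I \<noteq> {} \<Longrightarrow> prob_space.indep_vars (sample I) (\<lambda>_. borel) (\<lambda>p \<omega>. \<omega> p) I"
proof -
  assume "I \<noteq> {}"
  interpret P: prob_space "sample I" by (rule prob_space_sample)
  have "P.indep_vars (\<lambda>_. \<mu>) (\<lambda>p \<omega>. \<omega> p) I"
    by (intro indep_vars_PiM_coordinates prob_space_axioms \<open>I \<noteq> {}\<close>)
  from P.indep_vars_compose2[OF this, of "\<lambda>_ x. x" "\<lambda>_. borel"] show ?thesis by auto
qed

lemma sample_component:
  assumes "p \<in> I" "u \<in> borel_measurable borel"
  shows "integrable \<mu> u \<Longrightarrow> integrable (sample I) (\<lambda>x. u (x p) :: real)"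
    "(\<integral>x. u (x p) \<partial>sample I) = integral\<^sup>L \<mu> u"
proof -
  have u: "u \<in> borel_measurable \<mu>" using assms(2) by (simp add: measurable_cong_sets[OF sets_law refl])
  note P = PiM_component_integral[of I "\<lambda>_. \<mu>" p u, OF prob_space_axioms assms(1) u]
  show "integrable \<mu> u \<Longrightarrow> integrable (sample I) (\<lambda>x. u (x p) :: real)" "(\<integral>x. u (x p) \<partial>sample I) = integral\<^sup>L \<mu> u"
    using P by auto
qed

lemma weighted_sum_sample:
  assumes "finite I" "I \<noteq> {}"
  shows "weighted_sum (sample I) I (\<lambda>p \<omega>. \<omega> p) m3 b3 m4"
proof -
  interpret P: prob_space "sample I" by (rule prob_space_sample)
  show ?thesis
  proof (intro weighted_sum.intro weighted_sum_axioms.intro prob_space_sample assms(1) indep_sample[OF assms(2)])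
    fix p assume p: "p \<in> I"
    show "integrable (sample I) (\<lambda>\<omega>. \<omega> p ^ 4)"
      using law_int4 by (intro sample_component(1)[OF p, where u = "\<lambda>x. x ^ 4"]) auto
    show "P.expectation (\<lambda>\<omega>. \<omega> p) = 0" using sample_component(2)[OF p, of "\<lambda>x. x"] law_moments by simp
    show "P.expectation (\<lambda>\<omega>. (\<omega> p)\<^sup>2) = 1" using sample_component(2)[OF p, of "\<lambda>x. x\<^sup>2"] law_moments by simp
    show "P.expectation (\<lambda>\<omega>. \<omega> p ^ 3) = m3" using sample_component(2)[OF p, of "\<lambda>x. x ^ 3"] law_moments by simp
    show "P.expectation (\<lambda>\<omega>. \<bar>\<omega> p\<bar> ^ 3) = b3" using sample_component(2)[OF p, of "\<lambda>x. \<bar>x\<bar> ^ 3"] law_moments by simp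
    show "P.expectation (\<lambda>\<omega>. \<omega> p ^ 4) = m4" using sample_component(2)[OF p, of "\<lambda>x. x ^ 4"] law_moments by simp
  qed
qed

lemma law_moment_facts: "1 \<le> b3" "1 \<le> m4"
proof -
  interpret w: weighted_sum "sample {()}" "{()}" "\<lambda>p \<omega>. \<omega> p" "\<lambda>_. 1" m3 b3 m4 by (rule weighted_sum_sample) auto
  show "1 \<le> b3" "1 \<le> m4" using w.moment_facts[of "()"] by auto
qed

definition lin :: "nat \<Rightarrow> 'k set \<Rightarrow> ('k \<Rightarrow> real) \<Rightarrow> (nat \<times> 'k \<Rightarrow> real) \<Rightarrow> real" where
  "lin m K a x = (\<Sum>k\<in>K. a k * ((\<Sum>i=1..m. x (i, k)) / sqrt (real m)))"

text \<open>The weights are normalised to have squared sum 1, and the scale \<open>s\<close> is kept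
  outside; it will be absorbed into the test function.\<close>

lemma weights:
  fixes K :: "'k set"
  assumes m: "m \<ge> 1" and K: "finite K" and s: "s > 0" "s\<^sup>2 = (\<Sum>k\<in>K. (a k)\<^sup>2)"
  defines "c \<equiv> \<lambda>(i::nat, k). a k / (s * sqrt (real m))"
  shows "(\<Sum>p\<in>{1..m} \<times> K. (c p)\<^sup>2) = 1"
    "(\<Sum>p\<in>{1..m} \<times> K. \<bar>c p\<bar> ^ 3) = (\<Sum>k\<in>K. \<bar>a k\<bar> ^ 3) / (s ^ 3 * sqrt (real m))"
    "(\<Sum>p\<in>{1..m} \<times> K. c p ^ 3) = (\<Sum>k\<in>K. a k ^ 3) / (s ^ 3 * sqrt (real m))"
    "(\<Sum>p\<in>{1..m} \<times> K. c p ^ 4) = (\<Sum>k\<in>K. a k ^ 4) / (s ^ 4 * real m)"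
    "s * (\<Sum>p\<in>{1..m} \<times> K. c p * x p) = lin m K a x"
proof -
  let ?q = "sqrt (real m)"
  have q: "?q > 0" "?q\<^sup>2 = real m" using m by auto
  have q3: "?q ^ 3 = real m * ?q" and q4: "?q ^ 4 = real m * real m"
    using q(2) by (simp_all add: eval_nat_numeral)
  have cart: "(\<Sum>p\<in>{1..m} \<times> K. F p) = (\<Sum>i=1..m. \<Sum>k\<in>K. F (i, k))" for F :: "nat \<times> 'k \<Rightarrow> real"
    by (simp add: sum.cartesian_product)
  have sum: "(\<Sum>p\<in>{1..m} \<times> K. g (c p)) = real m * (\<Sum>k\<in>K. g (a k / (s * ?q)))" for g :: "real \<Rightarrow> real"
    unfolding cart by (simp add: c_def)
  show "(\<Sum>p\<in>{1..m} \<times> K. (c p)\<^sup>2) = 1"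
    using sum[of "\<lambda>x. x ^ 2"] q s(1) m
    unfolding power_divide power_mult_distrib sum_divide_distrib[symmetric] s(2)[symmetric] by simp
  show "(\<Sum>p\<in>{1..m} \<times> K. \<bar>c p\<bar> ^ 3) = (\<Sum>k\<in>K. \<bar>a k\<bar> ^ 3) / (s ^ 3 * ?q)"
    using sum[of "\<lambda>x. \<bar>x\<bar> ^ 3"] q s m by (simp add: abs_mult power_divide power_mult_distrib sum_divide_distrib[symmetric] q3)
  show "(\<Sum>p\<in>{1..m} \<times> K. c p ^ 3) = (\<Sum>k\<in>K. a k ^ 3) / (s ^ 3 * ?q)"
    using sum[of "\<lambda>x. x ^ 3"] q s m by (simp add: power_divide power_mult_distrib sum_divide_distrib[symmetric] q3)
  show "(\<Sum>p\<in>{1..m} \<times> K. c p ^ 4) = (\<Sum>k\<in>K. a k ^ 4) / (s ^ 4 * real m)"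
    using sum[of "\<lambda>x. x ^ 4"] q s m by (simp add: power_divide power_mult_distrib sum_divide_distrib[symmetric] q4)
  have "(\<Sum>p\<in>{1..m} \<times> K. c p * x p) = (\<Sum>i=1..m. \<Sum>k\<in>K. a k / (s * ?q) * x (i, k))"
    unfolding cart by (simp add: c_def)
  also have "\<dots> = (\<Sum>k\<in>K. \<Sum>i=1..m. a k / (s * ?q) * x (i, k))" by (rule sum.swap)
  finally show "s * (\<Sum>p\<in>{1..m} \<times> K. c p * x p) = lin m K a x"
    using s q unfolding lin_def by (simp add: sum_distrib_left sum_divide_distrib)
qed

end

text \<open>Rescaling \<open>h\<close> by \<open>s\<close> multiplies its j-th derivative by s^j,
  while the fourth-order error carries A / s^4. The three quotients that result are bounded here by
  terms without negative powers of \<open>s\<close>, starting from A <= s^4. The quotient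
  \<open>Q\<close> plays this part for the first-order error and is kept because its square can be
  averaged.\<close>

lemma power_sum_bounds:
  fixes a :: "'k \<Rightarrow> real"
  assumes K: "finite K" and s: "s > 0" "s\<^sup>2 = (\<Sum>k\<in>K. (a k)\<^sup>2)"
  defines "A \<equiv> \<Sum>k\<in>K. a k ^ 4" and "Q \<equiv> (\<Sum>k\<in>K. \<bar>a k\<bar> ^ 3) / s\<^sup>2"
  shows "A / s\<^sup>2 \<le> sqrt A" "A / s ^ 3 \<le> (1 + sqrt A) / 2" "A / s ^ 4 \<le> 1" "Q\<^sup>2 \<le> A / s\<^sup>2" "Q / s \<le> 1" "Q \<ge> 0"
proof -
  have A0: "A \<ge> 0" by (auto simp: A_def intro!: sum_nonneg)
  have s4: "s ^ 4 = (s\<^sup>2)\<^sup>2" by simp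
  have "A = (\<Sum>k\<in>K. (a k)\<^sup>2 * (a k)\<^sup>2)" unfolding A_def by (intro sum.cong) (auto simp: eval_nat_numeral)
  also have "\<dots> \<le> (\<Sum>k\<in>K. (a k)\<^sup>2 * (\<Sum>k\<in>K. (a k)\<^sup>2))"
    using K by (intro sum_mono mult_left_mono) (auto intro: member_le_sum)
  also have "\<dots> = s ^ 4" unfolding s4 s(2) power2_eq_square[of "sum _ _"] sum_distrib_right ..
  finally have A4: "A \<le> s ^ 4" .
  then show r4: "A / s ^ 4 \<le> 1" using s(1) by simp
  have sq: "sqrt A \<le> s\<^sup>2" using A4 unfolding s4 by (intro real_le_lsqrt) auto
  have "A = sqrt A * sqrt A" using A0 by simp
  also have "\<dots> \<le> sqrt A * s\<^sup>2" using sq A0 by (intro mult_left_mono) auto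
  finally show r2: "A / s\<^sup>2 \<le> sqrt A" using s(1) by (simp add: divide_le_eq)
  define t where "t = A / s ^ 3"
  \<comment> \<open>\<open>A / s ^ 3\<close> is the geometric mean of the other two
    quotients.\<close>
  have "(A / s ^ 3)\<^sup>2 = (A / s\<^sup>2) * (A / s ^ 4)" using s(1) by (simp add: power_divide eval_nat_numeral)
  also have "\<dots> \<le> sqrt A * 1" using r2 r4 A0 s(1) by (intro mult_mono) auto
  finally have "t\<^sup>2 \<le> sqrt A" by (simp add: t_def)
  moreover have "2 * t \<le> 1 + t\<^sup>2"
    using zero_le_power2[of "t - 1"] unfolding power2_diff by simp
  ultimately show "A / s ^ 3 \<le> (1 + sqrt A) / 2" unfolding t_def[symmetric] by simp
  show Q0: "Q \<ge> 0" by (auto simp: Q_def intro!: divide_nonneg_nonneg sum_nonneg)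
  have "(\<Sum>k\<in>K. \<bar>a k\<bar> * (a k)\<^sup>2)\<^sup>2 \<le> (\<Sum>k\<in>K. \<bar>a k\<bar>\<^sup>2) * (\<Sum>k\<in>K. ((a k)\<^sup>2)\<^sup>2)"
    by (rule Cauchy_Schwarz_ineq_sum)
  also have "\<dots> = s\<^sup>2 * A" by (simp add: s(2) A_def flip: power_mult)
  also have "(\<Sum>k\<in>K. \<bar>a k\<bar> * (a k)\<^sup>2) = Q * s\<^sup>2"
    using s(1) by (simp add: Q_def) (intro sum.cong, auto simp: power3_eq_cube power2_eq_square)
  finally show QA: "Q\<^sup>2 \<le> A / s\<^sup>2" using s(1) by (simp add: field_simps power2_eq_square)
  have "(Q / s)\<^sup>2 \<le> A / s ^ 4" using QA s(1) by (simp add: power_divide field_simps eval_nat_numeral)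
  then have "(Q / s)\<^sup>2 \<le> 1\<^sup>2" using r4 by simp
  then show "Q / s \<le> 1" by (rule power2_le_imp_le) simp
qed

context moment_law
begin

text \<open>Stein's bounds involve the deviation of \<open>h\<close> from its Gaussian mean, the
  theorem that from the VG mean, which will be \<open>c0\<close>. Passing from one centre to the
  other costs a factor 2.\<close>

lemma centred_gauss_bound:
  fixes h :: "real \<Rightarrow> real"
  assumes [measurable]: "h \<in> borel_measurable borel" and H0: "\<And>x. \<bar>h x - c0\<bar> \<le> H0"
  shows "\<bar>h (s * y) - (\<integral>z. h (s * z) \<partial>std_normal_distribution)\<bar> \<le> 2 * H0"
proof -
  interpret N: prob_space std_normal_distribution by (rule prob_space_gauss)
  have "\<bar>h x\<bar> \<le> H0 + \<bar>c0\<bar>" for x using H0[of x] by linarith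
  then have i: "integrable std_normal_distribution (\<lambda>z. h (s * z))"
    by (intro N.integrable_const_bound[where B = "H0 + \<bar>c0\<bar>"]) auto
  have "\<bar>N.expectation (\<lambda>z. h (s * z) - c0)\<bar> \<le> N.expectation (\<lambda>z. \<bar>h (s * z) - c0\<bar>)" by (rule integral_abs_bound)
  also have "\<dots> \<le> N.expectation (\<lambda>z. H0)" using i H0 by (intro integral_mono) auto
  also have "\<dots> = H0" using N.prob_space by simp
  also have "N.expectation (\<lambda>z. h (s * z) - c0) = N.expectation (\<lambda>z. h (s * z)) - c0"
    using i N.prob_space by simp
  finally show ?thesis using H0[of "s * y"] by linarith
qed

text \<open>Apply \<open>clt_third_order\<close> to x |-> h(s x) with the normalised weights, and
  restore the vector form of the correction by \<open>gauss_vec_hermite_sum\<close>.\<close>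

lemma clt_vector_third_order:
  fixes h h1 h2 h3 :: "real \<Rightarrow> real"
  assumes m: "m \<ge> 1" and K: "finite K" "K \<noteq> {}"
    and D: "\<And>x. (h has_real_derivative h1 x) (at x)" "\<And>x. (h1 has_real_derivative h2 x) (at x)"
      "\<And>x. (h2 has_real_derivative h3 x) (at x)" and cont: "continuous_on UNIV h3"
    and H0: "\<And>x. \<bar>h x - c0\<bar> \<le> H0" and H1: "\<And>x. \<bar>h1 x\<bar> \<le> H1" and H2: "\<And>x. \<bar>h2 x\<bar> \<le> H2" and H3: "\<And>x. \<bar>h3 x\<bar> \<le> H3"
  shows "\<bar>(\<integral>x. h (lin m K a x) \<partial>sample ({1..m} \<times> K)) - (\<integral>N. h (\<Sum>k\<in>K. a k * N k) \<partial>gauss_vec K)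
      - m3 / (6 * sqrt (real m)) * (\<integral>N. h (\<Sum>k\<in>K. a k * N k) * (\<Sum>k\<in>K. N k ^ 3 - 3 * N k) \<partial>gauss_vec K)\<bar>
    \<le> m4 / real m * ((41 / 4 * H2 + 27 / 2 * H1) * sqrt (\<Sum>k\<in>K. a k ^ 4) + 27 / 2 * H1 + 231 * H0)"
proof -
  define A where "A = (\<Sum>k\<in>K. a k ^ 4)"
  have A0: "A \<ge> 0" by (auto simp: A_def intro!: sum_nonneg)
  have Hp: "H0 \<ge> 0" "H1 \<ge> 0" "H2 \<ge> 0" using H0[of 0] H1[of 0] H2[of 0] by auto
  have mp: "real m > 0" using m by simp
  have [measurable]: "h \<in> borel_measurable borel"
    by (intro borel_measurable_continuous_onI DERIV_continuous_on) (use D(1) in auto)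
  define s where "s = sqrt (\<Sum>k\<in>K. (a k)\<^sup>2)"
  have s2: "s\<^sup>2 = (\<Sum>k\<in>K. (a k)\<^sup>2)" by (simp add: s_def sum_nonneg)
  have G0: "(\<integral>N. h (\<Sum>k\<in>K. a k * N k) \<partial>gauss_vec K) = (\<integral>z. h (s * z) \<partial>std_normal_distribution)"
    unfolding s_def by (rule gauss_vec_linear_integral[OF K]) auto
  define B where "B = H0 + \<bar>c0\<bar> + H1 + H2 + \<bar>H3\<bar>"
  have b: "\<bar>h x\<bar> \<le> B" "\<bar>h1 x\<bar> \<le> B" "\<bar>h2 x\<bar> \<le> B" "\<bar>h3 x\<bar> \<le> B" for x
  proof -
    show "\<bar>h x\<bar> \<le> B" using H0[of x] Hp unfolding B_def by linarith
    show "\<bar>h1 x\<bar> \<le> B" using H1[of x] Hp unfolding B_def by linarith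
    show "\<bar>h2 x\<bar> \<le> B" using H2[of x] Hp unfolding B_def by linarith
    show "\<bar>h3 x\<bar> \<le> B" using H3[of x] Hp unfolding B_def by linarith
  qed
  note GH = gauss_vec_hermite_sum[OF K D cont b s_def]
  define T where "T = (\<integral>N. h (\<Sum>k\<in>K. a k * N k) * (\<Sum>k\<in>K. N k ^ 3 - 3 * N k) \<partial>gauss_vec K)"
  have s_cases: "s > 0 \<or> s = 0" using sum_nonneg[of K "\<lambda>k. (a k)\<^sup>2"] by (auto simp: s_def)
  then show ?thesis
  proof
    \<comment> \<open>All weights vanish: both expectations equal \<open>h 0\<close>, and the
      correction is \<open>h 0\<close> times the mean of the cubic weight, which is 0.\<close>
    assume s0: "s = 0"
    then have "(\<Sum>k\<in>K. (a k)\<^sup>2) = 0" using s2 by simp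
    then have a0: "a k = 0" if "k \<in> K" for k using that K by (simp add: sum_nonneg_eq_0_iff)
    interpret P: prob_space "sample ({1..m} \<times> K)" by (rule prob_space_sample)
    interpret G: prob_space "gauss_vec K" by (rule prob_space_gauss_vec)
    have "lin m K a x = 0" for x by (simp add: lin_def a0)
    moreover have "(\<Sum>k\<in>K. a k * N k) = 0" for N by (simp add: a0)
    moreover have "(\<integral>N. 1 * (\<Sum>k\<in>K. N k ^ 3 - 3 * N k) \<partial>gauss_vec K) = 0"
      using gauss_vec_hermite_radial[OF K(1), of "\<lambda>_. 1" 1] by simp
    ultimately show ?thesis
      using Hp A0 mp law_moment_facts(2) by (simp add: P.prob_space[simplified] G.prob_space A_def)
  next
    assume sp: "s > 0"
    let ?c = "\<lambda>(i::nat, k). a k / (s * sqrt (real m))"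
    interpret w: weighted_sum "sample ({1..m} \<times> K)" "{1..m} \<times> K" "\<lambda>p \<omega>. \<omega> p" ?c m3 b3 m4
      using m K by (intro weighted_sum_sample) auto
    note W = weights[OF m K(1) sp s2]
    let ?g = "\<lambda>x. h (s * x)"
    have Dg: "(?g has_real_derivative s * h1 (s * x)) (at x)" "((\<lambda>x. s * h1 (s * x)) has_real_derivative s\<^sup>2 * h2 (s * x)) (at x)" for x
    proof -
      have "(?g has_real_derivative h1 (s * x) * s) (at x)" by (rule DERIV_chain2[OF D(1) DERIV_cmult_Id])
      then show "(?g has_real_derivative s * h1 (s * x)) (at x)" by (simp only: mult.commute)
      have "((\<lambda>x. s * h1 (s * x)) has_real_derivative s * (h2 (s * x) * s)) (at x)"
        by (rule DERIV_cmult[OF DERIV_chain2[OF D(2) DERIV_cmult_Id]])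
      moreover have "s * (h2 (s * x) * s) = s\<^sup>2 * h2 (s * x)" by (simp add: power2_eq_square)
      ultimately show "((\<lambda>x. s * h1 (s * x)) has_real_derivative s\<^sup>2 * h2 (s * x)) (at x)" by (simp only:)
    qed
    have "\<bar>w.expectation (\<lambda>\<omega>. ?g (w.S \<omega>)) - integral\<^sup>L std_normal_distribution ?g
      - m3 / 6 * (\<Sum>i\<in>{1..m} \<times> K. ?c i ^ 3) * (\<integral>x. ?g x * (x ^ 3 - 3 * x) \<partial>std_normal_distribution)\<bar>
      \<le> m4 * (\<Sum>i\<in>{1..m} \<times> K. ?c i ^ 4) * (41 / 4 * (s\<^sup>2 * H2) + 27 * (s * H1) + 231 / 2 * (2 * H0))"
    proof (rule w.clt_third_order[OF W(1) Dg])
      show "\<bar>?g x - integral\<^sup>L std_normal_distribution ?g\<bar> \<le> 2 * H0" for x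
        by (rule centred_gauss_bound[OF _ H0]) auto
      show "\<bar>s * h1 (s * x)\<bar> \<le> s * H1" for x using H1 sp by (simp add: abs_mult)
      show "\<bar>s\<^sup>2 * h2 (s * x)\<bar> \<le> s\<^sup>2 * H2" for x using H2 sp by (simp add: abs_mult)
    qed
    also have "w.expectation (\<lambda>\<omega>. ?g (w.S \<omega>)) = (\<integral>x. h (lin m K a x) \<partial>sample ({1..m} \<times> K))"
      unfolding w.S_def W(5) ..
    also have "m3 / 6 * (\<Sum>i\<in>{1..m} \<times> K. ?c i ^ 3) * (\<integral>x. ?g x * (x ^ 3 - 3 * x) \<partial>std_normal_distribution) = m3 / (6 * sqrt (real m)) * T"
      unfolding W(3) T_def using GH sp mp by (simp add: field_simps)
    also have "m4 * (\<Sum>i\<in>{1..m} \<times> K. ?c i ^ 4) * (41 / 4 * (s\<^sup>2 * H2) + 27 * (s * H1) + 231 / 2 * (2 * H0)) =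
       m4 / real m * (41 / 4 * H2 * (A / s\<^sup>2) + 27 * H1 * (A / s ^ 3) + 231 * H0 * (A / s ^ 4))"
      unfolding W(4) A_def[symmetric] using sp mp by (simp add: field_simps eval_nat_numeral)
    also have "\<dots> \<le> m4 / real m * (41 / 4 * H2 * sqrt A + 27 * H1 * ((1 + sqrt A) / 2) + 231 * H0 * 1)"
      using power_sum_bounds[OF K(1) sp s2, folded A_def] Hp law_moment_facts(2) mp
      by (intro mult_left_mono add_mono) auto
    also have "\<dots> = m4 / real m * ((41 / 4 * H2 + 27 / 2 * H1) * sqrt A + 27 / 2 * H1 + 231 * H0)"
      by (simp add: algebra_simps)
    finally show ?thesis unfolding G0 T_def A_def .
  qed
qed

lemma clt_vector_first_order:
  fixes h h1 :: "real \<Rightarrow> real"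
  assumes m: "m \<ge> 1" and K: "finite K" "K \<noteq> {}"
    and D: "\<And>x. (h has_real_derivative h1 x) (at x)"
    and H0: "\<And>x. \<bar>h x - c0\<bar> \<le> H0" and H1: "\<And>x. \<bar>h1 x\<bar> \<le> H1"
  shows "\<bar>(\<integral>x. h (lin m K a x) \<partial>sample ({1..m} \<times> K)) - (\<integral>N. h (\<Sum>k\<in>K. a k * N k) \<partial>gauss_vec K)\<bar>
    \<le> b3 / sqrt (real m) * (9 / 2 * H1 * ((\<Sum>k\<in>K. \<bar>a k\<bar> ^ 3) / (\<Sum>k\<in>K. (a k)\<^sup>2)) + 18 * H0)"
proof -
  have Hp: "H0 \<ge> 0" "H1 \<ge> 0" using H0[of 0] H1[of 0] by auto
  have mp: "real m > 0" using m by simp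
  have [measurable]: "h \<in> borel_measurable borel"
    by (intro borel_measurable_continuous_onI DERIV_continuous_on) (use D(1) in auto)
  define s where "s = sqrt (\<Sum>k\<in>K. (a k)\<^sup>2)"
  have s2: "s\<^sup>2 = (\<Sum>k\<in>K. (a k)\<^sup>2)" by (simp add: s_def sum_nonneg)
  have G0: "(\<integral>N. h (\<Sum>k\<in>K. a k * N k) \<partial>gauss_vec K) = (\<integral>z. h (s * z) \<partial>std_normal_distribution)"
    unfolding s_def by (rule gauss_vec_linear_integral[OF K]) auto
  have "s > 0 \<or> s = 0" using sum_nonneg[of K "\<lambda>k. (a k)\<^sup>2"] by (auto simp: s_def)
  then show ?thesis
  proof
    \<comment> \<open>All weights vanish, both expectations equal \<open>h 0\<close>, and the
      quotient in the bound is 0 / 0 = 0.\<close>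
    assume s0: "s = 0"
    then have "(\<Sum>k\<in>K. (a k)\<^sup>2) = 0" using s2 by simp
    then have a0: "a k = 0" if "k \<in> K" for k using that K by (simp add: sum_nonneg_eq_0_iff)
    interpret P: prob_space "sample ({1..m} \<times> K)" by (rule prob_space_sample)
    interpret G: prob_space "gauss_vec K" by (rule prob_space_gauss_vec)
    have "lin m K a x = 0" for x by (simp add: lin_def a0)
    moreover have "(\<Sum>k\<in>K. a k * N k) = 0" for N by (simp add: a0)
    ultimately show ?thesis
      using Hp mp law_moment_facts(1) by (simp add: P.prob_space[simplified] G.prob_space a0)
  next
    assume sp: "s > 0"
    let ?c = "\<lambda>(i::nat, k). a k / (s * sqrt (real m))"
    interpret w: weighted_sum "sample ({1..m} \<times> K)" "{1..m} \<times> K" "\<lambda>p \<omega>. \<omega> p" ?c m3 b3 m4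
      using m K by (intro weighted_sum_sample) auto
    note W = weights[OF m K(1) sp s2]
    let ?g = "\<lambda>x. h (s * x)"
    define Q where "Q = (\<Sum>k\<in>K. \<bar>a k\<bar> ^ 3) / s\<^sup>2"
    have Dg: "(?g has_real_derivative s * h1 (s * x)) (at x)" for x
    proof -
      have "(?g has_real_derivative h1 (s * x) * s) (at x)" by (rule DERIV_chain2[OF D DERIV_cmult_Id])
      then show ?thesis by (simp only: mult.commute)
    qed
    have "\<bar>w.expectation (\<lambda>\<omega>. ?g (w.S \<omega>)) - integral\<^sup>L std_normal_distribution ?g\<bar>
      \<le> 9 / 2 * (s * H1 + 2 * (2 * H0)) * b3 * (\<Sum>i\<in>{1..m} \<times> K. \<bar>?c i\<bar> ^ 3)"
    proof (rule w.clt_first_order[OF W(1) Dg])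
      show "\<bar>?g x - integral\<^sup>L std_normal_distribution ?g\<bar> \<le> 2 * H0" for x
        by (rule centred_gauss_bound[OF _ H0]) auto
      show "\<bar>s * h1 (s * x)\<bar> \<le> s * H1" for x using H1 sp by (simp add: abs_mult)
    qed
    also have "w.expectation (\<lambda>\<omega>. ?g (w.S \<omega>)) = (\<integral>x. h (lin m K a x) \<partial>sample ({1..m} \<times> K))"
      unfolding w.S_def W(5) ..
    also have "9 / 2 * (s * H1 + 2 * (2 * H0)) * b3 * (\<Sum>i\<in>{1..m} \<times> K. \<bar>?c i\<bar> ^ 3) =
       b3 / sqrt (real m) * (9 / 2 * H1 * Q + 18 * H0 * (Q / s))"
      unfolding W(2) Q_def using sp mp by (simp add: field_simps eval_nat_numeral)
    also have "\<dots> \<le> b3 / sqrt (real m) * (9 / 2 * H1 * Q + 18 * H0 * 1)"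
      using power_sum_bounds[OF K(1) sp s2, folded Q_def] Hp law_moment_facts(1) mp
      by (intro mult_left_mono add_mono) auto
    finally show ?thesis unfolding G0 Q_def s2 by simp
  qed
qed

end

section \<open>Estimates to be averaged over random weights\<close>

lemma (in prob_space) integrable_pair_snd:
  fixes u :: "'b \<Rightarrow> real"
  assumes "prob_space N" "integrable N u"
  shows "integrable (M \<Otimes>\<^sub>M N) (\<lambda>p. u (snd p))"
proof -
  interpret N: prob_space N by fact
  interpret P: pair_prob_space M N ..
  have [measurable]: "u \<in> borel_measurable N" using assms(2) by auto
  have "distr (M \<Otimes>\<^sub>M N) N snd = N"
  proof (rule measure_eqI)
    fix A assume "A \<in> sets (distr (M \<Otimes>\<^sub>M N) N snd)"
    then have A: "A \<in> sets N" by simp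
    have "snd -` A \<inter> space (M \<Otimes>\<^sub>M N) = space M \<times> A"
      using sets.sets_into_space[OF A] by (auto simp: space_pair_measure)
    then show "emeasure (distr (M \<Otimes>\<^sub>M N) N snd) A = emeasure N A"
      using A by (simp add: emeasure_distr N.emeasure_pair_measure_Times emeasure_space_1)
  qed simp
  then have "integrable (distr (M \<Otimes>\<^sub>M N) N snd) u" using assms(2) by simp
  then show ?thesis by (subst (asm) integrable_distr_eq) auto
qed

lemma integral_diff_bound:
  fixes F G e :: "'a \<Rightarrow> real"
  assumes "integrable M F" "integrable M G" "integrable M e" "\<And>x. \<bar>F x - G x\<bar> \<le> e x"
  shows "\<bar>integral\<^sup>L M F - integral\<^sup>L M G\<bar> \<le> integral\<^sup>L M e"
proof -
  have "\<bar>integral\<^sup>L M (\<lambda>x. F x - G x)\<bar> \<le> integral\<^sup>L M (\<lambda>x. \<bar>F x - G x\<bar>)" by (rule integral_abs_bound)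
  also have "\<dots> \<le> integral\<^sup>L M e" using assms by (intro integral_mono) auto
  finally show ?thesis using assms by simp
qed

lemma gauss_vec_moments:
  assumes K: "finite K" "K \<noteq> {}"
  shows "integrable (gauss_vec K) (\<lambda>N. (\<Sum>k\<in>K. N k ^ 3 - 3 * N k)\<^sup>2)"
    "(\<integral>N. (\<Sum>k\<in>K. N k ^ 3 - 3 * N k)\<^sup>2 \<partial>gauss_vec K) = 6 * real (card K)"
    "integrable (gauss_vec K) (\<lambda>N. (\<Sum>k\<in>K. (N k)\<^sup>2 - 1)\<^sup>2)"
    "(\<integral>N. (\<Sum>k\<in>K. (N k)\<^sup>2 - 1)\<^sup>2 \<partial>gauss_vec K) = 2 * real (card K)"
    "integrable (gauss_vec K) (\<lambda>N. \<Sum>k\<in>K. N k ^ 4)"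
    "(\<integral>N. (\<Sum>k\<in>K. N k ^ 4) \<partial>gauss_vec K) = 3 * real (card K)"
    "integrable (gauss_vec K) (\<lambda>N. \<Sum>k\<in>K. N k ^ 3 - 3 * N k)"
proof -
  interpret G: prob_space "gauss_vec K" by (rule prob_space_gauss_vec)
  note C = PiM_component_integral[of K "\<lambda>_. std_normal_distribution", OF prob_space_gauss]
  note g = gauss_moments
  have i4: "integrable std_normal_distribution (\<lambda>x. x ^ 4)" by (rule integrable_std_normal_distribution_moment)
  have iv: "G.indep_vars (\<lambda>_. borel) (\<lambda>k N. u (N k)) K" if "u \<in> borel_measurable borel" for u :: "real \<Rightarrow> real"
  proof -
    have "G.indep_vars (\<lambda>_. std_normal_distribution) (\<lambda>k N. N k) K"
      by (intro indep_vars_PiM_coordinates prob_space_gauss K)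
    from G.indep_vars_compose2[OF this, of "\<lambda>_. u" "\<lambda>_. borel"] that show ?thesis by auto
  qed
  show "integrable (gauss_vec K) (\<lambda>N. (\<Sum>k\<in>K. N k ^ 3 - 3 * N k)\<^sup>2)"
    by (rule G.sum_square_expectation(1)[OF K(1) iv[of "\<lambda>x. x ^ 3 - 3 * x"]])
       (use C(1)[of _ "\<lambda>x. (x ^ 3 - 3 * x)\<^sup>2"] C(2)[of _ "\<lambda>x. x ^ 3 - 3 * x"] g in auto)
  have "(\<integral>N. (\<Sum>k\<in>K. N k ^ 3 - 3 * N k)\<^sup>2 \<partial>gauss_vec K) = (\<Sum>k\<in>K. \<integral>N. (N k ^ 3 - 3 * N k)\<^sup>2 \<partial>gauss_vec K)"
    by (rule G.sum_square_expectation(2)[OF K(1) iv[of "\<lambda>x. x ^ 3 - 3 * x"]])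
       (use C(1)[of _ "\<lambda>x. (x ^ 3 - 3 * x)\<^sup>2"] C(2)[of _ "\<lambda>x. x ^ 3 - 3 * x"] g in auto)
  then show "(\<integral>N. (\<Sum>k\<in>K. N k ^ 3 - 3 * N k)\<^sup>2 \<partial>gauss_vec K) = 6 * real (card K)"
    using C(2)[of _ "\<lambda>x. (x ^ 3 - 3 * x)\<^sup>2"] g by simp
  show "integrable (gauss_vec K) (\<lambda>N. (\<Sum>k\<in>K. (N k)\<^sup>2 - 1)\<^sup>2)"
    by (rule G.sum_square_expectation(1)[OF K(1) iv[of "\<lambda>x. x\<^sup>2 - 1"]])
       (use C(1)[of _ "\<lambda>x. (x\<^sup>2 - 1)\<^sup>2"] C(2)[of _ "\<lambda>x. x\<^sup>2 - 1"] g in auto)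
  have "(\<integral>N. (\<Sum>k\<in>K. (N k)\<^sup>2 - 1)\<^sup>2 \<partial>gauss_vec K) = (\<Sum>k\<in>K. \<integral>N. ((N k)\<^sup>2 - 1)\<^sup>2 \<partial>gauss_vec K)"
    by (rule G.sum_square_expectation(2)[OF K(1) iv[of "\<lambda>x. x\<^sup>2 - 1"]])
       (use C(1)[of _ "\<lambda>x. (x\<^sup>2 - 1)\<^sup>2"] C(2)[of _ "\<lambda>x. x\<^sup>2 - 1"] g in auto)
  then show "(\<integral>N. (\<Sum>k\<in>K. (N k)\<^sup>2 - 1)\<^sup>2 \<partial>gauss_vec K) = 2 * real (card K)"
    using C(2)[of _ "\<lambda>x. (x\<^sup>2 - 1)\<^sup>2"] g by simp
  have i: "integrable (gauss_vec K) (\<lambda>N. N k ^ 4)" if "k \<in> K" for k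
    using C(1)[of k "\<lambda>x. x ^ 4"] that i4 by simp
  then show "integrable (gauss_vec K) (\<lambda>N. \<Sum>k\<in>K. N k ^ 4)" by auto
  show "(\<integral>N. (\<Sum>k\<in>K. N k ^ 4) \<partial>gauss_vec K) = 3 * real (card K)"
    using i C(2)[of _ "\<lambda>x. x ^ 4"] g by simp
  show "integrable (gauss_vec K) (\<lambda>N. \<Sum>k\<in>K. N k ^ 3 - 3 * N k)"
    using C(1)[of _ "\<lambda>x. x ^ 3 - 3 * x"] g(8) by auto
qed

text \<open>This avoids a negative moment of the chi-squared law: for \<open>S < r / 2\<close> the quadratic term takes over.\<close>

lemma fourth_over_square_bound:
  fixes A S r :: real
  assumes "r > 0" "S \<ge> 0" "A \<ge> 0" "A \<le> S\<^sup>2"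
  shows "A / S \<le> 2 * A / r + 2 * (S - r)\<^sup>2 / r"
proof (cases "S \<ge> r / 2")
  case True
  then have "A / S \<le> A / (r / 2)" using assms by (intro divide_left_mono) auto
  also have "\<dots> = 2 * A / r + 0" by simp
  also have "\<dots> \<le> 2 * A / r + 2 * (S - r)\<^sup>2 / r" using assms by (intro add_left_mono) auto
  finally show ?thesis .
next
  case False
  have "A / S \<le> S"
    using assms by (cases "S = 0") (auto simp: divide_le_eq power2_eq_square)
  also have "S \<le> 2 * (r / 2)\<^sup>2 / r" using False assms by (simp add: power2_eq_square)
  also have "\<dots> \<le> 2 * (r - S)\<^sup>2 / r"
    using False assms by (intro divide_right_mono mult_left_mono power_mono) auto
  also have "\<dots> \<le> 2 * A / r + 2 * (S - r)\<^sup>2 / r" using assms by (simp add: power2_commute)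
  finally show ?thesis .
qed

text \<open>The weight sqrt r balances the two terms in the uses below, where x^2 has mean of order
  r and y^2 is of order 1: both terms then contribute order sqrt r.\<close>

lemma young_sqrt:
  fixes x y r :: real
  assumes "r > 0"
  shows "x * y \<le> x\<^sup>2 / (2 * sqrt r) + sqrt r * y\<^sup>2 / 2"
proof -
  let ?q = "sqrt r"
  have q: "?q > 0" using assms by simp
  have "0 \<le> (x - ?q * y)\<^sup>2 / (2 * ?q)" using q by simp
  also have "\<dots> = x\<^sup>2 / (2 * ?q) + ?q * y\<^sup>2 / 2 - x * y"
    using q by (simp add: power2_diff field_simps power2_eq_square)
  finally show ?thesis by simp
qed

text \<open>For a Gaussian vector the right-hand side has mean at most 6 + 4 = 10, whatever the
  dimension. This replaces the average of 1 / |a|^2, which diverges in low dimension.\<close>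

lemma cubic_over_square_bound:
  fixes a :: "'k \<Rightarrow> real"
  assumes K: "finite K" "K \<noteq> {}"
  defines "r \<equiv> real (card K)"
  shows "((\<Sum>k\<in>K. \<bar>a k\<bar> ^ 3) / (\<Sum>k\<in>K. (a k)\<^sup>2))\<^sup>2 \<le> 2 * (\<Sum>k\<in>K. a k ^ 4) / r + 2 * (\<Sum>k\<in>K. (a k)\<^sup>2 - 1)\<^sup>2 / r"
proof -
  have r: "r > 0" using K by (simp add: r_def card_gt_0_iff)
  define S where "S = (\<Sum>k\<in>K. (a k)\<^sup>2)"
  define A where "A = (\<Sum>k\<in>K. a k ^ 4)"
  have S0: "S \<ge> 0" and A0: "A \<ge> 0" by (auto simp: S_def A_def intro!: sum_nonneg)
  have Sr: "(\<Sum>k\<in>K. (a k)\<^sup>2 - 1) = S - r" by (simp add: S_def r_def sum_subtractf)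
  show ?thesis
  proof (cases "S = 0")
    case True
    then show ?thesis using r A0 unfolding S_def[symmetric] A_def[symmetric] by simp
  next
    case False
    then have s: "sqrt S > 0" "(sqrt S)\<^sup>2 = S" using S0 by auto
    have s2: "(sqrt S)\<^sup>2 = (\<Sum>k\<in>K. (a k)\<^sup>2)" using s(2) by (simp add: S_def)
    note b = power_sum_bounds[OF K(1) s(1) s2, folded A_def, unfolded s(2)]
    have "sqrt S ^ 4 = ((sqrt S)\<^sup>2)\<^sup>2" by (simp only: power_mult[symmetric]) simp
    then have "A / S\<^sup>2 \<le> 1" using b(3) unfolding s(2) by (simp only:)
    then have "A \<le> S\<^sup>2" using False S0 by simp
    then show ?thesis
      using b(4) fourth_over_square_bound[OF r S0 A0] unfolding Sr S_def[symmetric] A_def[symmetric] by linarith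
  qed
qed

text \<open>Named separately because these sums serve as weights in the first replacement and are
  the variables to be replaced in the second.\<close>

definition col_sum :: "nat \<Rightarrow> (nat \<times> 'k \<Rightarrow> real) \<Rightarrow> 'k \<Rightarrow> real" where
  "col_sum n y k = (\<Sum>j=1..n. y (j, k)) / sqrt (real n)"

context moment_law
begin

lemma lin_col_sum: "lin n K a y = (\<Sum>k\<in>K. a k * col_sum n y k)"
  by (simp add: lin_def col_sum_def)

lemma measurable_sample: "f \<in> borel_measurable (PiM I (\<lambda>_. borel)) \<Longrightarrow> f \<in> borel_measurable (sample I)"
  by (simp add: measurable_cong_sets[OF sets_PiM_cong[OF refl sets_law] refl])

lemma measurable_col_sum: "k \<in> K \<Longrightarrow> (\<lambda>y. col_sum n y k) \<in> borel_measurable (sample ({1..n} \<times> K))"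
  unfolding col_sum_def
  by (intro measurable_sample borel_measurable_divide borel_measurable_sum measurable_component_singleton) auto

text \<open>The fourth moment of a sum of n independent terms gives \<open>m4 / n + 3\<close>, and
  m4 >= 1 makes this at most \<open>4 * m4\<close>, uniformly in \<open>n\<close>.\<close>

lemma col_sum_fourth_moment:
  fixes K :: "'k set"
  assumes n: "n \<ge> 1" and K: "finite K" "k \<in> K"
  shows "integrable (sample ({1..n} \<times> K)) (\<lambda>y. col_sum n y k ^ 4)"
    "(\<integral>y. col_sum n y k ^ 4 \<partial>sample ({1..n} \<times> K)) \<le> 4 * m4"
proof -
  interpret w: weighted_sum "sample ({1..n} \<times> K)" "{1..n} \<times> K" "\<lambda>p \<omega>. \<omega> p" "\<lambda>_. 1" m3 b3 m4
    using n K by (intro weighted_sum_sample) auto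
  let ?I = "{1..n} \<times> {k}"
  have sub: "?I \<subseteq> {1..n} \<times> K" using K by auto
  have iv: "w.indep_vars (\<lambda>_. borel) (\<lambda>p \<omega>. \<omega> p) ?I" using w.indep_vars_subset[OF w.indep sub] .
  have fi: "finite ?I" by simp
  have sum: "(\<Sum>p\<in>?I. y p) = (\<Sum>j=1..n. y (j, k))" for y :: "nat \<times> 'k \<Rightarrow> real"
    using sum.cartesian_product[of "\<lambda>i j. y (i, j)" "{k}" "{1..n}"] by simp
  have i4: "integrable (sample ({1..n} \<times> K)) (\<lambda>y. (\<Sum>p\<in>?I. y p) ^ 4)"
    by (rule w.sum_fourth_expectation(1)[OF fi iv]) (use sub w.int4 w.mean in auto)
  have "w.expectation (\<lambda>y. (\<Sum>p\<in>?I. y p) ^ 4) \<le> (\<Sum>p\<in>?I. w.expectation (\<lambda>y. y p ^ 4)) + 3 * (\<Sum>p\<in>?I. w.expectation (\<lambda>y. (y p)\<^sup>2))\<^sup>2"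
    by (rule w.sum_fourth_expectation(2)[OF fi iv]) (use sub w.int4 w.mean in auto)
  also have "(\<Sum>p\<in>?I. w.expectation (\<lambda>y. y p ^ 4)) = (\<Sum>p\<in>?I. m4)"
    by (rule sum.cong) (use sub w.mom4 in auto)
  also have "(\<Sum>p\<in>?I. w.expectation (\<lambda>y. (y p)\<^sup>2)) = (\<Sum>p\<in>?I. 1)"
    by (rule sum.cong) (use sub w.var in auto)
  finally have E: "w.expectation (\<lambda>y. (\<Sum>p\<in>?I. y p) ^ 4) \<le> real n * m4 + 3 * (real n)\<^sup>2" by simp
  have sq: "sqrt (real n) ^ 4 = (real n)\<^sup>2" by (simp add: eval_nat_numeral)
  have eq: "(\<lambda>y. col_sum n y k ^ 4) = (\<lambda>y. (\<Sum>p\<in>?I. y p) ^ 4 / (real n)\<^sup>2)"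
    by (simp add: col_sum_def sum power_divide sq del: One_nat_def)
  show "integrable (sample ({1..n} \<times> K)) (\<lambda>y. col_sum n y k ^ 4)" unfolding eq using i4 by auto
  have "w.expectation (\<lambda>y. col_sum n y k ^ 4) = w.expectation (\<lambda>y. (\<Sum>p\<in>?I. y p) ^ 4) / (real n)\<^sup>2"
    unfolding eq by simp
  also have "\<dots> \<le> (real n * m4 + 3 * (real n)\<^sup>2) / (real n)\<^sup>2"
    using E by (intro divide_right_mono) auto
  also have "\<dots> \<le> 4 * m4"
  proof -
    have "real n * m4 \<le> (real n)\<^sup>2 * m4"
      using n law_moment_facts(2) by (intro mult_right_mono) (auto simp: power2_eq_square)
    moreover have "3 * (real n)\<^sup>2 * 1 \<le> 3 * (real n)\<^sup>2 * m4"
      using law_moment_facts(2) by (intro mult_left_mono) auto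
    ultimately have "real n * m4 + 3 * (real n)\<^sup>2 \<le> (real n)\<^sup>2 * m4 + 3 * (real n)\<^sup>2 * m4" by linarith
    also have "\<dots> = 4 * m4 * (real n)\<^sup>2" by simp
    finally show ?thesis using n by (simp add: divide_le_eq del: distrib_right_numeral)
  qed
  finally show "w.expectation (\<lambda>y. col_sum n y k ^ 4) \<le> 4 * m4" .
qed

end

section \<open>The two replacements and their cubic corrections\<close>

locale product_clt = X: moment_law \<mu>X m3X b3X m4X + Y: moment_law \<mu>Y m3Y b3Y m4Y
  for \<mu>X m3X b3X m4X \<mu>Y m3Y b3Y m4Y +
  fixes K :: "'k set" and m n :: nat and h h1 h2 h3 :: "real \<Rightarrow> real" and c0 H0 H1 H2 H3 :: real
  assumes m: "m \<ge> 1" and n: "n \<ge> 1" and K: "finite K" "K \<noteq> {}"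
    and D: "\<And>x. (h has_real_derivative h1 x) (at x)" "\<And>x. (h1 has_real_derivative h2 x) (at x)"
      "\<And>x. (h2 has_real_derivative h3 x) (at x)" and cont: "continuous_on UNIV h3"
    and H0: "\<And>x. \<bar>h x - c0\<bar> \<le> H0" and H1: "\<And>x. \<bar>h1 x\<bar> \<le> H1" and H2: "\<And>x. \<bar>h2 x\<bar> \<le> H2" and H3: "\<And>x. \<bar>h3 x\<bar> \<le> H3"
begin

abbreviation "PX \<equiv> X.sample ({1..m} \<times> K)"
abbreviation "PY \<equiv> Y.sample ({1..n} \<times> K)"
abbreviation "G \<equiv> gauss_vec K"
abbreviation "r \<equiv> real (card K)"

sublocale SX: prob_space PX by (rule X.prob_space_sample)
sublocale SY: prob_space PY by (rule Y.prob_space_sample)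
sublocale SG: prob_space G by (rule prob_space_gauss_vec)
sublocale YG: pair_prob_space PY G ..
sublocale GG: pair_prob_space G G ..
sublocale YX: pair_prob_space PY PX ..

definition "Z N = (\<Sum>k\<in>K. N k ^ 3 - 3 * N k :: real)"
text \<open>A bound for \<open>h\<close> itself, which serves integrability; the estimates are in
  terms of the centred bound \<open>H0\<close>.\<close>

definition "hb = H0 + \<bar>c0\<bar>"

lemma h_bound: "\<bar>h x\<bar> \<le> hb"
  using H0[of x] unfolding hb_def by linarith

lemma h_measurable[measurable]: "h \<in> borel_measurable borel"
  by (intro borel_measurable_continuous_onI DERIV_continuous_on) (use D(1) in auto)

lemma bounds_nonneg: "H0 \<ge> 0" "H1 \<ge> 0" "H2 \<ge> 0" "hb \<ge> 0" "r > 0"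
  using H0[of 0] H1[of 0] H2[of 0] K by (auto simp: hb_def card_gt_0_iff)

lemma col_sum_measurable[measurable]: "k \<in> K \<Longrightarrow> (\<lambda>y. col_sum n y k) \<in> borel_measurable PY"
  by (rule Y.measurable_col_sum)

lemma coord_measurable[measurable]: "k \<in> K \<Longrightarrow> (\<lambda>N. N k) \<in> borel_measurable G"
  by (intro measurable_gauss_vec) auto

lemma coordX_measurable[measurable]: "k \<in> K \<Longrightarrow> (\<lambda>x. \<Sum>i=1..m. x (i, k)) \<in> borel_measurable PX"
  by (intro X.measurable_sample borel_measurable_sum measurable_component_singleton) auto

lemma inner_YG_measurable[measurable]: "(\<lambda>p. \<Sum>k\<in>K. snd p k * col_sum n (fst p) k) \<in> borel_measurable (PY \<Otimes>\<^sub>M G)"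
  by (intro borel_measurable_sum borel_measurable_times measurable_compose[OF measurable_fst] measurable_compose[OF measurable_snd])
     (auto intro: col_sum_measurable coord_measurable simp del: One_nat_def)

lemma inner_GG_measurable[measurable]: "(\<lambda>p. \<Sum>k\<in>K. fst p k * snd p k) \<in> borel_measurable (G \<Otimes>\<^sub>M G)"
  by (intro borel_measurable_sum borel_measurable_times measurable_compose[OF measurable_fst] measurable_compose[OF measurable_snd])
     (auto intro: coord_measurable)

lemma inner_YX_measurable[measurable]: "(\<lambda>p. X.lin m K (col_sum n (fst p)) (snd p)) \<in> borel_measurable (PY \<Otimes>\<^sub>M PX)"
  unfolding X.lin_def
  by (intro borel_measurable_sum borel_measurable_times borel_measurable_divide measurable_compose[OF measurable_fst, of "\<lambda>y. col_sum n y _"]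
       measurable_compose[OF measurable_snd, of "\<lambda>x. \<Sum>i=1..m. x (i, _)"])
     (auto intro: col_sum_measurable coordX_measurable simp del: One_nat_def)

text \<open>The test function between the two replacements; \<open>hGG\<close> is its form after
  both.\<close>

definition "hYG y N = h (\<Sum>k\<in>K. N k * col_sum n y k)"
definition "hGG N N' = h (\<Sum>k\<in>K. N k * N' k)"

lemma hYG_measurable[measurable]: "(\<lambda>p. hYG (fst p) (snd p)) \<in> borel_measurable (PY \<Otimes>\<^sub>M G)"
  unfolding hYG_def by (rule measurable_compose[OF inner_YG_measurable h_measurable])

lemma hGG_measurable[measurable]: "(\<lambda>p. hGG (fst p) (snd p)) \<in> borel_measurable (G \<Otimes>\<^sub>M G)"
  unfolding hGG_def by (rule measurable_compose[OF inner_GG_measurable h_measurable])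

lemma hGG_commute: "hGG N N' = hGG N' N"
  unfolding hGG_def by (simp add: mult.commute)

lemma Z_integrable: "integrable G Z"
  unfolding Z_def by (rule gauss_vec_moments(7)[OF K])

lemma fubini_YG:
  shows "integrable PY (\<lambda>y. \<integral>N. hYG y N \<partial>G)" "integrable G (\<lambda>N. \<integral>y. hYG y N \<partial>PY)"
    "(\<integral>y. (\<integral>N. hYG y N \<partial>G) \<partial>PY) = (\<integral>N. (\<integral>y. hYG y N \<partial>PY) \<partial>G)"
    "integrable PY (\<lambda>y. \<integral>N. hYG y N * Z N \<partial>G)" "integrable G (\<lambda>N. (\<integral>y. hYG y N \<partial>PY) * Z N)"
    "(\<integral>y. (\<integral>N. hYG y N * Z N \<partial>G) \<partial>PY) = (\<integral>N. (\<integral>y. hYG y N \<partial>PY) * Z N \<partial>G)"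
proof -
  have i: "integrable (PY \<Otimes>\<^sub>M G) (\<lambda>(y, N). hYG y N)"
    unfolding case_prod_unfold
    by (rule YG.integrable_const_bound[where B = hb, OF _ hYG_measurable]) (auto simp: hYG_def h_bound)
  have "integrable (PY \<Otimes>\<^sub>M G) (\<lambda>p. Z (snd p))"
    using Z_integrable by (rule SY.integrable_pair_snd[OF prob_space_gauss_vec])
  then have iZ: "integrable (PY \<Otimes>\<^sub>M G) (\<lambda>(y, N). hYG y N * Z N)"
    unfolding case_prod_unfold
    by (rule integrable_mult_bounded[where B = hb, OF _ hYG_measurable]) (auto simp: hYG_def h_bound)
  show "integrable PY (\<lambda>y. \<integral>N. hYG y N \<partial>G)" using YG.integrable_fst[OF i] .
  show "integrable G (\<lambda>N. \<integral>y. hYG y N \<partial>PY)" using YG.integrable_snd[OF i] .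
  show "(\<integral>y. (\<integral>N. hYG y N \<partial>G) \<partial>PY) = (\<integral>N. (\<integral>y. hYG y N \<partial>PY) \<partial>G)"
    using YG.Fubini_integral[OF i] by simp
  show "integrable PY (\<lambda>y. \<integral>N. hYG y N * Z N \<partial>G)" using YG.integrable_fst[OF iZ] .
  show "integrable G (\<lambda>N. (\<integral>y. hYG y N \<partial>PY) * Z N)" using YG.integrable_snd[OF iZ] by simp
  show "(\<integral>y. (\<integral>N. hYG y N * Z N \<partial>G) \<partial>PY) = (\<integral>N. (\<integral>y. hYG y N \<partial>PY) * Z N \<partial>G)"
    using YG.Fubini_integral[OF iZ] by simp
qed

lemma fubini_GG:
  shows "integrable G (\<lambda>N. \<integral>N'. hGG N N' \<partial>G)" "integrable G (\<lambda>N. \<integral>N'. hGG N N' * Z N' \<partial>G)"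
    "integrable G (\<lambda>N. (\<integral>N'. hGG N N' \<partial>G) * Z N)"
    "(\<integral>N. (\<integral>N'. hGG N N' * Z N' \<partial>G) \<partial>G) = (\<integral>N. (\<integral>N'. hGG N N' \<partial>G) * Z N \<partial>G)"
proof -
  have i: "integrable (G \<Otimes>\<^sub>M G) (\<lambda>(y, N). hGG y N)"
    unfolding case_prod_unfold
    by (rule GG.integrable_const_bound[where B = hb]) (auto simp: hGG_def h_bound)
  have "integrable (G \<Otimes>\<^sub>M G) (\<lambda>p. Z (snd p))"
    using Z_integrable by (rule SG.integrable_pair_snd[OF prob_space_gauss_vec])
  then have iZ: "integrable (G \<Otimes>\<^sub>M G) (\<lambda>(y, N). hGG y N * Z N)"
    unfolding case_prod_unfold
    by (rule integrable_mult_bounded[where B = hb]) (auto simp: hGG_def h_bound)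
  show "integrable G (\<lambda>N. \<integral>N'. hGG N N' \<partial>G)" using GG.integrable_fst[OF i] .
  show "integrable G (\<lambda>N. \<integral>N'. hGG N N' * Z N' \<partial>G)" using GG.integrable_fst[OF iZ] .
  show "integrable G (\<lambda>N. (\<integral>N'. hGG N N' \<partial>G) * Z N)" using GG.integrable_snd[OF iZ] by (simp add: hGG_commute)
  show "(\<integral>N. (\<integral>N'. hGG N N' * Z N' \<partial>G) \<partial>G) = (\<integral>N. (\<integral>N'. hGG N N' \<partial>G) * Z N \<partial>G)"
    using GG.Fubini_integral[OF iZ] by (simp add: hGG_commute)
qed

lemma hGG_radial: "(\<integral>N'. hGG N N' \<partial>G) = (\<integral>z. h (sqrt (\<Sum>k\<in>K. (N k)\<^sup>2) * z) \<partial>std_normal_distribution)"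
  unfolding hGG_def by (rule gauss_vec_linear_integral[OF K]) auto

lemma VG_hGG: "VG r h = (\<integral>N. (\<integral>N'. hGG N N' \<partial>G) \<partial>G)"
  unfolding hGG_radial by (rule VG_eq_gauss_mixture[OF K _ h_bound]) auto

text \<open>The first-order Edgeworth correction vanishes: it is odd under sign changes of the Gaussian factors.\<close>

lemma hGG_Z_zero: "(\<integral>N. (\<integral>N'. hGG N N' \<partial>G) * Z N \<partial>G) = 0"
proof -
  interpret N: prob_space std_normal_distribution by (rule prob_space_gauss)
  let ?\<psi> = "\<lambda>s. \<integral>z. h (sqrt s * z) \<partial>std_normal_distribution"
  have "\<bar>?\<psi> s\<bar> \<le> hb" for s
  proof -
    have "\<bar>?\<psi> s\<bar> \<le> (\<integral>z. \<bar>h (sqrt s * z)\<bar> \<partial>std_normal_distribution)" by (rule integral_abs_bound)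
    also have "\<dots> \<le> (\<integral>z. hb \<partial>std_normal_distribution)"
      by (intro integral_mono N.integrable_const_bound[where B = hb]) (auto simp: h_bound bounds_nonneg)
    finally show ?thesis using N.prob_space by simp
  qed
  moreover have "?\<psi> \<in> borel_measurable borel" by measurable
  ultimately show ?thesis
    unfolding hGG_radial Z_def by (intro gauss_vec_hermite_radial K) auto
qed

abbreviation "cA \<equiv> 41 / 4 * H2 + 27 / 2 * H1"
abbreviation "cB \<equiv> 27 / 2 * H1 + 231 * H0"

text \<open>Linearises the square root, so that the error can be averaged from the mean of the sum
  of fourth powers alone.\<close>

lemma sqrt_le_young: "A \<ge> 0 \<Longrightarrow> sqrt A \<le> A / (2 * sqrt r) + sqrt r / 2"
  using young_sqrt[OF bounds_nonneg(5), of "sqrt A" 1] by simp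

lemma third_order_bound:
  fixes a :: "'k \<Rightarrow> real"
  assumes "mm > 0" "m4 \<ge> 0"
  shows "m4 / mm * (cA * sqrt (\<Sum>k\<in>K. a k ^ 4) + cB) \<le> m4 / mm * (cA * ((\<Sum>k\<in>K. a k ^ 4) / (2 * sqrt r) + sqrt r / 2) + cB)"
  using assms bounds_nonneg
  by (intro mult_left_mono add_mono sqrt_le_young) (auto intro!: sum_nonneg add_nonneg_nonneg mult_nonneg_nonneg)

text \<open>The expansion for fixed weights, averaged over the column sums. Their fourth powers have
  total mean at most 4 r m4Y, so after linearisation the square root costs 2 sqrt r m4Y + sqrt r /
  2, which is at most (5/2) sqrt r m4Y.\<close>

lemma stage_X:
  "\<bar>(\<integral>y. (\<integral>x. h (X.lin m K (col_sum n y) x) \<partial>PX) \<partial>PY) - (\<integral>y. (\<integral>N. hYG y N \<partial>G) \<partial>PY)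
     - m3X / (6 * sqrt (real m)) * (\<integral>y. (\<integral>N. hYG y N * Z N \<partial>G) \<partial>PY)\<bar>
   \<le> m4X / real m * (cA * (5 / 2 * sqrt r * m4Y) + cB)"
proof -
  have m4: "m4X \<ge> 1" "m4Y \<ge> 1" using X.law_moment_facts Y.law_moment_facts by auto
  have mp: "real m > 0" using m by simp
  let ?F = "\<lambda>y. \<integral>x. h (X.lin m K (col_sum n y) x) \<partial>PX"
  let ?G = "\<lambda>y. (\<integral>N. hYG y N \<partial>G) + m3X / (6 * sqrt (real m)) * (\<integral>N. hYG y N * Z N \<partial>G)"
  let ?A = "\<lambda>y. \<Sum>k\<in>K. col_sum n y k ^ 4"
  let ?e = "\<lambda>y. m4X / real m * (cA * (?A y / (2 * sqrt r) + sqrt r / 2) + cB)"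
  have "integrable (PY \<Otimes>\<^sub>M PX) (\<lambda>(y, x). h (X.lin m K (col_sum n y) x))"
    unfolding case_prod_unfold
    by (rule YX.integrable_const_bound[where B = hb, OF _ measurable_compose[OF inner_YX_measurable h_measurable]])
       (auto simp: h_bound)
  from YX.integrable_fst[OF this] have iF: "integrable PY ?F" .
  have iG: "integrable PY ?G" using fubini_YG by auto
  have iA: "integrable PY ?A" using Y.col_sum_fourth_moment(1)[OF n K(1)] by auto
  have ie: "integrable PY ?e" using iA by (auto simp del: One_nat_def)
  have le: "\<bar>?F y - ?G y\<bar> \<le> ?e y" for y
  proof -
    have "\<bar>?F y - (\<integral>N. hYG y N \<partial>G) - m3X / (6 * sqrt (real m)) * (\<integral>N. hYG y N * Z N \<partial>G)\<bar> \<le>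
      m4X / real m * ((41 / 4 * H2 + 27 / 2 * H1) * sqrt (?A y) + 27 / 2 * H1 + 231 * H0)"
      using X.clt_vector_third_order[OF m K D cont H0 H1 H2 H3, of "col_sum n y"]
      by (simp add: hYG_def Z_def mult.commute)
    then show ?thesis
      using third_order_bound[OF mp, of m4X "col_sum n y"] m4 by (simp add: add.assoc diff_diff_eq)
  qed
  have "\<bar>integral\<^sup>L PY ?F - integral\<^sup>L PY ?G\<bar> \<le> integral\<^sup>L PY ?e"
    by (rule integral_diff_bound[OF iF iG ie le])
  also have "integral\<^sup>L PY ?G = (\<integral>y. (\<integral>N. hYG y N \<partial>G) \<partial>PY) + m3X / (6 * sqrt (real m)) * (\<integral>y. (\<integral>N. hYG y N * Z N \<partial>G) \<partial>PY)"
    using fubini_YG by simp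
  also have "integral\<^sup>L PY ?e = m4X / real m * (cA * (integral\<^sup>L PY ?A / (2 * sqrt r) + sqrt r / 2) + cB)"
    using iA by (simp add: SY.prob_space del: One_nat_def)
  also have "\<dots> \<le> m4X / real m * (cA * (5 / 2 * sqrt r * m4Y) + cB)"
  proof (intro mult_left_mono add_mono order_refl)
    have "integral\<^sup>L PY ?A = (\<Sum>k\<in>K. \<integral>y. col_sum n y k ^ 4 \<partial>PY)"
      using Y.col_sum_fourth_moment(1)[OF n K(1)] by simp
    also have "\<dots> \<le> (\<Sum>k\<in>K. 4 * m4Y)"
      by (intro sum_mono Y.col_sum_fourth_moment(2)[OF n K(1)])
    finally have "integral\<^sup>L PY ?A / (2 * sqrt r) \<le> r * (4 * m4Y) / (2 * sqrt r)"
      using bounds_nonneg by (intro divide_right_mono) auto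
    also have "\<dots> = r / sqrt r * (2 * m4Y)" using bounds_nonneg by simp
    also have "r / sqrt r = sqrt r" using bounds_nonneg by (intro real_div_sqrt) auto
    finally have "integral\<^sup>L PY ?A / (2 * sqrt r) \<le> 2 * (sqrt r * m4Y)" by (simp add: mult_ac)
    moreover have "sqrt r * 1 \<le> sqrt r * m4Y" using m4 by (intro mult_left_mono) auto
    ultimately show "integral\<^sup>L PY ?A / (2 * sqrt r) + sqrt r / 2 \<le> 5 / 2 * sqrt r * m4Y" by simp
  qed (use m4 mp bounds_nonneg in auto)
  finally show ?thesis by (simp add: diff_diff_eq)
qed

text \<open>Here the weights are Gaussian and their fourth powers have total mean 3 r, hence the
  factor 3/2 + 1/2 = 2. The cubic correction carries its weight on the other Gaussian vector; by
  symmetry of \<open>hGG\<close> it equals the integral that \<open>hGG_Z_zero\<close> evaluates to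
  0.\<close>

lemma stage_Y:
  "\<bar>(\<integral>N. (\<integral>y. hYG y N \<partial>PY) \<partial>G) - VG r h\<bar> \<le> m4Y / real n * (cA * (2 * sqrt r) + cB)"
proof -
  have m4: "m4Y \<ge> 1" using Y.law_moment_facts by auto
  have np: "real n > 0" using n by simp
  let ?F = "\<lambda>N. \<integral>y. hYG y N \<partial>PY"
  let ?G = "\<lambda>N. (\<integral>N'. hGG N N' \<partial>G) + m3Y / (6 * sqrt (real n)) * (\<integral>N'. hGG N N' * Z N' \<partial>G)"
  let ?A = "\<lambda>N. \<Sum>k\<in>K. N k ^ 4"
  let ?e = "\<lambda>N. m4Y / real n * (cA * (?A N / (2 * sqrt r) + sqrt r / 2) + cB)"
  note gm = gauss_vec_moments[OF K]
  have iF: "integrable G ?F" by (rule fubini_YG)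
  have iG: "integrable G ?G" using fubini_GG by auto
  have ie: "integrable G ?e" using gm by auto
  have le: "\<bar>?F N - ?G N\<bar> \<le> ?e N" for N
  proof -
    have "\<bar>?F N - (\<integral>N'. hGG N N' \<partial>G) - m3Y / (6 * sqrt (real n)) * (\<integral>N'. hGG N N' * Z N' \<partial>G)\<bar> \<le>
      m4Y / real n * ((41 / 4 * H2 + 27 / 2 * H1) * sqrt (?A N) + 27 / 2 * H1 + 231 * H0)"
      using Y.clt_vector_third_order[OF n K D cont H0 H1 H2 H3, of N]
      by (simp add: hYG_def hGG_def Z_def Y.lin_col_sum)
    then show ?thesis
      using third_order_bound[OF np, of m4Y N] m4 by (simp add: add.assoc diff_diff_eq)
  qed
  have "\<bar>integral\<^sup>L G ?F - integral\<^sup>L G ?G\<bar> \<le> integral\<^sup>L G ?e"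
    by (rule integral_diff_bound[OF iF iG ie le])
  also have "integral\<^sup>L G ?G = VG r h"
    using fubini_GG hGG_Z_zero by (simp add: VG_hGG)
  also have "integral\<^sup>L G ?e = m4Y / real n * (cA * (3 * r / (2 * sqrt r) + sqrt r / 2) + cB)"
    using gm by (simp add: SG.prob_space)
  also have "3 * r / (2 * sqrt r) + sqrt r / 2 = 2 * sqrt r"
  proof -
    have "r / sqrt r = sqrt r" using bounds_nonneg by (intro real_div_sqrt) auto
    moreover have "3 * r / (2 * sqrt r) + sqrt r / 2 = 3 / 2 * (r / sqrt r) + sqrt r / 2" by simp
    ultimately show ?thesis by simp
  qed
  finally show ?thesis .
qed

text \<open>The correction left by \<open>stage_X\<close> already has a factor of order 1 / sqrt m,
  so it is enough to replace the column sums to first order, and the Gaussian value vanishes. The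
  weight is unbounded and is separated by \<open>young_sqrt\<close>: its second moment 6 r gives 3
  sqrt r, the squared quotient gives 5 sqrt r, and the constant 1 gives sqrt r / 2. Thus 36 = (9/2)
  (3 + 5) and 63 = 18 (3 + 1/2).\<close>

lemma stage_cross:
  "\<bar>\<integral>N. (\<integral>y. hYG y N \<partial>PY) * Z N \<partial>G\<bar> \<le> b3Y / sqrt (real n) * (sqrt r * (36 * H1 + 63 * H0))"
proof -
  have b3: "b3Y \<ge> 1" using Y.law_moment_facts by auto
  have np: "real n > 0" using n by simp
  have rp: "r > 0" "sqrt r > 0" using bounds_nonneg by auto
  note gm = gauss_vec_moments[OF K, folded Z_def]
  let ?F = "\<lambda>N. (\<integral>y. hYG y N \<partial>PY) * Z N"
  let ?G = "\<lambda>N. (\<integral>N'. hGG N N' \<partial>G) * Z N"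
  let ?A = "\<lambda>N. \<Sum>k\<in>K. N k ^ 4" and ?B = "\<lambda>N. (\<Sum>k\<in>K. (N k)\<^sup>2 - 1)\<^sup>2"
  let ?e1 = "\<lambda>N. (Z N)\<^sup>2 / (2 * sqrt r) + sqrt r * (2 * ?A N / r + 2 * ?B N / r) / 2"
  let ?e2 = "\<lambda>N. (Z N)\<^sup>2 / (2 * sqrt r) + sqrt r / 2"
  let ?e = "\<lambda>N. b3Y / sqrt (real n) * (9 / 2 * H1 * ?e1 N + 18 * H0 * ?e2 N)"
  have iF: "integrable G ?F" by (rule fubini_YG)
  have iG: "integrable G ?G" by (rule fubini_GG)
  have ie: "integrable G ?e" using gm by auto
  have le: "\<bar>?F N - ?G N\<bar> \<le> ?e N" for N
  proof -
    let ?Q = "(\<Sum>k\<in>K. \<bar>N k\<bar> ^ 3) / (\<Sum>k\<in>K. (N k)\<^sup>2)"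
    have d: "\<bar>(\<integral>y. hYG y N \<partial>PY) - (\<integral>N'. hGG N N' \<partial>G)\<bar> \<le> b3Y / sqrt (real n) * (9 / 2 * H1 * ?Q + 18 * H0)"
      using Y.clt_vector_first_order[OF n K D(1) H0 H1, of N]
      by (simp add: hYG_def hGG_def Y.lin_col_sum)
    have "\<bar>?F N - ?G N\<bar> = \<bar>(\<integral>y. hYG y N \<partial>PY) - (\<integral>N'. hGG N N' \<partial>G)\<bar> * \<bar>Z N\<bar>"
      by (simp add: abs_mult flip: left_diff_distrib)
    also have "\<dots> \<le> b3Y / sqrt (real n) * (9 / 2 * H1 * ?Q + 18 * H0) * \<bar>Z N\<bar>"
      by (intro mult_right_mono d) auto
    also have "\<dots> = b3Y / sqrt (real n) * (9 / 2 * H1 * (\<bar>Z N\<bar> * ?Q) + 18 * H0 * (\<bar>Z N\<bar> * 1))"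
      by (simp add: algebra_simps)
    also have "\<dots> \<le> ?e N"
    proof (intro mult_left_mono add_mono)
      have "\<bar>Z N\<bar> * ?Q \<le> (Z N)\<^sup>2 / (2 * sqrt r) + sqrt r * ?Q\<^sup>2 / 2"
        using young_sqrt[OF rp(1), of "\<bar>Z N\<bar>" ?Q] by simp
      also have "\<dots> \<le> ?e1 N"
        using cubic_over_square_bound[OF K, of N] rp by (intro add_mono divide_right_mono mult_left_mono) auto
      finally show "\<bar>Z N\<bar> * ?Q \<le> ?e1 N" .
      show "\<bar>Z N\<bar> * 1 \<le> ?e2 N"
        using young_sqrt[OF rp(1), of "\<bar>Z N\<bar>" 1] by simp
    qed (use bounds_nonneg b3 in auto)
    finally show ?thesis .
  qed
  have "\<bar>integral\<^sup>L G ?F - integral\<^sup>L G ?G\<bar> \<le> integral\<^sup>L G ?e"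
    by (rule integral_diff_bound[OF iF iG ie le])
  also have "integral\<^sup>L G ?G = 0" by (rule hGG_Z_zero)
  also have "integral\<^sup>L G ?e = b3Y / sqrt (real n) * (9 / 2 * H1 * (6 * r / (2 * sqrt r) + sqrt r * (2 * (3 * r) / r + 2 * (2 * r) / r) / 2)
      + 18 * H0 * (6 * r / (2 * sqrt r) + sqrt r / 2))"
    using gm by (simp add: SG.prob_space)
  also have "6 * r / (2 * sqrt r) = 3 * sqrt r"
  proof -
    have "r / sqrt r = sqrt r" using bounds_nonneg by (intro real_div_sqrt) auto
    moreover have "6 * r / (2 * sqrt r) = 3 * (r / sqrt r)" by simp
    ultimately show ?thesis by simp
  qed
  also have "sqrt r * (2 * (3 * r) / r + 2 * (2 * r) / r) / 2 = 5 * sqrt r" using rp by simp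
  also have "b3Y / sqrt (real n) * (9 / 2 * H1 * (3 * sqrt r + 5 * sqrt r) + 18 * H0 * (3 * sqrt r + sqrt r / 2)) =
     b3Y / sqrt (real n) * (sqrt r * (36 * H1 + 63 * H0))" by (simp add: algebra_simps)
  finally show ?thesis by simp
qed

text \<open>Both stages plus the correction; the Edgeworth factor 1/6 reduces 36 and 63 to 6 and
  21/2.\<close>

lemma product_clt:
  "\<bar>(\<integral>y. (\<integral>x. h (X.lin m K (col_sum n y) x) \<partial>PX) \<partial>PY) - VG r h\<bar>
   \<le> m4X / real m * (cA * (5 / 2 * sqrt r * m4Y) + cB) + m4Y / real n * (cA * (2 * sqrt r) + cB)
     + \<bar>m3X\<bar> * b3Y / sqrt (real m * real n) * (sqrt r * (6 * H1 + 21 / 2 * H0))"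
proof -
  have "\<bar>m3X / (6 * sqrt (real m)) * (\<integral>N. (\<integral>y. hYG y N \<partial>PY) * Z N \<partial>G)\<bar> \<le>
      \<bar>m3X\<bar> / (6 * sqrt (real m)) * (b3Y / sqrt (real n) * (sqrt r * (36 * H1 + 63 * H0)))"
    unfolding abs_mult using stage_cross by (intro mult_mono) auto
  also have "\<dots> = \<bar>m3X\<bar> * b3Y / sqrt (real m * real n) * (sqrt r * (6 * H1 + 21 / 2 * H0))"
  proof -
    define t where "t = 6 * H1 + 21 / 2 * H0"
    have "36 * H1 + 63 * H0 = 6 * t" by (simp add: t_def)
    then show ?thesis unfolding t_def[symmetric] real_sqrt_mult by simp
  qed
  finally show ?thesis
    using stage_X stage_Y unfolding fubini_YG(3,6) by linarith
qed

end

section \<open>Reduction to the product of the two sample laws\<close>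

text \<open>Joint independence of the disjoint union is used twice: between the two blocks, to split
  the law into a product, and inside each block, to make each factor a product of marginals.\<close>

lemma (in prob_space) distr_two_families:
  fixes F :: "'i \<Rightarrow> 'a \<Rightarrow> real" and H :: "'i \<Rightarrow> 'a \<Rightarrow> real"
  assumes indep: "indep_vars (\<lambda>_. borel) (case_sum F H) (I <+> J)" and ne: "I \<noteq> {}" "J \<noteq> {}"
    and F: "\<And>i. i \<in> I \<Longrightarrow> distr M borel (F i) = \<mu>" and H: "\<And>j. j \<in> J \<Longrightarrow> distr M borel (H j) = \<nu>"
  shows "distr M (PiM I (\<lambda>_. borel) \<Otimes>\<^sub>M PiM J (\<lambda>_. borel)) (\<lambda>\<omega>. (\<lambda>i\<in>I. F i \<omega>, \<lambda>j\<in>J. H j \<omega>)) = PiM I (\<lambda>_. \<mu>) \<Otimes>\<^sub>M PiM J (\<lambda>_. \<nu>)"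
proof -
  let ?X = "case_sum F H"
  have sub: "Inl ` I \<subseteq> I <+> J" "Inr ` J \<subseteq> I <+> J" "Inl ` I \<inter> Inr ` J = {}" by auto
  have rvF: "random_variable borel (F i)" if "i \<in> I" for i
    using indep that unfolding indep_vars_def by (auto dest!: bspec[where x = "Inl i"])
  have rvH: "random_variable borel (H j)" if "j \<in> J" for j
    using indep that unfolding indep_vars_def by (auto dest!: bspec[where x = "Inr j"])
  have "indep_var (PiM I (\<lambda>_. borel)) ((\<lambda>f. \<lambda>i\<in>I. f (Inl i)) \<circ> (\<lambda>\<omega>. restrict (\<lambda>p. ?X p \<omega>) (Inl ` I)))
     (PiM J (\<lambda>_. borel)) ((\<lambda>f. \<lambda>j\<in>J. f (Inr j)) \<circ> (\<lambda>\<omega>. restrict (\<lambda>p. ?X p \<omega>) (Inr ` J)))"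
    by (intro indep_var_compose[OF indep_var_restrict[OF indep sub(3,1,2)]] measurable_restrict measurable_component_singleton) auto
  also have "(\<lambda>f. \<lambda>i\<in>I. f (Inl i)) \<circ> (\<lambda>\<omega>. restrict (\<lambda>p. ?X p \<omega>) (Inl ` I)) = (\<lambda>\<omega>. \<lambda>i\<in>I. F i \<omega>)"
    by (auto simp: fun_eq_iff)
  also have "(\<lambda>f. \<lambda>j\<in>J. f (Inr j)) \<circ> (\<lambda>\<omega>. restrict (\<lambda>p. ?X p \<omega>) (Inr ` J)) = (\<lambda>\<omega>. \<lambda>j\<in>J. H j \<omega>)"
    by (auto simp: fun_eq_iff)
  finally have joint: "distr M (PiM I (\<lambda>_. borel)) (\<lambda>\<omega>. \<lambda>i\<in>I. F i \<omega>) \<Otimes>\<^sub>M distr M (PiM J (\<lambda>_. borel)) (\<lambda>\<omega>. \<lambda>j\<in>J. H j \<omega>)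
      = distr M (PiM I (\<lambda>_. borel) \<Otimes>\<^sub>M PiM J (\<lambda>_. borel)) (\<lambda>\<omega>. (\<lambda>i\<in>I. F i \<omega>, \<lambda>j\<in>J. H j \<omega>))"
    unfolding indep_var_distribution_eq by blast
  \<comment> \<open>Reindexing along an injection: each index of \<open>L\<close> is assigned a
    one-element block of the full family, and \<open>\<lambda>f. f (e i)\<close> reads off its
    entry.\<close>
  have single: "indep_vars (\<lambda>_. borel) (\<lambda>i \<omega>. ?X (e i) \<omega>) L" if e: "inj_on e L" "e ` L \<subseteq> I <+> J" for e :: "'l \<Rightarrow> 'i + 'i" and L
  proof -
    have "indep_vars (\<lambda>i. PiM {e i} (\<lambda>_. borel)) (\<lambda>i \<omega>. restrict (\<lambda>p. ?X p \<omega>) {e i}) L"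
      using e by (intro indep_vars_restrict[OF indep]) (auto simp: disjoint_family_on_def inj_on_def)
    from indep_vars_compose2[OF this, of "\<lambda>i f. f (e i)" "\<lambda>_. borel"] show ?thesis by simp
  qed
  have "indep_vars (\<lambda>_. borel) F I" using single[of Inl I] by auto
  then have "distr M (PiM I (\<lambda>_. borel)) (\<lambda>\<omega>. \<lambda>i\<in>I. F i \<omega>) = PiM I (\<lambda>i. distr M borel (F i))"
    using ne rvF by (subst (asm) indep_vars_iff_distr_eq_PiM') auto
  also have "\<dots> = PiM I (\<lambda>_. \<mu>)" using F by (intro PiM_cong) auto
  finally have 1: "distr M (PiM I (\<lambda>_. borel)) (\<lambda>\<omega>. \<lambda>i\<in>I. F i \<omega>) = PiM I (\<lambda>_. \<mu>)" .
  have "indep_vars (\<lambda>_. borel) H J" using single[of Inr J] by auto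
  then have "distr M (PiM J (\<lambda>_. borel)) (\<lambda>\<omega>. \<lambda>j\<in>J. H j \<omega>) = PiM J (\<lambda>j. distr M borel (H j))"
    using ne rvH by (subst (asm) indep_vars_iff_distr_eq_PiM') auto
  also have "\<dots> = PiM J (\<lambda>_. \<nu>)" using H by (intro PiM_cong) auto
  finally show ?thesis using joint 1 by simp
qed

lemma moment_law_distr:
  assumes A: "prob_space A" and [measurable]: "X \<in> borel_measurable A" and i6: "integrable A (\<lambda>\<omega>. X \<omega> ^ 6)"
    and mean: "prob_space.expectation A X = 0" and var: "prob_space.variance A X = 1"
  shows "moment_law (distr A borel X) (moment A X 3) (abs_moment A X 3) (moment A X 4)"
proof -
  interpret A: prob_space A by fact
  interpret L: prob_space "distr A borel X" by (rule A.prob_space_distr) fact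
  have le: "\<bar>x ^ 4\<bar> \<le> 1 + x ^ 6" for x :: real
  proof -
    have "\<bar>x\<bar> ^ 4 \<le> 1" if "\<bar>x\<bar> \<le> 1" using that by (intro power_le_one) auto
    moreover have "\<bar>x\<bar> ^ 4 \<le> \<bar>x\<bar> ^ 6" if "\<not> \<bar>x\<bar> \<le> 1" using that by (intro power_increasing) auto
    moreover have "0 \<le> \<bar>x\<bar> ^ 6" by simp
    ultimately have "\<bar>x\<bar> ^ 4 \<le> 1 + \<bar>x\<bar> ^ 6" by linarith
    then show ?thesis by (simp add: power_even_abs)
  qed
  have i4: "integrable A (\<lambda>\<omega>. X \<omega> ^ 4)"
    by (rule Bochner_Integration.integrable_bound[where f = "\<lambda>\<omega>. 1 + X \<omega> ^ 6"])
       (use i6 le in \<open>auto intro!: always_eventually order_trans[OF le abs_ge_self]\<close>)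
  have e2: "A.expectation (\<lambda>\<omega>. (X \<omega>)\<^sup>2) = 1" using var mean by simp
  show ?thesis
  proof (intro moment_law.intro moment_law_axioms.intro L.prob_space_axioms)
    show "integrable (distr A borel X) (\<lambda>x. x ^ 4)" by (subst integrable_distr_eq) (auto intro: i4)
    show "(\<integral>x. x \<partial>distr A borel X) = 0" by (subst integral_distr) (auto simp: mean)
    show "(\<integral>x. x\<^sup>2 \<partial>distr A borel X) = 1" by (subst integral_distr) (auto simp: e2)
    show "(\<integral>x. x ^ 3 \<partial>distr A borel X) = moment A X 3" by (subst integral_distr) (auto simp: moment_def)
    show "(\<integral>x. \<bar>x\<bar> ^ 3 \<partial>distr A borel X) = abs_moment A X 3" by (subst integral_distr) (auto simp: abs_moment_def power_abs)
    show "(\<integral>x. x ^ 4 \<partial>distr A borel X) = moment A X 4" by (subst integral_distr) (auto simp: moment_def)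
  qed simp
qed

section \<open>Moments, supremum norms and numerical constants\<close>

lemma abs_moment_nonneg: "abs_moment N V k \<ge> 0"
  unfolding abs_moment_def by simp

lemma moment_even_nonneg: "even k \<Longrightarrow> moment N V k \<ge> 0"
  unfolding moment_def by (rule integral_nonneg_AE) (simp add: zero_le_even_power)

lemma supnorm_upper:
  assumes "bounded (range f)"
  shows "\<bar>f x\<bar> \<le> supnorm f"
proof -
  obtain B where "\<And>x. \<bar>f x\<bar> \<le> B" using assms unfolding bounded_iff by auto
  then show ?thesis unfolding supnorm_def by (intro cSUP_upper) (auto intro!: bdd_aboveI2)
qed

lemma Cb3_derivatives:
  assumes "h \<in> Cb3"
  shows "\<And>x. (h has_real_derivative deriv h x) (at x)" "\<And>x. (deriv h has_real_derivative (deriv ^^ 2) h x) (at x)"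
    "\<And>x. ((deriv ^^ 2) h has_real_derivative (deriv ^^ 3) h x) (at x)" "continuous_on UNIV ((deriv ^^ 3) h)"
    "bounded (range h)" "bounded (range (deriv h))" "bounded (range ((deriv ^^ 2) h))" "bounded (range ((deriv ^^ 3) h))"
proof -
  have d: "(deriv ^^ k) h differentiable (at x)" if "k < 3" for k x using assms that by (auto simp: Cb3_def)
  have D: "((deriv ^^ k) h has_real_derivative (deriv ^^ (Suc k)) h x) (at x)" if "k < 3" for k x
    using d[OF that] by (simp add: DERIV_deriv_iff_real_differentiable)
  show "(h has_real_derivative deriv h x) (at x)" "(deriv h has_real_derivative (deriv ^^ 2) h x) (at x)"
    "((deriv ^^ 2) h has_real_derivative (deriv ^^ 3) h x) (at x)" for x
    using D[of 0 x] D[of 1 x] D[of 2 x] by (simp_all add: eval_nat_numeral)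
  show "continuous_on UNIV ((deriv ^^ 3) h)" using assms by (simp add: Cb3_def)
  have b: "bounded (range ((deriv ^^ k) h))" if "k \<le> 3" for k using assms that by (auto simp: Cb3_def)
  show "bounded (range h)" "bounded (range (deriv h))" "bounded (range ((deriv ^^ 2) h))" "bounded (range ((deriv ^^ 3) h))"
    using b[of 0] b[of 1] b[of 2] b[of 3] by simp_all
qed

text \<open>The left-hand side is sqrt (pi r / 2) + 1. The rational 6/5 has square 36/25 < 3/2, so
  pi > 3 is enough. This is what pays for the growth of the errors with sqrt r.\<close>

lemma c_const_lower:
  fixes r :: nat
  assumes "r \<ge> 1"
  shows "real r * c_const r \<ge> 6 / 5 * sqrt r + 1"
proof -
  have r: "real r > 0" using assms by simp
  have "(6 / 5 * sqrt r)\<^sup>2 = 36 / 25 * real r" by (simp add: power_mult_distrib power2_eq_square)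
  also have "\<dots> \<le> (real r)\<^sup>2 * (pi / (2 * real r))"
    using r pi_gt3 by (simp add: field_simps power2_eq_square)
  also have "\<dots> = (real r * sqrt (pi / (2 * real r)))\<^sup>2"
    using r by (simp add: power_mult_distrib)
  finally have "6 / 5 * sqrt r \<le> real r * sqrt (pi / (2 * real r))"
    by (rule power2_le_imp_le) (use r in auto)
  then show ?thesis using r by (simp add: c_const_def distrib_left)
qed

text \<open>The coefficients 5, 18, 19 are those of \<open>M3\<close> and the 9 is that of 9/m in
  \<open>gamma2\<close>. The large constant 231 is covered by \<open>R * m4 * H0\<close> and
  \<open>m4 * H0\<close> together: 1026/5 + 171 > 231.\<close>

lemma stage_X_numeric:
  fixes R :: real
  assumes "R \<ge> 1" "m4 \<ge> 1" "H0 \<ge> 0" "H1 \<ge> 0" "H2 \<ge> 0"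
  shows "(41 / 4 * H2 + 27 / 2 * H1) * (5 / 2 * R * m4) + (27 / 2 * H1 + 231 * H0)
    \<le> (6 / 5 * R + 1) * (9 * m4 * (5 * H2 + 18 * H1 + 19 * H0))"
proof -
  have T: "R * m4 \<ge> 1" using mult_mono[of 1 R 1 m4] assms by simp
  \<comment> \<open>With the products as unknowns, the remaining inequality is linear.\<close>
  define u2 u1 u0 v2 v1 v0 where "u2 = R * m4 * H2" "u1 = R * m4 * H1" "u0 = R * m4 * H0"
    "v2 = m4 * H2" "v1 = m4 * H1" "v0 = m4 * H0"
  note uv = this
  have p: "u2 \<ge> 0" "v2 \<ge> 0" "v1 \<ge> 0" "u1 \<ge> H1" "u0 \<ge> H0" "v0 \<ge> H0"
    unfolding uv using assms T mult_right_mono[OF T, of H1] mult_right_mono[OF T, of H0] mult_right_mono[of 1 m4 H0] by auto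
  have "(6 / 5 * R + 1) * (9 * m4 * (5 * H2 + 18 * H1 + 19 * H0)) - ((41 / 4 * H2 + 27 / 2 * H1) * (5 / 2 * R * m4) + (27 / 2 * H1 + 231 * H0))
    = (54 - 205 / 8) * (R * m4 * H2) + (972 / 5 - 135 / 4) * (R * m4 * H1) + 1026 / 5 * (R * m4 * H0) + 45 * (m4 * H2) + 162 * (m4 * H1) + 171 * (m4 * H0)
      - 27 / 2 * H1 - 231 * H0"
    by (simp add: algebra_simps)
  also have "\<dots> \<ge> 0" unfolding uv[symmetric] using p assms(3-5) by simp
  finally show ?thesis by simp
qed

text \<open>The coefficients 52, 124, 124 are those of \<open>M4\<close>. The bound is used with the
  fourth moment of X as \<open>m4\<close>, because the summand of \<open>gamma3\<close> with 1/n
  contains the product of both fourth moments.\<close>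

lemma stage_Y_numeric:
  fixes R :: real
  assumes "R \<ge> 1" "m4 \<ge> 1" "H0 \<ge> 0" "H1 \<ge> 0" "H2 \<ge> 0"
  shows "(41 / 4 * H2 + 27 / 2 * H1) * (2 * R) + (27 / 2 * H1 + 231 * H0)
    \<le> (6 / 5 * R + 1) * (m4 * (52 * H2 + 124 * H1 + 124 * H0))"
proof -
  define u2 u1 u0 where "u2 = R * H2" "u1 = R * H1" "u0 = R * H0"
  note uv = this
  have p: "u2 \<ge> 0" "u1 \<ge> H1" "u0 \<ge> H0"
    unfolding uv using assms mult_right_mono[of 1 R H1] mult_right_mono[of 1 R H0] by auto
  have "(6 / 5 * R + 1) * (52 * H2 + 124 * H1 + 124 * H0) - ((41 / 4 * H2 + 27 / 2 * H1) * (2 * R) + (27 / 2 * H1 + 231 * H0))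
    = (312 / 5 - 41 / 2) * (R * H2) + (744 / 5 - 27) * (R * H1) + 744 / 5 * (R * H0) + 52 * H2 + (124 - 27 / 2) * H1 + (124 - 231) * H0"
    by (simp add: algebra_simps)
  also have "\<dots> \<ge> 0" unfolding uv[symmetric] using p assms(3-5) by simp
  finally have "(41 / 4 * H2 + 27 / 2 * H1) * (2 * R) + (27 / 2 * H1 + 231 * H0) \<le> (6 / 5 * R + 1) * (1 * (52 * H2 + 124 * H1 + 124 * H0))"
    by simp
  also have "\<dots> \<le> (6 / 5 * R + 1) * (m4 * (52 * H2 + 124 * H1 + 124 * H0))"
    using assms by (intro mult_left_mono mult_right_mono) auto
  finally show ?thesis .
qed

theorem theorem4p9:
  fixes m n r :: nat
    and M :: "'a measure" and Xs Ys :: "nat \<Rightarrow> nat \<Rightarrow> 'a \<Rightarrow> real"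
    and A :: "'b measure" and X :: "'b \<Rightarrow> real"
    and B :: "'c measure" and Y :: "'c \<Rightarrow> real"
    and h :: "real \<Rightarrow> real"
  assumes "m \<ge> 1" and "n \<ge> 1" and "r \<ge> 1"
    and "prob_space M" and "prob_space A" and "prob_space B"
    and "X \<in> borel_measurable A" and "Y \<in> borel_measurable B"
    and "integrable A (\<lambda>\<omega>. X \<omega> ^ 6)" and "integrable B (\<lambda>\<omega>. Y \<omega> ^ 6)"
    and "prob_space.expectation A X = 0" and "prob_space.expectation B Y = 0"
    and "prob_space.variance A X = 1" and "prob_space.variance B Y = 1"
    and "\<And>i k. i \<in> {1..m} \<Longrightarrow> k \<in> {1..r} \<Longrightarrow> distr M borel (Xs i k) = distr A borel X"
    and "\<And>j k. j \<in> {1..n} \<Longrightarrow> k \<in> {1..r} \<Longrightarrow> distr M borel (Ys j k) = distr B borel Y"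
    and "prob_space.indep_vars M (\<lambda>_. borel)
           (case_sum (\<lambda>(i, k). Xs i k) (\<lambda>(j, k). Ys j k))
           (({1..m} \<times> {1..r}) <+> ({1..n} \<times> {1..r}))"
    and "h \<in> Cb3"
  shows "\<bar>prob_space.expectation M (\<lambda>\<omega>. h (W m n r Xs Ys \<omega>)) - VG r h\<bar>
     \<le> r * (gamma1 m n A X B Y * M2 r h + gamma2 m n A X B Y * M3 r h
             + gamma3 m n A X B Y * M4 r h)"
proof -
  interpret M: prob_space M by fact
  define K :: "nat set" where "K = {1..r}"
  have K: "finite K" "K \<noteq> {}" "card K = r" using assms(3) by (auto simp: K_def)
  define H0 where "H0 = supnorm (centred r h)"
  define H1 where "H1 = supnorm (deriv h)"
  define H2 where "H2 = supnorm ((deriv ^^ 2) h)"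
  define H3 where "H3 = supnorm ((deriv ^^ 3) h)"
  define x3 where "x3 = moment A X 3"
  define x4 where "x4 = moment A X 4"
  define y3 where "y3 = abs_moment B Y 3"
  define y4 where "y4 = moment B Y 4"
  note h = Cb3_derivatives[OF assms(18)]
  have "bounded (range (centred r h))"
  proof -
    obtain C where C: "\<And>x. \<bar>h x\<bar> \<le> C" using h(5) unfolding bounded_iff by auto
    have "\<bar>centred r h x\<bar> \<le> C + \<bar>VG r h\<bar>" for x using C[of x] unfolding centred_def by linarith
    then show ?thesis unfolding bounded_iff by auto
  qed
  from supnorm_upper[OF this] have b0: "\<bar>h x - VG r h\<bar> \<le> H0" for x unfolding H0_def centred_def .
  have b: "\<bar>deriv h x\<bar> \<le> H1" "\<bar>(deriv ^^ 2) h x\<bar> \<le> H2" "\<bar>(deriv ^^ 3) h x\<bar> \<le> H3" for x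
    unfolding H1_def H2_def H3_def using h supnorm_upper by auto
  have Hp: "H0 \<ge> 0" "H1 \<ge> 0" "H2 \<ge> 0" "H3 \<ge> 0"
    using b0[of 0] b(1)[of 0] b(2)[of 0] b(3)[of 0] by auto
  interpret X: moment_law "distr A borel X" x3 "abs_moment A X 3" x4
    unfolding x3_def x4_def by (rule moment_law_distr) fact+
  interpret Y: moment_law "distr B borel Y" "moment B Y 3" y3 y4
    unfolding y3_def y4_def by (rule moment_law_distr) fact+
  \<comment> \<open>Centring at \<open>VG r h\<close> makes \<open>H0\<close> the supremum norm of
    the centred function in the theorem.\<close>
  interpret P: product_clt "distr A borel X" x3 "abs_moment A X 3" x4 "distr B borel Y" "moment B Y 3" y3 y4
    K m n h "deriv h" "(deriv ^^ 2) h" "(deriv ^^ 3) h" "VG r h" H0 H1 H2 H3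
    by unfold_locales (use assms(1,2) K h(1-4) b0 b in auto)
  let ?I = "{1..m} \<times> K" and ?J = "{1..n} \<times> K"
  let ?F = "\<lambda>(i, k). Xs i k" and ?H = "\<lambda>(j, k). Ys j k"
  have ne: "?I \<noteq> {}" "?J \<noteq> {}" using assms(1,2) K by auto
  let ?T = "\<lambda>\<omega>. (\<lambda>p\<in>?I. ?F p \<omega>, \<lambda>p\<in>?J. ?H p \<omega>)"
  let ?B = "PiM ?I (\<lambda>_. borel) \<Otimes>\<^sub>M PiM ?J (\<lambda>_. borel) :: ((nat \<times> nat \<Rightarrow> real) \<times> (nat \<times> nat \<Rightarrow> real)) measure"
  let ?g = "\<lambda>p. h (X.lin m K (col_sum n (snd p)) (fst p))"
  have law: "distr M ?B ?T = P.PX \<Otimes>\<^sub>M P.PY"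
    by (rule M.distr_two_families) (use assms(15-17) ne in \<open>auto simp: K_def\<close>)
  have rv: "Xs i k \<in> borel_measurable M" if "(i, k) \<in> ?I" for i k
    using assms(17) that unfolding M.indep_vars_def K_def by (auto dest!: bspec[where x = "Inl (i, k)"])
  have rv': "Ys j k \<in> borel_measurable M" if "(j, k) \<in> ?J" for j k
    using assms(17) that unfolding M.indep_vars_def K_def by (auto dest!: bspec[where x = "Inr (j, k)"])
  have T: "?T \<in> measurable M ?B"
    by (intro measurable_Pair measurable_restrict) (use rv rv' in auto)
  \<comment> \<open>For each \<open>k\<close> the double sum over \<open>i\<close> and
    \<open>j\<close> factors, so the statistic is the linear form \<open>lin\<close> in the X sample
    with the column sums of the Y sample as weights.\<close>
  have Wg: "h (W m n r Xs Ys \<omega>) = ?g (?T \<omega>)" for \<omega>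
  proof -
    have "W m n r Xs Ys \<omega> = 1 / sqrt (real m * real n) * (\<Sum>i=1..m. \<Sum>k\<in>K. \<Sum>j=1..n. Xs i k \<omega> * Ys j k \<omega>)"
      unfolding W_def K_def by (intro arg_cong[where f = "\<lambda>x. _ * x"] sum.cong refl sum.swap)
    also have "(\<Sum>i=1..m. \<Sum>k\<in>K. \<Sum>j=1..n. Xs i k \<omega> * Ys j k \<omega>) = (\<Sum>k\<in>K. \<Sum>i=1..m. \<Sum>j=1..n. Xs i k \<omega> * Ys j k \<omega>)"
      by (rule sum.swap)
    also have "\<dots> = (\<Sum>k\<in>K. (\<Sum>i=1..m. Xs i k \<omega>) * (\<Sum>j=1..n. Ys j k \<omega>))"
      by (simp add: sum_product)
    also have "1 / sqrt (real m * real n) * \<dots> = X.lin m K (col_sum n (\<lambda>p\<in>?J. ?H p \<omega>)) (\<lambda>p\<in>?I. ?F p \<omega>)"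
    proof -
      have "(\<Sum>j=1..n. (\<lambda>p\<in>?J. ?H p \<omega>) (j, k)) = (\<Sum>j=1..n. Ys j k \<omega>)"
        "(\<Sum>i=1..m. (\<lambda>p\<in>?I. ?F p \<omega>) (i, k)) = (\<Sum>i=1..m. Xs i k \<omega>)" if "k \<in> K" for k
        using that by (auto intro!: sum.cong)
      then show ?thesis
        unfolding X.lin_def col_sum_def
        by (subst sum_distrib_left, intro sum.cong refl) (simp add: real_sqrt_mult mult.commute del: One_nat_def)
    qed
    finally show ?thesis by simp
  qed
  have mg: "?g \<in> borel_measurable (P.PX \<Otimes>\<^sub>M P.PY)"
    using measurable_compose[OF measurable_pair_swap' measurable_compose[OF P.inner_YX_measurable P.h_measurable]]
    by (simp add: case_prod_unfold)
  then have mgB: "?g \<in> borel_measurable ?B"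
    using law by (metis (no_types, lifting) measurable_cong_sets sets_distr)
  have gi: "integrable (P.PX \<Otimes>\<^sub>M P.PY) ?g"
  proof -
    interpret XY: pair_prob_space P.PX P.PY ..
    show ?thesis by (rule XY.integrable_const_bound[where B = P.hb, OF _ mg]) (auto simp: P.h_bound)
  qed
  have "M.expectation (\<lambda>\<omega>. h (W m n r Xs Ys \<omega>)) = integral\<^sup>L (distr M ?B ?T) ?g"
    unfolding Wg by (rule integral_distr[OF T mgB, symmetric])
  also have "\<dots> = (\<integral>y. (\<integral>x. h (X.lin m K (col_sum n y) x) \<partial>P.PX) \<partial>P.PY)"
  proof -
    interpret XY: pair_prob_space P.PX P.PY ..
    show ?thesis unfolding law using XY.integral_snd[of "\<lambda>x y. h (X.lin m K (col_sum n y) x)"] gi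
      by (simp add: case_prod_unfold)
  qed
  finally have E: "M.expectation (\<lambda>\<omega>. h (W m n r Xs Ys \<omega>)) = (\<integral>y. (\<integral>x. h (X.lin m K (col_sum n y) x) \<partial>P.PX) \<partial>P.PY)" .
  define R where "R = sqrt (real r)"
  define Q where "Q = real r * c_const r"
  have R: "R \<ge> 1" using assms(3) by (simp add: R_def)
  have Q: "Q \<ge> 6 / 5 * R + 1" unfolding Q_def R_def by (rule c_const_lower[OF assms(3)])
  have mp: "real m > 0" "real n > 0" using assms(1,2) by auto
  have mom: "x4 \<ge> 1" "y4 \<ge> 1" "y3 \<ge> 1" using X.law_moment_facts Y.law_moment_facts by auto
  have cp: "c_const r \<ge> 0" by (auto simp: c_const_def)
  have Mn: "M2 r h \<ge> 0" "M3 r h \<ge> 0" "M4 r h \<ge> 0"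
    unfolding M2_def M3_def M4_def H0_def[symmetric] H1_def[symmetric] H2_def[symmetric] H3_def[symmetric]
    using Hp cp by auto
  have "\<bar>M.expectation (\<lambda>\<omega>. h (W m n r Xs Ys \<omega>)) - VG r h\<bar> \<le>
     x4 / real m * ((41 / 4 * H2 + 27 / 2 * H1) * (5 / 2 * R * y4) + (27 / 2 * H1 + 231 * H0))
     + y4 / real n * ((41 / 4 * H2 + 27 / 2 * H1) * (2 * R) + (27 / 2 * H1 + 231 * H0))
     + \<bar>x3\<bar> * y3 / sqrt (real m * real n) * (R * (6 * H1 + 21 / 2 * H0))"
    unfolding E R_def using P.product_clt K(3) by simp
  \<comment> \<open>Each error is brought to the shape of one summand: the first as 9 y4 with the
    coefficients of \<open>M3\<close>, the other two as x4 and 135 x4 with those of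
    \<open>M4\<close>. The factors x4 >= 1 and y4 >= 1 may be inserted freely, and \<open>Q\<close>
    absorbs the growth with \<open>R\<close>.\<close>
  also have "\<dots> \<le> x4 / real m * (Q * (9 * y4 * (5 * H2 + 18 * H1 + 19 * H0)))
     + y4 / real n * (Q * (x4 * (52 * H2 + 124 * H1 + 124 * H0)))
     + \<bar>x3\<bar> * y3 / sqrt (real m * real n) * (Q * (135 * x4 * (52 * H2 + 124 * H1 + 124 * H0)))"
  proof (intro add_mono mult_left_mono)
    show "(41 / 4 * H2 + 27 / 2 * H1) * (5 / 2 * R * y4) + (27 / 2 * H1 + 231 * H0) \<le> Q * (9 * y4 * (5 * H2 + 18 * H1 + 19 * H0))"
      using mom Hp Q by (intro order_trans[OF stage_X_numeric[OF R mom(2) Hp(1,2,3)] mult_right_mono]) auto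
    show "(41 / 4 * H2 + 27 / 2 * H1) * (2 * R) + (27 / 2 * H1 + 231 * H0) \<le> Q * (x4 * (52 * H2 + 124 * H1 + 124 * H0))"
      using mom Hp Q by (intro order_trans[OF stage_Y_numeric[OF R mom(1) Hp(1,2,3)] mult_right_mono]) auto
    have "R * (6 * H1 + 21 / 2 * H0) \<le> Q * (135 * 1 * (52 * H2 + 124 * H1 + 124 * H0))"
      using Q R Hp by (intro mult_mono) auto
    also have "\<dots> \<le> Q * (135 * x4 * (52 * H2 + 124 * H1 + 124 * H0))"
      using Q R Hp mom by (intro mult_left_mono mult_right_mono) auto
    finally show "R * (6 * H1 + 21 / 2 * H0) \<le> Q * (135 * x4 * (52 * H2 + 124 * H1 + 124 * H0))" .
  qed (use mom mp in auto)
  also have "\<dots> = real r * ((9 / real m * x4 * y4) * (c_const r * (5 * H2 + 18 * H1 + 19 * H0))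
     + (1 / real n * x4 * y4 + 135 / sqrt (real m * real n) * \<bar>x3\<bar> * x4 * y3) * (c_const r * (52 * H2 + 124 * H1 + 124 * H0)))"
    unfolding Q_def by (simp add: distrib_right distrib_left mult_ac)
  also have "\<dots> \<le> real r * (gamma1 m n A X B Y * M2 r h + gamma2 m n A X B Y * M3 r h + gamma3 m n A X B Y * M4 r h)"
  proof (rule mult_left_mono)
    \<comment> \<open>From here on all comparisons are termwise: every summand of the three gammas
      and of \<open>M2\<close>, \<open>M3\<close>, \<open>M4\<close> is nonnegative.\<close>
    have "0 \<le> gamma1 m n A X B Y * M2 r h"
      unfolding gamma1_def using Mn(1) by (intro mult_nonneg_nonneg add_nonneg_nonneg abs_moment_nonneg moment_even_nonneg) auto
    moreover have "(9 / real m * x4 * y4) * (c_const r * (5 * H2 + 18 * H1 + 19 * H0)) \<le> gamma2 m n A X B Y * M3 r h"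
    proof (rule mult_mono)
      have "0 \<le> 30 / real n * \<bar>moment B Y 3\<bar> * moment B Y 4 + 85 / sqrt (real m * real n) * \<bar>moment A X 3\<bar> * abs_moment B Y 5
        + 46 / sqrt (real m * real n) * abs_moment A X 3 * \<bar>moment B Y 3\<bar> * moment B Y 4"
        by (intro mult_nonneg_nonneg add_nonneg_nonneg abs_moment_nonneg moment_even_nonneg) auto
      then show "9 / real m * x4 * y4 \<le> gamma2 m n A X B Y"
        unfolding gamma2_def x4_def y4_def by linarith
      then show "0 \<le> gamma2 m n A X B Y"
        using mom mp by (intro order_trans[OF _ \<open>9 / real m * x4 * y4 \<le> gamma2 m n A X B Y\<close>]) auto
      show "c_const r * (5 * H2 + 18 * H1 + 19 * H0) \<le> M3 r h"
        unfolding M3_def H0_def H1_def H2_def by simp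
    qed (use cp Hp in auto)
    moreover have "(1 / real n * x4 * y4 + 135 / sqrt (real m * real n) * \<bar>x3\<bar> * x4 * y3) * (c_const r * (52 * H2 + 124 * H1 + 124 * H0))
       \<le> gamma3 m n A X B Y * M4 r h"
    proof (rule mult_mono)
      have "0 \<le> 1 / real n * moment A X 4 * moment B Y 4 * (15 * \<bar>moment B Y 3\<bar>)
         + 284 / real m * \<bar>moment A X 3\<bar> * abs_moment A X 3 * moment B Y 6
         + 148 / real n * moment A X 4 * \<bar>moment B Y 3\<bar> * abs_moment B Y 5
         + 248 / sqrt (real m * real n) * moment A X 4 * \<bar>moment B Y 3\<bar>"
        by (intro mult_nonneg_nonneg add_nonneg_nonneg abs_moment_nonneg moment_even_nonneg) auto
      then show le: "1 / real n * x4 * y4 + 135 / sqrt (real m * real n) * \<bar>x3\<bar> * x4 * y3 \<le> gamma3 m n A X B Y"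
        unfolding gamma3_def x4_def y4_def x3_def y3_def by (simp add: distrib_left)
      show "0 \<le> gamma3 m n A X B Y"
        using mom mp by (intro order_trans[OF _ le]) auto
      show "c_const r * (52 * H2 + 124 * H1 + 124 * H0) \<le> M4 r h"
        unfolding M4_def H0_def[symmetric] H1_def[symmetric] H2_def[symmetric] H3_def[symmetric]
        using cp Hp by (intro mult_left_mono) auto
    qed (use cp Hp in auto)
    ultimately show "(9 / real m * x4 * y4) * (c_const r * (5 * H2 + 18 * H1 + 19 * H0))
     + (1 / real n * x4 * y4 + 135 / sqrt (real m * real n) * \<bar>x3\<bar> * x4 * y3) * (c_const r * (52 * H2 + 124 * H1 + 124 * H0))
      \<le> gamma1 m n A X B Y * M2 r h + gamma2 m n A X B Y * M3 r h + gamma3 m n A X B Y * M4 r h"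
      by linarith
  qed simp
  finally show ?thesis .
qed

end
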